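(* Let $\mathbf{k}$ be an uncountable, algebraically closed field. Let $f$ be a birational transformation of $\mathbb{P}^m_{\mathbf{k}}$ of degree $d\geq 2$. There exists an automorphism $A\in\mathrm{PGL}_{m+1}(\mathbf{k})$ such that $A\circ f$ is not regularizable.
   Context: The degree of a birational transformation of $\mathbb{P}^m_{\mathbf{k}}$ is its degree with respect to $\mathcal{O}(1)$ (the common degree of homogeneous polynomials without common factor defining it). A birational transformation $g\colon M\dashrightarrow M$ of a smooth irreducible projective variety $M$ is regularizable if there exist a smooth projective variety $V$ and a birational map $\varphi\colon V\dashrightarrow M$ such that $\varphi^{-1}\circ g\circ\varphi$ is an automorphism of $V$. *)

theory Defs
  imports
    "HOL-Library.Poly_Mapping"
    "HOL-Library.Countable_Set"
    "HOL-Library.Extended_Nat"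
    "HOL-Analysis.Abstract_Topology"
    "Jordan_Normal_Form.VS_Connect"
begin

section \<open>Polynomials in the variables \<open>x\<^sub>0, x\<^sub>1, \<dots>\<close>\<close>

text \<open>A monomial is a finitely supported exponent vector, a polynomial a finitely supported
  family of coefficients; ring structure and divisibility are those of \<^theory>\<open>HOL-Library.Poly_Mapping\<close>.\<close>

type_synonym 'k mpoly = "(nat \<Rightarrow>\<^sub>0 nat) \<Rightarrow>\<^sub>0 'k"

definition eval :: "'k::field mpoly \<Rightarrow> 'k vec \<Rightarrow> 'k" where
  "eval p v = (\<Sum>m\<in>Poly_Mapping.keys p. Poly_Mapping.lookup p m *
                 (\<Prod>i\<in>Poly_Mapping.keys m. (v $ i) ^ Poly_Mapping.lookup m i))"

definition pdiff :: "nat \<Rightarrow> 'k::field mpoly \<Rightarrow> 'k mpoly" where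
  "pdiff i p = (\<Sum>m\<in>Poly_Mapping.keys p. Poly_Mapping.single (m - Poly_Mapping.single i 1)
                  (of_nat (Poly_Mapping.lookup m i) * Poly_Mapping.lookup p m))"

text \<open>Forms of degree \<open>d\<close> in \<open>x\<^sub>0, \<dots>, x\<^sub>n\<close>; the zero polynomial is a form of every degree.\<close>

definition forms :: "nat \<Rightarrow> nat \<Rightarrow> 'k::field mpoly set" where
  "forms n d = {p. \<forall>m\<in>Poly_Mapping.keys p. Poly_Mapping.keys m \<subseteq> {..n} \<and>
                     (\<Sum>i\<in>Poly_Mapping.keys m. Poly_Mapping.lookup m i) = d}"

section \<open>Projective space and projective varieties\<close>

text \<open>The point of projective space represented by a nonzero vector \<open>v\<close> is the punctured line
  through \<open>v\<close>, i.e. the set of all homogeneous coordinate vectors of that point.\<close>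

type_synonym 'k point = "'k vec set"

definition point_of :: "'k::field vec \<Rightarrow> 'k point" where
  "point_of v = {c \<cdot>\<^sub>v v | c. c \<noteq> 0}"

definition projectivization :: "nat \<Rightarrow> 'k::field point set" where
  "projectivization N = {point_of v | v. v \<in> carrier_vec N \<and> v \<noteq> 0\<^sub>v N}"

abbreviation proj_space :: "nat \<Rightarrow> 'k::field point set" where
  "proj_space n \<equiv> projectivization (Suc n)"

definition basic_open :: "nat \<Rightarrow> 'k::field mpoly \<Rightarrow> 'k point set" where
  "basic_open n F = {p \<in> proj_space n. \<forall>v\<in>p. eval F v \<noteq> 0}"

definition zariski :: "nat \<Rightarrow> 'k::field point topology" where
  "zariski n = topology_generated_by {basic_open n F | F d. F \<in> forms n d}"

abbreviation zariski_on :: "nat \<Rightarrow> 'k::field point set \<Rightarrow> 'k point topology" where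
  "zariski_on n X \<equiv> subtopology (zariski n) X"

definition irreducible_space :: "'a topology \<Rightarrow> bool" where
  "irreducible_space T \<longleftrightarrow> topspace T \<noteq> {} \<and>
     (\<forall>C D. closedin T C \<and> closedin T D \<and> C \<union> D = topspace T \<longrightarrow> C = topspace T \<or> D = topspace T)"

text \<open>Krull dimension: supremum of the lengths \<open>r\<close> of chains \<open>Z\<^sub>0 \<subset> \<dots> \<subset> Z\<^sub>r\<close> of irreducible
  closed subsets.\<close>

definition krull_dim :: "'a topology \<Rightarrow> enat" where
  "krull_dim T = Sup {enat r | r. \<exists>Z. (\<forall>i\<le>r. closedin T (Z i) \<and> irreducible_space (subtopology T (Z i)))
                                   \<and> (\<forall>i<r. Z i \<subset> Z (Suc i))}"

definition projective_variety :: "nat \<Rightarrow> 'k::field point set \<Rightarrow> bool" where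
  "projective_variety n X \<longleftrightarrow> closedin (zariski n) X \<and> irreducible_space (zariski_on n X)"

definition vanishing_forms :: "nat \<Rightarrow> 'k::field point set \<Rightarrow> 'k mpoly set" where
  "vanishing_forms n X = {F. (\<exists>d. F \<in> forms n d) \<and> (\<forall>p\<in>X. \<forall>v\<in>p. eval F v = 0)}"

text \<open>Tangent space at \<open>v\<close> of the affine cone over \<open>X\<close>. The tangent space of \<open>X\<close> at the point
  represented by \<open>v\<close> is its quotient by the line through \<open>v\<close> (Euler's formula shows that this line
  is contained in it), so nonsingularity at that point means that the dimension here is
  \<open>dim X + 1\<close>.\<close>

definition cone_tangent_space :: "nat \<Rightarrow> 'k::field point set \<Rightarrow> 'k vec \<Rightarrow> 'k vec set" where
  "cone_tangent_space n X v =
     {w \<in> carrier_vec (Suc n). \<forall>F\<in>vanishing_forms n X. (\<Sum>i\<le>n. eval (pdiff i F) v * w $ i) = 0}"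

definition smooth :: "nat \<Rightarrow> 'k::field point set \<Rightarrow> bool" where
  "smooth n X \<longleftrightarrow> (\<forall>p\<in>X. \<forall>v\<in>p.
     enat (vectorspace.dim class_ring
             ((module_vec TYPE('k) (Suc n))\<lparr>carrier := cone_tangent_space n X v\<rparr>))
       = krull_dim (zariski_on n X) + 1)"

section \<open>Regular and rational maps\<close>

text \<open>Maps are partial functions on points. Throughout, \<open>X\<close> is a subset of projective \<open>n\<close>-space
  and \<open>Y\<close> a subset of projective \<open>r\<close>-space.\<close>

definition given_by :: "nat \<Rightarrow> (nat \<Rightarrow> 'k::field mpoly) \<Rightarrow> ('k point \<rightharpoonup> 'k point) \<Rightarrow> 'k point set \<Rightarrow> bool" where
  "given_by r F f W \<longleftrightarrow> (\<forall>p\<in>W. \<forall>v\<in>p.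
     vec (Suc r) (\<lambda>i. eval (F i) v) \<noteq> 0\<^sub>v (Suc r) \<and> f p = Some (point_of (vec (Suc r) (\<lambda>i. eval (F i) v))))"

text \<open>Regular on \<open>U\<close>: locally given by forms of equal degree without common zero.\<close>

definition regular_on :: "nat \<Rightarrow> nat \<Rightarrow> ('k::field point \<rightharpoonup> 'k point) \<Rightarrow> 'k point set \<Rightarrow> bool" where
  "regular_on n r f U \<longleftrightarrow> (\<forall>p\<in>U. \<exists>W d F. openin (zariski_on n U) W \<and> p \<in> W \<and>
     (\<forall>i\<le>r. F i \<in> forms n d) \<and> given_by r F f W)"

definition regular_map ::
  "nat \<Rightarrow> 'k::field point set \<Rightarrow> nat \<Rightarrow> 'k point set \<Rightarrow> ('k point \<rightharpoonup> 'k point) \<Rightarrow> bool" where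
  "regular_map n X r Y f \<longleftrightarrow> dom f = X \<and> ran f \<subseteq> Y \<and> regular_on n r f X"

definition automorphism :: "nat \<Rightarrow> 'k::field point set \<Rightarrow> ('k point \<rightharpoonup> 'k point) \<Rightarrow> bool" where
  "automorphism n X a \<longleftrightarrow> regular_map n X n X a \<and>
     (\<exists>b. regular_map n X n X b \<and> b \<circ>\<^sub>m a = Some |` X \<and> a \<circ>\<^sub>m b = Some |` X)"

text \<open>A rational map from an irreducible \<open>X\<close> to \<open>Y\<close> is represented by a regular map on some nonempty
  open subset of \<open>X\<close> (not necessarily the largest one); representatives are identified when they
  agree on a nonempty open subset of \<open>X\<close>.\<close>

definition rational_map ::
  "nat \<Rightarrow> 'k::field point set \<Rightarrow> nat \<Rightarrow> 'k point set \<Rightarrow> ('k point \<rightharpoonup> 'k point) \<Rightarrow> bool" where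
  "rational_map n X r Y f \<longleftrightarrow> openin (zariski_on n X) (dom f) \<and> dom f \<noteq> {} \<and>
     ran f \<subseteq> Y \<and> regular_on n r f (dom f)"

definition rat_eq ::
  "nat \<Rightarrow> 'k::field point set \<Rightarrow> ('k point \<rightharpoonup> 'k point) \<Rightarrow> ('k point \<rightharpoonup> 'k point) \<Rightarrow> bool" where
  "rat_eq n X f g \<longleftrightarrow> (\<exists>U. openin (zariski_on n X) U \<and> U \<noteq> {} \<and> U \<subseteq> dom f \<inter> dom g \<and> (\<forall>p\<in>U. f p = g p))"

definition birational_inverse ::
  "nat \<Rightarrow> 'k::field point set \<Rightarrow> nat \<Rightarrow> 'k point set \<Rightarrow> ('k point \<rightharpoonup> 'k point) \<Rightarrow> ('k point \<rightharpoonup> 'k point) \<Rightarrow> bool" where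
  "birational_inverse n X r Y f g \<longleftrightarrow> rational_map r Y n X g \<and>
     rat_eq n X (g \<circ>\<^sub>m f) Some \<and> rat_eq r Y (f \<circ>\<^sub>m g) Some"

definition birational_map ::
  "nat \<Rightarrow> 'k::field point set \<Rightarrow> nat \<Rightarrow> 'k point set \<Rightarrow> ('k point \<rightharpoonup> 'k point) \<Rightarrow> bool" where
  "birational_map n X r Y f \<longleftrightarrow> rational_map n X r Y f \<and> (\<exists>g. birational_inverse n X r Y f g)"

text \<open>\<open>d\<close> is the common degree of forms without common factor defining the rational transformation
  \<open>f\<close> of projective \<open>m\<close>-space. If all \<open>F i\<close> vanished, every polynomial would be a common factor.\<close>

definition has_degree :: "nat \<Rightarrow> ('k::field point \<rightharpoonup> 'k point) \<Rightarrow> nat \<Rightarrow> bool" where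
  "has_degree m f d \<longleftrightarrow> (\<exists>F. (\<forall>i\<le>m. F i \<in> forms m d) \<and> (\<forall>G. (\<forall>i\<le>m. G dvd F i) \<longrightarrow> G dvd 1) \<and>
     (\<exists>W. openin (zariski m) W \<and> W \<noteq> {} \<and> given_by m F f W))"

definition regularizable :: "nat \<Rightarrow> 'k::field point set \<Rightarrow> ('k point \<rightharpoonup> 'k point) \<Rightarrow> bool" where
  "regularizable m M g \<longleftrightarrow> (\<exists>n V \<phi> \<psi> a.
     projective_variety n V \<and> smooth n V \<and>
     birational_map n V m M \<phi> \<and> birational_inverse n V m M \<phi> \<psi> \<and>
     automorphism n V a \<and> rat_eq n V (\<psi> \<circ>\<^sub>m g \<circ>\<^sub>m \<phi>) a)"

section \<open>Projective linear transformations\<close>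

definition projectivity :: "'k::field mat \<Rightarrow> 'k point \<rightharpoonup> 'k point" where
  "projectivity A = (\<lambda>p. Some ((\<lambda>v. A *\<^sub>v v) ` p)) |` projectivization (dim_col A)"

definition PGL :: "nat \<Rightarrow> ('k::field point \<rightharpoonup> 'k point) set" where
  "PGL N = {projectivity A | A. A \<in> carrier_mat N N \<and> invertible_mat A}"

end

theory Submission
  imports Defs "Jordan_Normal_Form.Char_Poly"
begin

text \<open>
  Let \<open>F\<close> and \<open>G\<close> be systems of forms without common factor which represent \<open>f\<close> and its inverse, so that
  \<open>F(G(y))\<close> and \<open>G(F(y))\<close> are multiples of \<open>y\<close>. Since \<open>f\<close> has degree at least two, \<open>F(G(q)) = 0\<close> for some
  \<open>q \<noteq> 0\<close>: the inverse of \<open>f\<close> contracts the hypersurface \<open>F(G(y)) = 0\<close>. Let \<open>g = A \<circ> f\<close> with a very general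
  matrix \<open>A\<close>, represented by \<open>A \<circ> F\<close>, and let \<open>B\<close> be the adjugate of \<open>A\<close>, so that \<open>G \<circ> B\<close> represents the inverse of
  \<open>g\<close>. Write \<open>Z\<^sub>k\<close> for the set of points \<open>y\<close> with \<open>(A \<circ> F)^k ((G \<circ> B)^k (y)) = 0\<close>, the union of the hypersurfaces
  contracted by the \<open>k\<close>-th iterate of the inverse; it grows with \<open>k\<close>. Two properties of the \<open>Z\<^sub>k\<close>
  contradict each other if \<open>g\<close> is regularizable.

  First, suppose that \<open>g\<close> becomes an automorphism \<open>a\<close> of a projective variety \<open>V\<close>. A nonempty open part of \<open>V\<close> is
  identified with an open part of projective space. Closures of forward orbits of the inverse of \<open>a\<close> form a decreasing
  sequence of closed sets, which stabilizes because \<open>V\<close> is Noetherian; hence every point of the open part returns to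
  it infinitely often (\<open>recurrence\<close>). At each return time \<open>k\<close> the \<open>k\<close>-th iterate of the inverse of \<open>g\<close> is regular at
  the point and the \<open>k\<close>-th iterate of \<open>g\<close> is regular at its image (\<open>regularizable_recurrence\<close>). For very general \<open>A\<close>
  the iterates \<open>(A \<circ> F)^k\<close> and \<open>(G \<circ> B)^k\<close> have no common factor, so regularity means that these forms do not all vanish
  (\<open>parallel_forms_vanish\<close>), and the point does not lie on \<open>Z\<^sub>k\<close>. Thus all \<open>Z\<^sub>k\<close> lie in one hypersurface \<open>T = 0\<close>.

  Second, an increasing sequence of hypersurfaces inside a fixed one is eventually constant
  (\<open>hypersurface_chain_stabilizes\<close>). But for very general \<open>A\<close> the points \<open>q\<^sub>k = (A \<circ> F)^k (A q)\<close> are defined for all \<open>k\<close>,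
  \<open>g\<close> is locally invertible at each of them, and therefore \<open>q\<^sub>k\<close> lies on \<open>Z\<^sub>k\<^sub>+\<^sub>1\<close> but not on \<open>Z\<^sub>k\<close>
  (\<open>round_trip_orb\<close>).

  That \<open>A\<close> can be chosen so is a matter of countably many conditions, each of which persists on a polynomial curve of
  matrices with finitely many exceptions (\<open>thick\<close>); as the field is uncountable, it is enough to satisfy
  each family of conditions by one matrix, possibly a singular one (\<open>thick_meet\<close>). For the points \<open>q\<^sub>k\<close>, any general
  matrix of rank one will do, since its orbits consist of multiples of a single vector (\<open>orbit_avoids_nonempty\<close>). The absence of a
  common factor is expressed by the existence of a line on which the forms have no common zero (\<open>free_line\<close>,
  \<open>exists_free_line\<close>); for the iterates, project onto such a line by a matrix of rank two, so that the line is mapped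
  to itself (\<open>iterates_avoid_zero_nonempty\<close>).
\<close>

section \<open>Evaluating polynomials in commutative rings\<close>

abbreviation monomial_value :: "(nat \<Rightarrow> 'r::comm_ring_1) \<Rightarrow> (nat \<Rightarrow>\<^sub>0 nat) \<Rightarrow> 'r" where
  "monomial_value w m \<equiv> (\<Prod>i\<in>Poly_Mapping.keys m. w i ^ Poly_Mapping.lookup m i)"

definition peval :: "('k::comm_ring_1 \<Rightarrow> 'r::comm_ring_1) \<Rightarrow> (nat \<Rightarrow> 'r) \<Rightarrow> ((nat \<Rightarrow>\<^sub>0 nat) \<Rightarrow>\<^sub>0 'k) \<Rightarrow> 'r" where
  "peval \<kappa> w p = (\<Sum>m\<in>Poly_Mapping.keys p. \<kappa> (Poly_Mapping.lookup p m) * monomial_value w m)"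

lemma monomial_value_superset:
  assumes "finite A" "Poly_Mapping.keys m \<subseteq> A"
  shows "monomial_value w m = (\<Prod>i\<in>A. w i ^ Poly_Mapping.lookup m i)"
  by (rule prod.mono_neutral_left) (use assms in \<open>auto simp: in_keys_iff\<close>)

lemma monomial_value_add:
  "monomial_value w (m + m') = monomial_value w m * monomial_value w m'"
proof -
  let ?A = "Poly_Mapping.keys m \<union> Poly_Mapping.keys m'"
  have "monomial_value w (m + m') = (\<Prod>i\<in>?A. w i ^ Poly_Mapping.lookup (m + m') i)"
    by (rule monomial_value_superset) (use Poly_Mapping.keys_add[of m m'] in auto)
  also have "\<dots> = (\<Prod>i\<in>?A. w i ^ Poly_Mapping.lookup m i) * (\<Prod>i\<in>?A. w i ^ Poly_Mapping.lookup m' i)"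
    by (simp add: lookup_add power_add prod.distrib)
  also have "(\<Prod>i\<in>?A. w i ^ Poly_Mapping.lookup m i) = monomial_value w m"
    by (rule monomial_value_superset[symmetric]) auto
  also have "(\<Prod>i\<in>?A. w i ^ Poly_Mapping.lookup m' i) = monomial_value w m'"
    by (rule monomial_value_superset[symmetric]) auto
  finally show ?thesis .
qed

lemma poly_mapping_expansion:
  "(p :: 'a \<Rightarrow>\<^sub>0 'b::comm_monoid_add) = (\<Sum>m\<in>Poly_Mapping.keys p. Poly_Mapping.single m (Poly_Mapping.lookup p m))"
proof (rule poly_mapping_eqI)
  fix k
  have "Poly_Mapping.lookup (\<Sum>m\<in>Poly_Mapping.keys p. Poly_Mapping.single m (Poly_Mapping.lookup p m)) k
      = (\<Sum>m\<in>Poly_Mapping.keys p. if m = k then Poly_Mapping.lookup p m else 0)"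
    by (auto simp: lookup_sum lookup_single when_def intro!: sum.cong)
  also have "\<dots> = Poly_Mapping.lookup p k"
    by (simp add: in_keys_iff)
  finally show "Poly_Mapping.lookup p k =
    Poly_Mapping.lookup (\<Sum>m\<in>Poly_Mapping.keys p. Poly_Mapping.single m (Poly_Mapping.lookup p m)) k" by simp
qed

lemma poly_mapping_induct_single [case_names single add]:
  fixes p :: "'a \<Rightarrow>\<^sub>0 'b::comm_monoid_add"
  assumes "\<And>m c. P (Poly_Mapping.single m c)" "\<And>p q. P p \<Longrightarrow> P q \<Longrightarrow> P (p + q)"
  shows "P p"
proof -
  have "P (\<Sum>m\<in>A. Poly_Mapping.single m (Poly_Mapping.lookup p m))" if "finite A" for A
    using that
  proof (induction A rule: finite_induct)
    case empty
    have "P (Poly_Mapping.single undefined 0)" by (rule assms(1))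
    then show ?case by simp
  next
    case (insert x F)
    then show ?case by (simp add: assms)
  qed
  from this[of "Poly_Mapping.keys p"] show ?thesis
    using poly_mapping_expansion[of p] by simp
qed

context
  fixes \<kappa> :: "'k::comm_ring_1 \<Rightarrow> 'r::comm_ring_1" and w :: "nat \<Rightarrow> 'r"
  assumes \<kappa>: "comm_ring_hom \<kappa>"
begin

interpretation kap: comm_ring_hom \<kappa> by (rule \<kappa>)

lemma peval_single: "peval \<kappa> w (Poly_Mapping.single m c) = \<kappa> c * monomial_value w m"
  by (cases "c = 0") (simp_all add: peval_def)

lemma peval_add: "peval \<kappa> w (p + q) = peval \<kappa> w p + peval \<kappa> w q"
  unfolding peval_def
  by (rule Poly_Mapping.setsum_keys_plus_distrib) (simp_all add: kap.hom_add algebra_simps)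

lemma peval_mult: "peval \<kappa> w (p * q) = peval \<kappa> w p * peval \<kappa> w q"
proof (induction p rule: poly_mapping_induct_single)
  case (single m c)
  show ?case
  proof (induction q rule: poly_mapping_induct_single)
    case (single m' c')
    show ?case
      by (simp add: mult_single peval_single kap.hom_mult monomial_value_add algebra_simps)
  next
    case (add p q)
    then show ?case by (simp add: algebra_simps peval_add)
  qed
next
  case (add p q)
  then show ?case by (simp add: algebra_simps peval_add)
qed

lemma peval_hom: "comm_ring_hom (peval \<kappa> w)"
proof
  show "peval \<kappa> w 0 = 0" by (simp add: peval_def)
  show "peval \<kappa> w 1 = 1" using peval_single[of 0 1] by (simp add: single_one)
qed (simp_all add: peval_add peval_mult)

lemma hom_peval:
  assumes "comm_ring_hom h"
  shows "h (peval \<kappa> w p) = peval (\<lambda>c. h (\<kappa> c)) (\<lambda>i. h (w i)) p"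
proof -
  interpret comm_ring_hom h by fact
  show ?thesis by (simp add: peval_def hom_sum hom_mult hom_prod hom_power)
qed

end

lemma peval_cong:
  assumes "\<And>m i. m \<in> Poly_Mapping.keys p \<Longrightarrow> i \<in> Poly_Mapping.keys m \<Longrightarrow> w i = w' i"
  shows "peval \<kappa> w p = peval \<kappa> w' p"
  unfolding peval_def by (intro sum.cong prod.cong refl arg_cong2[of _ _ _ _ "(*)"]) (simp_all add: assms)


section \<open>Ring homomorphisms\<close>

lemma comm_ring_hom_id: "comm_ring_hom (\<lambda>c. c)"
  by unfold_locales auto

lemma comm_ring_hom_comp:
  assumes "comm_ring_hom f" "comm_ring_hom g"
  shows "comm_ring_hom (\<lambda>x. f (g x))"
proof -
  interpret f: comm_ring_hom f by fact
  interpret g: comm_ring_hom g by fact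
  show ?thesis by unfold_locales (simp_all add: f.hom_add g.hom_add f.hom_mult g.hom_mult)
qed

lemma comm_ring_hom_const_poly: "comm_ring_hom (\<lambda>c::'a::comm_ring_1. [:c:])"
  by unfold_locales (auto simp: one_pCons)

lemma comm_ring_hom_poly: "comm_ring_hom (\<lambda>p. poly p (a::'a::comm_ring_1))"
  by unfold_locales auto

lemma comm_ring_hom_map_poly:
  assumes "comm_ring_hom h"
  shows "comm_ring_hom (map_poly h)"
proof -
  interpret comm_ring_hom h by fact
  have "map_poly h (p * q) = map_poly h p * map_poly h q" for p q
    by (induct p) (auto simp: hom_distribs)
  then show ?thesis by unfold_locales (simp_all add: hom_distribs)
qed

lemma comm_ring_hom_single: "comm_ring_hom (Poly_Mapping.single (0 :: 'a::comm_monoid_add) :: 'b::comm_ring_1 \<Rightarrow> _)"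
  by unfold_locales (simp_all add: single_add mult_single single_one)

abbreviation Const :: "'k::field \<Rightarrow> 'k mpoly" where
  "Const \<equiv> Poly_Mapping.single 0"

abbreviation Var :: "nat \<Rightarrow> 'k::field mpoly" where
  "Var i \<equiv> Poly_Mapping.single (Poly_Mapping.single i 1) 1"

abbreviation value_at :: "(nat \<Rightarrow> 'k::field) \<Rightarrow> 'k mpoly \<Rightarrow> 'k" where
  "value_at x \<equiv> peval (\<lambda>c. c) x"

abbreviation subst_poly :: "(nat \<Rightarrow> 'k::field mpoly) \<Rightarrow> 'k mpoly \<Rightarrow> 'k mpoly" where
  "subst_poly \<equiv> peval Const"

lemma comm_ring_hom_value_at: "comm_ring_hom (value_at x)"
  by (rule peval_hom[OF comm_ring_hom_id])

interpretation value_at_hom: comm_ring_hom "value_at x" for x :: "nat \<Rightarrow> 'k::field"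
  by (rule comm_ring_hom_value_at)

lemma eval_eq_value_at: "eval p v = value_at (($) v) p"
  by (simp add: eval_def peval_def)

lemma peval_Var: "comm_ring_hom \<kappa> \<Longrightarrow> peval \<kappa> w (Var i) = w i"
  by (subst peval_single) (auto simp: comm_ring_hom_def ring_hom_def semiring_hom_def monoid_mult_hom_def one_hom.hom_one)

lemma peval_Const: "comm_ring_hom \<kappa> \<Longrightarrow> peval \<kappa> w (Const c) = \<kappa> c"
  by (subst peval_single) auto

lemma value_at_Var [simp]: "value_at x (Var i) = x i"
  by (rule peval_Var[OF comm_ring_hom_id])

lemma Var_nonzero: "(Var i :: 'k::field mpoly) \<noteq> 0"
proof
  assume "(Var i :: 'k mpoly) = 0"
  then have "value_at (\<lambda>_. 1 :: 'k) (Var i) = 0" by (metis value_at_hom.hom_zero)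
  moreover have "value_at (\<lambda>_. 1 :: 'k) (Var i) = 1" by (rule value_at_Var)
  ultimately show False by simp
qed

lemma value_at_Const [simp]: "value_at x (Const c) = c"
  by (rule peval_Const[OF comm_ring_hom_id])

lemma value_at_subst_poly: "value_at x (subst_poly g p) = value_at (\<lambda>i. value_at x (g i)) p"
  using hom_peval[OF comm_ring_hom_single comm_ring_hom_value_at, of x g p] by simp

lemma monomial_value_Var: "monomial_value Var m = (Poly_Mapping.single m 1 :: 'k::field mpoly)"
proof -
  have pow: "(Var i :: 'k mpoly) ^ k = Poly_Mapping.single (Poly_Mapping.single i k) 1" for i k
    by (induction k) (simp_all add: mult_single single_one flip: single_add)
  have "(\<Prod>i\<in>A. (Var i :: 'k mpoly) ^ Poly_Mapping.lookup m i)
      = Poly_Mapping.single (\<Sum>i\<in>A. Poly_Mapping.single i (Poly_Mapping.lookup m i)) 1" if "finite A" for A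
    using that by (induction A rule: finite_induct) (simp_all add: pow mult_single single_one del: One_nat_def)
  from this[of "Poly_Mapping.keys m"] show ?thesis
    using poly_mapping_expansion[of m] by simp
qed

lemma subst_poly_Var: "subst_poly Var p = p"
proof (induction p rule: poly_mapping_induct_single)
  case (single m c)
  show ?case
    by (simp add: peval_single[OF comm_ring_hom_single] monomial_value_Var mult_single del: One_nat_def)
next
  case (add p q)
  then show ?case by (simp add: peval_add[OF comm_ring_hom_single])
qed

section \<open>Forms\<close>

abbreviation mdeg :: "(nat \<Rightarrow>\<^sub>0 nat) \<Rightarrow> nat" where
  "mdeg m \<equiv> \<Sum>i\<in>Poly_Mapping.keys m. Poly_Mapping.lookup m i"

lemma mdeg_superset:
  assumes "finite A" "Poly_Mapping.keys m \<subseteq> A"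
  shows "mdeg m = (\<Sum>i\<in>A. Poly_Mapping.lookup m i)"
  by (rule sum.mono_neutral_left) (use assms in \<open>auto simp: in_keys_iff\<close>)

lemma mdeg_add: "mdeg (m + m') = mdeg m + mdeg m'"
proof -
  let ?A = "Poly_Mapping.keys m \<union> Poly_Mapping.keys m'"
  have "mdeg (m + m') = (\<Sum>i\<in>?A. Poly_Mapping.lookup (m + m') i)"
    by (rule mdeg_superset) (use Poly_Mapping.keys_add[of m m'] in auto)
  also have "\<dots> = (\<Sum>i\<in>?A. Poly_Mapping.lookup m i) + (\<Sum>i\<in>?A. Poly_Mapping.lookup m' i)"
    by (simp add: lookup_add sum.distrib)
  also have "(\<Sum>i\<in>?A. Poly_Mapping.lookup m i) = mdeg m"
    by (rule mdeg_superset[symmetric]) auto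
  also have "(\<Sum>i\<in>?A. Poly_Mapping.lookup m' i) = mdeg m'"
    by (rule mdeg_superset[symmetric]) auto
  finally show ?thesis .
qed

lemma forms_0 [simp]: "0 \<in> forms n d"
  by (simp add: forms_def)

lemma forms_Const: "Const c \<in> forms n 0"
  by (auto simp: forms_def)

lemma forms_Var: "i \<le> n \<Longrightarrow> Var i \<in> forms n 1"
  by (auto simp: forms_def)

lemma forms_add: "p \<in> forms n d \<Longrightarrow> q \<in> forms n d \<Longrightarrow> p + q \<in> forms n d"
  unfolding forms_def using Poly_Mapping.keys_add[of p q] by blast

lemma forms_uminus: "p \<in> forms n d \<Longrightarrow> - p \<in> forms n d"
  unfolding forms_def by simp

lemma forms_diff: "p \<in> forms n d \<Longrightarrow> q \<in> forms n d \<Longrightarrow> p - q \<in> forms n d"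
  using forms_add[of p n d "- q"] forms_uminus[of q n d] by simp

lemma forms_sum: "(\<And>i. i \<in> I \<Longrightarrow> p i \<in> forms n d) \<Longrightarrow> sum p I \<in> forms n d"
  by (induction I rule: infinite_finite_induct) (auto intro: forms_add)

lemma forms_mult:
  assumes "p \<in> forms n d" "q \<in> forms n e"
  shows "p * q \<in> forms n (d + e)"
proof -
  have "Poly_Mapping.keys m \<subseteq> {..n} \<and> mdeg m = d + e" if "m \<in> Poly_Mapping.keys (p * q)" for m
  proof -
    from that Poly_Mapping.keys_mult[of p q] obtain a b
      where ab: "m = a + b" "a \<in> Poly_Mapping.keys p" "b \<in> Poly_Mapping.keys q" by blast
    with assms have "Poly_Mapping.keys a \<subseteq> {..n}" "mdeg a = d" "Poly_Mapping.keys b \<subseteq> {..n}" "mdeg b = e"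
      by (auto simp: forms_def)
    then show ?thesis
      using Poly_Mapping.keys_add[of a b] mdeg_add[of a b] ab(1) by auto
  qed
  then show ?thesis by (simp add: forms_def)
qed

lemma forms_Const_mult: "p \<in> forms n d \<Longrightarrow> Const c * p \<in> forms n d"
  using forms_mult[OF forms_Const, of p n d c] by simp

lemma forms_1: "1 \<in> forms n 0"
  using forms_Const[of 1 n] by (simp add: single_one)

lemma forms_power: "p \<in> forms n d \<Longrightarrow> p ^ k \<in> forms n (d * k)"
  by (induction k) (auto simp: forms_1 intro: forms_mult)

lemma forms_prod: "(\<And>i. i \<in> I \<Longrightarrow> p i \<in> forms n (d i)) \<Longrightarrow> prod p I \<in> forms n (sum d I)"
  by (induction I rule: infinite_finite_induct) (auto simp: forms_1 intro: forms_mult)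

lemma forms_subst_poly:
  assumes p: "p \<in> forms n d" and g: "\<And>i. i \<le> n \<Longrightarrow> g i \<in> forms n' e"
  shows "subst_poly g p \<in> forms n' (e * d)"
  unfolding peval_def
proof (rule forms_sum)
  fix m assume m: "m \<in> Poly_Mapping.keys p"
  with p have keys: "Poly_Mapping.keys m \<subseteq> {..n}" and deg: "mdeg m = d" by (auto simp: forms_def)
  have "monomial_value g m \<in> forms n' (\<Sum>i\<in>Poly_Mapping.keys m. e * Poly_Mapping.lookup m i)"
    by (rule forms_prod, rule forms_power, rule g) (use keys in auto)
  also have "(\<Sum>i\<in>Poly_Mapping.keys m. e * Poly_Mapping.lookup m i) = e * d"
    by (simp add: deg flip: sum_distrib_left)
  finally show "Const (Poly_Mapping.lookup p m) * monomial_value g m \<in> forms n' (e * d)"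
    by (rule forms_Const_mult)
qed

lemma peval_forms_cong:
  assumes "p \<in> forms n d" "\<And>i. i \<le> n \<Longrightarrow> w i = w' i"
  shows "peval \<kappa> w p = peval \<kappa> w' p"
  by (rule peval_cong) (use assms in \<open>auto simp: forms_def\<close>)

lemma peval_forms_scale:
  assumes "p \<in> forms n d"
  shows "peval \<kappa> (\<lambda>i. c * w i) p = c ^ d * peval \<kappa> w p"
  unfolding peval_def sum_distrib_left
proof (rule sum.cong[OF refl])
  fix m assume "m \<in> Poly_Mapping.keys p"
  with assms have "mdeg m = d" by (auto simp: forms_def)
  then have "monomial_value (\<lambda>i. c * w i) m = c ^ d * monomial_value w m"
    by (simp add: power_mult_distrib prod.distrib flip: power_sum)
  then show "\<kappa> (Poly_Mapping.lookup p m) * monomial_value (\<lambda>i. c * w i) m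
    = c ^ d * (\<kappa> (Poly_Mapping.lookup p m) * monomial_value w m)"
    by (simp add: algebra_simps)
qed

text \<open>Bookkeeping for coefficients of degree \<open>N\<close> that may vanish: unlike the leading coefficient, they behave
  well under addition and multiplication, and a form evaluated at polynomials of degree at most \<open>e\<close> has a
  coefficient of this kind which is again a value of the form.\<close>

definition top_coeff :: "nat \<Rightarrow> 'a::comm_ring_1 poly \<Rightarrow> 'a \<Rightarrow> bool" where
  "top_coeff N q l \<longleftrightarrow> degree q \<le> N \<and> coeff q N = l"

lemma top_coeff_mult:
  assumes "top_coeff N q l" "top_coeff N' q' l'"
  shows "top_coeff (N + N') (q * q') (l * l')"
proof -
  have d: "degree q \<le> N" "degree q' \<le> N'" using assms by (auto simp: top_coeff_def)
  have "coeff (q * q') (N + N') = (\<Sum>i\<le>N + N'. coeff q i * coeff q' (N + N' - i))"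
    by (simp add: coeff_mult)
  also have "\<dots> = (\<Sum>i\<in>{N}. coeff q i * coeff q' (N + N' - i))"
  proof (rule sum.mono_neutral_right)
    show "\<forall>i\<in>{..N + N'} - {N}. coeff q i * coeff q' (N + N' - i) = 0"
    proof
      fix i assume "i \<in> {..N + N'} - {N}"
      then consider "i < N" | "i > N" by force
      then show "coeff q i * coeff q' (N + N' - i) = 0"
        by cases (use d in \<open>auto simp: coeff_eq_0\<close>)
    qed
  qed auto
  finally have "coeff (q * q') (N + N') = l * l'" using assms by (simp add: top_coeff_def)
  moreover have "degree (q * q') \<le> N + N'" using degree_mult_le[of q q'] d by linarith
  ultimately show ?thesis by (simp add: top_coeff_def)
qed

lemma top_coeff_const: "top_coeff 0 [:c:] c"
  by (simp add: top_coeff_def)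

lemma top_coeff_add: "top_coeff N q l \<Longrightarrow> top_coeff N q' l' \<Longrightarrow> top_coeff N (q + q') (l + l')"
  by (auto simp: top_coeff_def intro: degree_add_le)

lemma top_coeff_sum:
  "(\<And>i. i \<in> I \<Longrightarrow> top_coeff N (q i) (l i)) \<Longrightarrow> top_coeff N (\<Sum>i\<in>I. q i) (\<Sum>i\<in>I. l i)"
proof (induction I rule: infinite_finite_induct)
  case (insert x F)
  then show ?case by (simp add: top_coeff_add)
qed (auto simp: top_coeff_def)

lemma top_coeff_power: "top_coeff N q l \<Longrightarrow> top_coeff (N * k) (q ^ k) (l ^ k)"
proof (induction k)
  case 0
  show ?case by (simp add: top_coeff_def)
next
  case (Suc k)
  from top_coeff_mult[OF Suc.prems Suc.IH[OF Suc.prems]] show ?case by simp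
qed

lemma top_coeff_prod:
  "(\<And>i. i \<in> I \<Longrightarrow> top_coeff (N i) (q i) (l i)) \<Longrightarrow> top_coeff (sum N I) (prod q I) (prod l I)"
proof (induction I rule: infinite_finite_induct)
  case (insert x F)
  then show ?case by (simp add: top_coeff_mult)
qed (auto simp: top_coeff_def)

lemma top_coeff_peval:
  assumes p: "p \<in> forms n d" and w: "\<And>i. i \<le> n \<Longrightarrow> top_coeff e (w i) (l i)"
  shows "top_coeff (e * d) (peval (\<lambda>c. [:\<kappa> c:]) w p) (peval \<kappa> l p)"
  unfolding peval_def
proof (rule top_coeff_sum)
  fix m assume m: "m \<in> Poly_Mapping.keys p"
  with p have keys: "Poly_Mapping.keys m \<subseteq> {..n}" and deg: "mdeg m = d" by (auto simp: forms_def)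
  have "top_coeff (\<Sum>i\<in>Poly_Mapping.keys m. e * Poly_Mapping.lookup m i) (monomial_value w m) (monomial_value l m)"
    by (rule top_coeff_prod, rule top_coeff_power, rule w) (use keys in auto)
  also have "(\<Sum>i\<in>Poly_Mapping.keys m. e * Poly_Mapping.lookup m i) = e * d"
    by (simp add: deg flip: sum_distrib_left)
  finally show "top_coeff (e * d) ([:\<kappa> (Poly_Mapping.lookup p m):] * monomial_value w m)
      (\<kappa> (Poly_Mapping.lookup p m) * monomial_value l m)"
    using top_coeff_mult[OF top_coeff_const] by fastforce
qed

section \<open>Polynomials over infinite fields\<close>

lemma alg_closed_infinite: "infinite (UNIV :: 'k::alg_closed_field set)"
proof
  assume fin: "finite (UNIV :: 'k set)"
  define p :: "'k poly" where "p = (\<Prod>a\<in>UNIV. [:-a, 1:]) + 1"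
  have "degree (\<Prod>a\<in>(UNIV::'k set). [:-a, 1:]) = card (UNIV :: 'k set)"
    by (subst degree_prod_eq_sum_degree) auto
  moreover have "card (UNIV :: 'k set) > 0" using fin by (simp add: card_gt_0_iff)
  ultimately have "degree p > 0" unfolding p_def by (subst degree_add_eq_left) auto
  then obtain x where "poly p x = 0" using alg_closed_imp_poly_has_root by blast
  moreover have "poly p x = 1"
    using fin by (auto simp: p_def poly_prod)
  ultimately show False by simp
qed

lemma poly_all_zero_imp_zero:
  assumes "infinite (UNIV :: 'k::field set)" "\<And>x. poly p (x::'k) = 0"
  shows "p = 0"
  using assms poly_roots_finite[of p] by auto

lemma base_expansion_inj:
  assumes "\<And>i. i < n \<Longrightarrow> e i < N" "\<And>i. i < n \<Longrightarrow> e' i < N"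
    and "(\<Sum>i<n. e i * N ^ i) = (\<Sum>i<n. e' i * N ^ i)" "i < (n::nat)"
  shows "e i = (e' i :: nat)"
  using assms
proof (induction n arbitrary: e e' i)
  case (Suc n)
  have split: "(\<Sum>i<Suc n. e i * N ^ i) = e 0 + N * (\<Sum>i<n. e (Suc i) * N ^ i)" for e :: "nat \<Rightarrow> nat"
    by (subst sum.lessThan_Suc_shift) (simp add: sum_distrib_left algebra_simps)
  have eq: "e 0 + N * (\<Sum>i<n. e (Suc i) * N ^ i) = e' 0 + N * (\<Sum>i<n. e' (Suc i) * N ^ i)"
    using Suc.prems(3) unfolding split .
  have lt: "e 0 < N" "e' 0 < N" using Suc.prems by auto
  have e0: "e 0 = e' 0" using arg_cong[OF eq, of "\<lambda>x. x mod N"] lt by simp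
  have "N > 0" using lt by auto
  with eq e0 have "(\<Sum>i<n. e (Suc i) * N ^ i) = (\<Sum>i<n. e' (Suc i) * N ^ i)" by simp
  then have IH: "e (Suc j) = e' (Suc j)" if "j < n" for j
    using Suc.IH[of "\<lambda>i. e (Suc i)" "\<lambda>i. e' (Suc i)" j] that Suc.prems by auto
  show ?case using e0 IH Suc.prems(4) by (cases i) auto
qed simp

text \<open>Kronecker substitution \<open>x\<^sub>i = t^(N^i)\<close> with large \<open>N\<close> keeps all monomials apart, so a nonzero
  polynomial becomes a nonzero polynomial in one variable.\<close>

lemma value_at_all_zero_imp_zero:
  fixes p :: "'k::field mpoly"
  assumes inf: "infinite (UNIV :: 'k set)" and zero: "\<And>x. value_at x p = 0"
  shows "p = 0"
proof (rule ccontr)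
  assume "p \<noteq> 0"
  then obtain m0 where m0: "m0 \<in> Poly_Mapping.keys p" by (auto simp: poly_mapping_eq_iff in_keys_iff fun_eq_iff)
  let ?K = "Poly_Mapping.keys p"
  define I where "I = (\<Union>m\<in>?K. Poly_Mapping.keys m)"
  have "finite I" by (auto simp: I_def)
  then obtain n where n: "I \<subseteq> {..<n}" using finite_nat_iff_bounded by blast
  define E where "E = (\<Union>m\<in>?K. Poly_Mapping.lookup m ` {..<n})"
  have "finite E" by (auto simp: E_def)
  then obtain N where N: "E \<subseteq> {..<N}" using finite_nat_iff_bounded by blast
  define \<phi> where "\<phi> m = (\<Sum>i<n. Poly_Mapping.lookup m i * N ^ i)" for m :: "nat \<Rightarrow>\<^sub>0 nat"
  have keys: "Poly_Mapping.keys m \<subseteq> {..<n}" if "m \<in> ?K" for m using that n by (auto simp: I_def)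
  have inj: "m = m'" if "m \<in> ?K" "m' \<in> ?K" "\<phi> m = \<phi> m'" for m m'
  proof (rule poly_mapping_eqI)
    fix i
    show "Poly_Mapping.lookup m i = Poly_Mapping.lookup m' i"
    proof (cases "i < n")
      case True
      show ?thesis
        by (rule base_expansion_inj[of n "Poly_Mapping.lookup m" N "Poly_Mapping.lookup m'"])
           (use that N True in \<open>auto simp: E_def \<phi>_def\<close>)
    next
      case False
      with keys that have "i \<notin> Poly_Mapping.keys m" "i \<notin> Poly_Mapping.keys m'" by auto
      then show ?thesis by (simp add: in_keys_iff)
    qed
  qed
  define q where "q = peval (\<lambda>c. [:c:]) (\<lambda>i. monom 1 (N ^ i)) p"
  have "q = 0"
  proof (rule poly_all_zero_imp_zero[OF inf])
    fix t
    show "poly q t = 0"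
      unfolding q_def hom_peval[OF comm_ring_hom_const_poly comm_ring_hom_poly] using zero by simp
  qed
  have mon: "monomial_value (\<lambda>i. monom (1::'k) (N ^ i)) m = monom 1 (\<phi> m)" if "m \<in> ?K" for m
  proof -
    have "monomial_value (\<lambda>i. monom (1::'k) (N ^ i)) m = (\<Prod>i<n. monom (1::'k) (N ^ i) ^ Poly_Mapping.lookup m i)"
      by (rule monomial_value_superset) (use keys that in auto)
    also have "\<dots> = monom 1 (\<phi> m)"
    proof -
      have "(\<Prod>i<k. monom (1::'k) (N ^ i) ^ Poly_Mapping.lookup m i) = monom 1 (\<Sum>i<k. Poly_Mapping.lookup m i * N ^ i)" for k
        by (induction k) (simp_all add: monom_power mult_monom algebra_simps)
      then show ?thesis by (simp add: \<phi>_def)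
    qed
    finally show ?thesis .
  qed
  have "coeff q (\<phi> m0) = (\<Sum>m\<in>?K. if m = m0 then Poly_Mapping.lookup p m else 0)"
    unfolding q_def peval_def coeff_sum
    by (rule sum.cong) (use inj m0 in \<open>auto simp: mon\<close>)
  also have "\<dots> = Poly_Mapping.lookup p m0" using m0 by simp
  finally show False using m0 \<open>q = 0\<close> by (simp add: in_keys_iff)
qed

section \<open>Division in polynomial rings over integral domains\<close>

lemma unit_lead_division:
  fixes y z :: "'a::idom poly"
  assumes unit: "lead_coeff y dvd 1"
  obtains q r where "z = y * q + r" "r = 0 \<or> degree r < degree y"
proof -
  from unit obtain c where c: "lead_coeff y * c = 1" by (auto elim!: dvdE)
  have y: "y \<noteq> 0" using c by auto
  obtain q r where qr: "pseudo_divmod z y = (q, r)" by force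
  define k where "k = Suc (degree z) - degree y"
  have eq: "Polynomial.smult (lead_coeff y ^ k) z = y * q + r" and deg: "r = 0 \<or> degree r < degree y"
    using pseudo_divmod[OF y qr] by (auto simp: k_def)
  have "z = Polynomial.smult (c ^ k) (Polynomial.smult (lead_coeff y ^ k) z)"
    using c by (simp add: mult.commute flip: power_mult_distrib)
  also have "\<dots> = y * Polynomial.smult (c ^ k) q + Polynomial.smult (c ^ k) r"
    unfolding eq by (simp add: smult_add_right)
  finally show ?thesis
    by (rule that) (use deg degree_smult_le[of "c ^ k" r] in \<open>auto intro: le_less_trans\<close>)
qed

lemma unit_lead_dvd_cancel:
  fixes y z :: "'a::idom poly"
  assumes unit: "lead_coeff y dvd 1" and h: "h \<noteq> 0" and dvd: "y dvd Polynomial.smult h z"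
  shows "y dvd z"
proof -
  obtain q r where z: "z = y * q + r" and r: "r = 0 \<or> degree r < degree y"
    using unit_lead_division[OF unit] by blast
  have "Polynomial.smult h r = Polynomial.smult h z - y * Polynomial.smult h q"
    by (simp add: z smult_add_right)
  also have "y dvd \<dots>" by (rule dvd_diff[OF dvd dvd_triv_left])
  finally have "y dvd Polynomial.smult h r" .
  with r h have "r = 0" by (metis degree_smult_eq dvd_imp_degree_le leD smult_eq_0_iff)
  with z show ?thesis by simp
qed

lemma sum_delta_mult:
  fixes y :: "nat \<Rightarrow> 'a::comm_ring_1"
  assumes "i \<le> m"
  shows "(\<Sum>j\<le>m. (if j = i then a else 0) * y j) = a * y i"
  using assms by (simp add: if_distrib[of "\<lambda>x. x * _"] cong: if_cong)

text \<open>An element of least degree in the ideal generated by the \<open>y\<^sub>i\<close>; after inverting elements of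
  the base ring it is their greatest common divisor.\<close>

lemma ideal_least_degree:
  fixes y :: "nat \<Rightarrow> 'a::idom poly"
  assumes "i0 \<le> m" "y i0 \<noteq> 0"
  shows "\<exists>N c. N \<noteq> 0 \<and> N = (\<Sum>i\<le>m. c i * y i) \<and>
    (\<forall>i\<le>m. \<exists>a E. a \<noteq> 0 \<and> Polynomial.smult a (y i) = N * E)"
proof -
  define J where "J = {N. N \<noteq> 0 \<and> (\<exists>c. N = (\<Sum>i\<le>m. c i * y i))}"
  have "(\<Sum>i\<le>m. (if i = i0 then 1 else 0) * y i) = y i0"
    using sum_delta_mult[OF assms(1), of 1 y] by simp
  then have "\<exists>c. y i0 = (\<Sum>i\<le>m. c i * y i)"
    by (intro exI[of _ "\<lambda>i. if i = i0 then 1 else 0"]) simp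
  then have "y i0 \<in> J" unfolding J_def using assms(2) by blast
  then obtain N where N: "N \<in> J" and least: "\<And>N'. N' \<in> J \<Longrightarrow> degree N \<le> degree N'"
    using ex_has_least_nat[of "\<lambda>x. x \<in> J" "y i0" degree] by blast
  from N obtain c where N0: "N \<noteq> 0" and c: "N = (\<Sum>i\<le>m. c i * y i)" by (auto simp: J_def)
  have "\<exists>a E. a \<noteq> 0 \<and> Polynomial.smult a (y i) = N * E" if i: "i \<le> m" for i
  proof -
    define r where "r = pseudo_mod (y i) N"
    obtain a q where a: "a \<noteq> 0" and eq: "Polynomial.smult a (y i) = N * q + r"
      and r: "r = 0 \<or> degree r < degree N"
      using pseudo_mod[OF N0, of "y i"] by (auto simp: r_def)
    have "r = (\<Sum>j\<le>m. ((if j = i then [:a:] else 0) - q * c j) * y j)"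
    proof -
      have "(\<Sum>j\<le>m. ((if j = i then [:a:] else 0) - q * c j) * y j)
          = (\<Sum>j\<le>m. (if j = i then [:a:] else 0) * y j) - q * (\<Sum>j\<le>m. c j * y j)"
        by (simp only: left_diff_distrib sum_subtractf sum_distrib_left mult.assoc)
      also have "\<dots> = [:a:] * y i - q * N" by (simp only: sum_delta_mult[OF i] c)
      finally show ?thesis using eq by (simp add: algebra_simps)
    qed
    then have "\<exists>c. r = (\<Sum>j\<le>m. c j * y j)"
      by (intro exI[of _ "\<lambda>j. (if j = i then [:a:] else 0) - q * c j"])
    then have "r \<noteq> 0 \<Longrightarrow> r \<in> J" unfolding J_def by blast
    with least r have "r = 0" by force
    with eq a show ?thesis by auto
  qed
  with N0 c show ?thesis by blast
qed

section \<open>Polynomials in two variables\<close>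

text \<open>The inner variable of a polynomial in two variables is called \<open>t\<close>, the outer one \<open>s\<close>.\<close>

definition spec :: "'k::field \<Rightarrow> 'k poly poly \<Rightarrow> 'k poly" where
  "spec t q = map_poly (\<lambda>c. poly c t) q"

lemma comm_ring_hom_spec: "comm_ring_hom (spec t)"
proof -
  have "spec t = map_poly (\<lambda>c. poly c t)" by (rule ext) (simp add: spec_def)
  then show ?thesis using comm_ring_hom_map_poly[OF comm_ring_hom_poly] by simp
qed

interpretation spec_hom: comm_ring_hom "spec t" for t :: "'k::field"
  by (rule comm_ring_hom_spec)

lemma coeff_spec: "coeff (spec t q) i = poly (coeff q i) t"
  by (simp add: spec_def coeff_map_poly)

lemma poly_spec: "poly (spec t q) s = poly (poly q [:s:]) t"
  using poly_hom.poly_map_poly[of t q "[:s:]"] by (simp add: spec_def)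

lemma spec_smult: "spec t (Polynomial.smult c q) = Polynomial.smult (poly c t) (spec t q)"
  by (rule poly_eqI) (simp add: coeff_spec)

lemma degree_spec_le: "degree (spec t q) \<le> degree q"
  by (rule degree_le) (auto simp: coeff_spec coeff_eq_0)

lemma spec_eq_0:
  assumes "spec t q = 0"
  obtains q' where "q = Polynomial.smult [:-t, 1:] q'"
proof
  show "q = Polynomial.smult [:-t, 1:] (map_poly (\<lambda>c. c div [:-t, 1:]) q)"
  proof (rule poly_eqI)
    fix i
    from assms have "poly (coeff q i) t = 0" by (metis coeff_0 coeff_spec)
    then have "[:-t, 1:] dvd coeff q i" by (simp add: poly_eq_0_iff_dvd)
    then show "coeff q i = coeff (Polynomial.smult [:-t, 1:] (map_poly (\<lambda>c. c div [:-t, 1:]) q)) i"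
      by (simp add: coeff_map_poly del: mult_pCons_left)
  qed
qed

text \<open>Elimination: if the \<open>y\<^sub>i(t\<^sub>0, s)\<close> have no common root (one of them keeping its degree, so that
  none escapes to infinity), then the ideal of the \<open>y\<^sub>i\<close> contains a nonzero polynomial in \<open>t\<close> alone.
  Otherwise an element of least degree in \<open>s\<close>, cleared of all factors \<open>t - t\<^sub>0\<close>, would specialize
  to a nonconstant common factor.\<close>

lemma elimination:
  fixes y :: "nat \<Rightarrow> 'k::alg_closed_field poly poly"
  assumes a: "a \<le> m" and lead: "poly (lead_coeff (y a)) t0 \<noteq> 0"
    and no_root: "\<And>s. \<exists>i\<le>m. poly (poly (y i) [:s:]) t0 \<noteq> 0"
  obtains h c where "h \<noteq> 0" "[:h:] = (\<Sum>i\<le>m. c i * y i)"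
proof -
  have ya: "y a \<noteq> 0" using lead by auto
  obtain N c where N: "N \<noteq> 0" "N = (\<Sum>i\<le>m. c i * y i)"
    and div: "\<forall>i\<le>m. \<exists>a E. a \<noteq> 0 \<and> Polynomial.smult a (y i) = N * E"
    using ideal_least_degree[of a m y, OF a ya] by blast
  show ?thesis
  proof (cases "degree N = 0")
    case True
    then obtain h where h: "N = [:h:]" by (rule degree_eq_zeroE)
    show ?thesis by (rule that[of h c]) (use N h in auto)
  next
    case False
    define \<N> where "\<N> = {N. N \<noteq> 0 \<and> degree N \<noteq> 0 \<and>
      (\<forall>i\<le>m. \<exists>a E. a \<noteq> 0 \<and> Polynomial.smult a (y i) = N * E)}"
    have "N \<in> \<N>" using N(1) False div by (auto simp: \<N>_def)
    then obtain M where M: "M \<in> \<N>"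
      and least: "\<And>M'. M' \<in> \<N> \<Longrightarrow> degree (lead_coeff M) \<le> degree (lead_coeff M')"
      using ex_has_least_nat[of "\<lambda>x. x \<in> \<N>" N "\<lambda>M. degree (lead_coeff M)"] by blast
    have M0: "M \<noteq> 0" "degree M \<noteq> 0" using M by (auto simp: \<N>_def)
    have specM: "spec t0 M \<noteq> 0"
    proof
      assume "spec t0 M = 0"
      then obtain M' where M': "M = Polynomial.smult [:-t0, 1:] M'" by (rule spec_eq_0)
      with M0 have "M' \<noteq> 0" "degree M' \<noteq> 0" by auto
      moreover have "\<exists>a E. a \<noteq> 0 \<and> Polynomial.smult a (y i) = M' * E" if "i \<le> m" for i
      proof -
        from M that obtain a E where "a \<noteq> 0" "Polynomial.smult a (y i) = M * E" by (auto simp: \<N>_def)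
        then have "a \<noteq> 0 \<and> Polynomial.smult a (y i) = M' * Polynomial.smult [:-t0, 1:] E"
          by (simp add: M')
        then show ?thesis by blast
      qed
      ultimately have "M' \<in> \<N>" by (auto simp: \<N>_def)
      then have "degree (lead_coeff M) \<le> degree (lead_coeff M')" by (rule least)
      moreover have "lead_coeff M = [:-t0, 1:] * lead_coeff M'" by (simp add: M')
      then have "degree (lead_coeff M) = Suc (degree (lead_coeff M'))"
        using \<open>M' \<noteq> 0\<close> by (simp add: degree_mult_eq del: mult_pCons_left)
      ultimately show False by simp
    qed
    have cofactor: "\<exists>a E. poly a t0 \<noteq> 0 \<and> Polynomial.smult a (y i) = M * E" if i: "i \<le> m" for i
    proof -
      define A where "A = {a. a \<noteq> 0 \<and> (\<exists>E. Polynomial.smult a (y i) = M * E)}"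
      have "\<exists>a0. a0 \<in> A" using M i unfolding \<N>_def A_def by blast
      then obtain a0 where "a0 \<in> A" ..
      then obtain a where aA: "a \<in> A" and min: "\<And>a'. a' \<in> A \<Longrightarrow> degree a \<le> degree a'"
        using ex_has_least_nat[of "\<lambda>x. x \<in> A" a0 degree] by blast
      then obtain E where a: "a \<noteq> 0" and E: "Polynomial.smult a (y i) = M * E" by (auto simp: A_def)
      have "poly a t0 \<noteq> 0"
      proof
        assume root: "poly a t0 = 0"
        then obtain a' where a': "a = [:-t0, 1:] * a'" by (auto simp: poly_eq_0_iff_dvd elim: dvdE)
        have "spec t0 M * spec t0 E = 0"
          using arg_cong[OF E, of "spec t0"] root by (simp add: spec_smult spec_hom.hom_mult)
        with specM have "spec t0 E = 0" by simp
        then obtain E' where E': "E = Polynomial.smult [:-t0, 1:] E'" by (rule spec_eq_0)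
        have "Polynomial.smult [:-t0, 1:] (Polynomial.smult a' (y i)) = Polynomial.smult [:-t0, 1:] (M * E')"
          using E unfolding a' E' by (simp add: smult_smult del: mult_pCons_left)
        then have "Polynomial.smult [:-t0, 1:] (Polynomial.smult a' (y i) - M * E') = 0"
          by (simp add: smult_diff_right)
        then have "Polynomial.smult a' (y i) = M * E'" by simp
        moreover have "a' \<noteq> 0" using a a' by auto
        ultimately have "a' \<in> A" by (auto simp: A_def)
        then have "degree a \<le> degree a'" by (rule min)
        then show False using a' \<open>a' \<noteq> 0\<close> by (simp add: degree_mult_eq del: mult_pCons_left)
      qed
      with E show ?thesis by blast
    qed
    from cofactor[OF a] obtain b E where b: "poly b t0 \<noteq> 0" and E: "Polynomial.smult b (y a) = M * E" by blast
    have "degree (spec t0 M) \<noteq> 0"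
    proof
      assume d0: "degree (spec t0 M) = 0"
      have b0: "b \<noteq> 0" using b by auto
      have E0: "E \<noteq> 0" using E b0 ya by auto
      have "coeff (spec t0 (y a)) (degree (y a)) \<noteq> 0" using lead by (simp add: coeff_spec)
      then have "degree (y a) \<le> degree (spec t0 (y a))" by (rule le_degree)
      also have "\<dots> = degree (spec t0 (Polynomial.smult b (y a)))" using b by (simp add: spec_smult)
      also have "\<dots> \<le> degree (spec t0 M) + degree (spec t0 E)"
        unfolding E spec_hom.hom_mult by (rule degree_mult_le)
      also have "\<dots> \<le> degree E" using d0 degree_spec_le[of t0 E] by simp
      also have "\<dots> < degree (M * E)" using M0 E0 by (simp add: degree_mult_eq)
      also have "\<dots> = degree (y a)" using b0 by (simp flip: E)
      finally show False by simp
    qed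
    then obtain s where s: "poly (spec t0 M) s = 0" using alg_closed_imp_poly_has_root by blast
    have "poly (poly (y i) [:s:]) t0 = 0" if "i \<le> m" for i
    proof -
      from cofactor[OF that] obtain b E where b: "poly b t0 \<noteq> 0" and E: "Polynomial.smult b (y i) = M * E" by blast
      have "poly b t0 * poly (poly (y i) [:s:]) t0 = 0"
        using arg_cong[OF E, of "\<lambda>q. poly (spec t0 q) s"] s
        by (simp add: spec_smult spec_hom.hom_mult flip: poly_spec)
      with b show ?thesis by simp
    qed
    with no_root show ?thesis by blast
  qed
qed

text \<open>Gauss's lemma for \<open>k[t]\<close>: the primes of \<open>k[t]\<close> are linear, and each of them dividing \<open>a\<close>
  can be cancelled from one of the two factors.\<close>

lemma lead_coeff_dvd_factor:
  fixes F :: "'k::alg_closed_field poly poly"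
  assumes "Polynomial.smult a F = N * E" "a \<noteq> 0" and unit: "lead_coeff F dvd 1"
  shows "lead_coeff N dvd coeff N j"
  using assms(1,2)
proof (induction "degree a" arbitrary: a N E rule: less_induct)
  case less
  have F0: "F \<noteq> 0" using unit by auto
  have NE: "N \<noteq> 0" "E \<noteq> 0" using less.prems F0 by auto
  show ?case
  proof (cases "degree a = 0")
    case True
    with less.prems(2) have "a dvd 1" by (simp add: is_unit_iff_degree)
    with unit have "a * lead_coeff F dvd 1" using mult_dvd_mono[of a 1 "lead_coeff F" 1] by simp
    also have "a * lead_coeff F = lead_coeff N * lead_coeff E"
      using arg_cong[OF less.prems(1), of lead_coeff] less.prems(2) by (simp add: lead_coeff_mult)
    finally have "lead_coeff N dvd 1" by (rule dvd_mult_left)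
    then show ?thesis by (rule dvd_trans) simp
  next
    case False
    then obtain t where t: "poly a t = 0" using alg_closed_imp_poly_has_root by blast
    then obtain a' where a': "a = [:-t, 1:] * a'" by (auto simp: poly_eq_0_iff_dvd elim: dvdE)
    then have a'0: "a' \<noteq> 0" using less.prems(2) by auto
    have deg: "degree a' < degree a" using a'0 by (simp add: a' degree_mult_eq del: mult_pCons_left)
    have cancel: "Polynomial.smult a' F = X" if "Polynomial.smult a F = Polynomial.smult [:-t, 1:] X" for X
    proof -
      from that have "Polynomial.smult [:-t, 1:] (Polynomial.smult a' F - X) = 0"
        by (simp add: a' smult_diff_right smult_smult del: mult_pCons_left)
      then show ?thesis by simp
    qed
    have "spec t N * spec t E = 0"
      using arg_cong[OF less.prems(1), of "spec t"] t by (simp add: spec_smult spec_hom.hom_mult)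
    then consider "spec t N = 0" | "spec t E = 0" by auto
    then show ?thesis
    proof cases
      case 1
      then obtain N' where N': "N = Polynomial.smult [:-t, 1:] N'" by (rule spec_eq_0)
      have "Polynomial.smult a' F = N' * E" by (rule cancel) (use less.prems(1) N' in simp)
      from less.hyps[OF deg this a'0] have "lead_coeff N' dvd coeff N' j" .
      moreover have "lead_coeff N = [:-t, 1:] * lead_coeff N'" "coeff N j = [:-t, 1:] * coeff N' j"
        by (simp_all add: N' del: mult_pCons_left)
      ultimately show ?thesis by (simp only: mult_dvd_mono[OF dvd_refl])
    next
      case 2
      then obtain E' where E': "E = Polynomial.smult [:-t, 1:] E'" by (rule spec_eq_0)
      have "Polynomial.smult a' F = N * E'" by (rule cancel) (use less.prems(1) E' in simp)
      from less.hyps[OF deg this a'0] show ?thesis .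
    qed
  qed
qed

section \<open>Divisibility up to powers\<close>

text \<open>The Nullstellensatz in one variable: split off one root of \<open>p\<close> at a time, each of them using up one factor \<open>T\<close>.\<close>

lemma roots_subset_imp_dvd_power:
  fixes p T :: "'k::alg_closed_field poly"
  assumes "p \<noteq> 0" "\<And>s. poly p s = 0 \<Longrightarrow> poly T s = 0"
  shows "p dvd T ^ degree p"
  using assms
proof (induction "degree p" arbitrary: p)
  case 0
  then show ?case by (simp add: is_unit_iff_degree)
next
  case (Suc n)
  then obtain a where a: "poly p a = 0" using alg_closed_imp_poly_has_root[of p] by auto
  then obtain p' where p': "p = [:-a, 1:] * p'" by (auto simp: poly_eq_0_iff_dvd elim: dvdE)
  have p'0: "p' \<noteq> 0" using p' Suc.prems(1) by auto
  have deg: "degree p = Suc (degree p')" using p'0 by (simp add: p' degree_mult_eq del: mult_pCons_left)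
  have "p' dvd T ^ degree p'"
    by (rule Suc.hyps(1)) (use deg Suc p' p'0 in auto)
  moreover have "[:-a, 1:] dvd T" using a Suc.prems(2) by (simp add: poly_eq_0_iff_dvd)
  ultimately have "[:-a, 1:] * p' dvd T * T ^ degree p'" by (rule mult_dvd_mono[rotated])
  then show ?case using p' deg by simp
qed

text \<open>Up to elements of the base ring, the radicals of the principal ideals \<open>(p\<^sub>n)\<close> form a decreasing
  sequence of ideals which all contain \<open>T\<close>. The least degrees of their nonzero elements increase
  and are bounded by the degree of \<open>T\<close>, so the sequence is eventually constant.\<close>

lemma radical_chain_stabilizes:
  fixes p :: "nat \<Rightarrow> 'a::idom poly"
  assumes T: "T \<noteq> 0" "\<And>n. \<exists>N. p n dvd T ^ N"
    and chain: "\<And>n. \<exists>N. p n dvd p (Suc n) ^ N"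
    and unit: "\<And>n. lead_coeff (p n) dvd 1"
  obtains n0 where "\<And>n. n \<ge> n0 \<Longrightarrow> \<exists>N. p n dvd p n0 ^ N"
proof -
  define Q where "Q n h \<longleftrightarrow> (\<exists>c N. c \<noteq> 0 \<and> p n dvd Polynomial.smult c (h ^ N))" for n h
  have Q_I: "Q n h" if "p n dvd h ^ N" for n h N
    unfolding Q_def using that by (intro exI[of _ 1] exI[of _ N]) simp
  have Q_T: "Q n T" for n using T(2)[of n] Q_I by blast
  have Q_p: "Q n (p n)" for n by (rule Q_I[of _ _ 1]) simp
  have Q_mult: "Q n (u * h)" if "Q n h" for n u h
  proof -
    from that obtain c N where c: "c \<noteq> 0" "p n dvd Polynomial.smult c (h ^ N)" by (auto simp: Q_def)
    have "p n dvd u ^ N * Polynomial.smult c (h ^ N)" using c(2) by (rule dvd_mult)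
    also have "\<dots> = Polynomial.smult c ((u * h) ^ N)" by (simp add: power_mult_distrib)
    finally show ?thesis using c(1) by (auto simp: Q_def)
  qed
  have Q_add: "Q n (h + h')" if "Q n h" "Q n h'" for n h h'
  proof -
    from that(1) obtain c N where c: "c \<noteq> 0" "p n dvd Polynomial.smult c (h ^ N)" by (auto simp: Q_def)
    from that(2) obtain c' N' where c': "c' \<noteq> 0" "p n dvd Polynomial.smult c' (h' ^ N')" by (auto simp: Q_def)
    have "p n dvd Polynomial.smult (c * c') ((h + h') ^ (N + N'))"
      unfolding binomial_ring smult_sum2
    proof (rule dvd_sum)
      fix k assume k: "k \<in> {..N + N'}"
      show "p n dvd Polynomial.smult (c * c') (of_nat (N + N' choose k) * h ^ k * h' ^ (N + N' - k))"
      proof (cases "N \<le> k")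
        case True
        then have hk: "h ^ k = h ^ N * h ^ (k - N)" by (simp flip: power_add)
        have "Polynomial.smult (c * c') (of_nat (N + N' choose k) * h ^ k * h' ^ (N + N' - k))
            = Polynomial.smult c (h ^ N) * Polynomial.smult c' (of_nat (N + N' choose k) * h ^ (k - N) * h' ^ (N + N' - k))"
          unfolding hk by (simp add: algebra_simps)
        then show ?thesis using dvd_mult2[OF c(2)] by (simp only:)
      next
        case False
        then have "N' + (N - k) = N + N' - k" by simp
        then have "h' ^ (N + N' - k) = h' ^ N' * h' ^ (N - k)" by (metis power_add)
        then have "Polynomial.smult (c * c') (of_nat (N + N' choose k) * h ^ k * h' ^ (N + N' - k))
            = Polynomial.smult c' (h' ^ N') * Polynomial.smult c (of_nat (N + N' choose k) * h ^ k * h' ^ (N - k))"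
          by (simp add: algebra_simps)
        then show ?thesis using dvd_mult2[OF c'(2)] by (simp only:)
      qed
    qed
    moreover have "c * c' \<noteq> 0" using c(1) c'(1) by simp
    ultimately show ?thesis unfolding Q_def by blast
  qed
  have Q_Suc: "Q n h" if h: "Q (Suc n) h" for n h
  proof -
    from h obtain c N where c: "c \<noteq> 0" "p (Suc n) dvd Polynomial.smult c (h ^ N)" by (auto simp: Q_def)
    from chain obtain M where M: "p n dvd p (Suc n) ^ M" by blast
    note M
    also have "p (Suc n) ^ M dvd Polynomial.smult c (h ^ N) ^ M" using c(2) by (rule dvd_power_same)
    also have "\<dots> = Polynomial.smult (c ^ M) (h ^ (N * M))" by (simp add: smult_power power_mult)
    finally show ?thesis using c(1) unfolding Q_def by (intro exI[of _ "c ^ M"] exI[of _ "N * M"]) simp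
  qed
  have Q_le: "Q n h" if "n \<le> n'" "Q n' h" for n n' h
    using that by (induction rule: dec_induct) (auto intro: Q_Suc)
  have "\<exists>r. r \<noteq> 0 \<and> Q n r \<and> (\<forall>h. h \<noteq> 0 \<longrightarrow> Q n h \<longrightarrow> degree r \<le> degree h)" for n
    using ex_has_least_nat[of "\<lambda>h. h \<noteq> 0 \<and> Q n h" T degree] T(1) Q_T[of n] by auto
  then obtain r where r: "\<And>n. r n \<noteq> 0" "\<And>n. Q n (r n)"
    and least: "\<And>n h. h \<noteq> 0 \<Longrightarrow> Q n h \<Longrightarrow> degree (r n) \<le> degree h" by metis
  have generator: "\<exists>a q. a \<noteq> 0 \<and> Polynomial.smult a h = r n * q" if h: "Q n h" for n h
  proof -
    define e where "e = pseudo_mod h (r n)"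
    obtain a q where a: "a \<noteq> 0" and eq: "Polynomial.smult a h = r n * q + e"
      and e: "e = 0 \<or> degree e < degree (r n)"
      using pseudo_mod[OF r(1), of h n] by (auto simp: e_def)
    have "e = [:a:] * h + (- q) * r n" using eq by (simp add: algebra_simps)
    then have "Q n e" using Q_add[OF Q_mult[OF h] Q_mult[OF r(2)]] by metis
    with least e have "e = 0" by force
    with a eq show ?thesis by auto
  qed
  have "\<forall>n. True \<longrightarrow> degree (r n) < Suc (degree T)" using least[OF T(1) Q_T] by (simp add: less_Suc_eq_le)
  then obtain n0 where n0: "\<And>n. degree (r n) \<le> degree (r n0)"
    using ex_has_greatest_nat[of "\<lambda>n. True" 0 "\<lambda>n. degree (r n)"] by blast
  have "\<exists>N. p n dvd p n0 ^ N" if n: "n \<ge> n0" for n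
  proof -
    have Qn: "Q n0 (r n)" using Q_le[OF n r(2)] .
    from generator[OF this] obtain a q where a: "a \<noteq> 0" and q: "Polynomial.smult a (r n) = r n0 * q" by blast
    have q0: "q \<noteq> 0" using q a r(1)[of n] by auto
    have "degree (r n) = degree (r n0) + degree q"
      using arg_cong[OF q, of degree] a q0 r(1)[of n0] by (simp add: degree_mult_eq)
    with n0[of n] have "degree q = 0" by simp
    then obtain \<kappa> where \<kappa>: "q = [:\<kappa>:]" by (rule degree_eq_zeroE)
    with q0 have \<kappa>0: "\<kappa> \<noteq> 0" by simp
    from generator[OF Q_p] obtain b q' where b: "b \<noteq> 0" and q': "Polynomial.smult b (p n0) = r n0 * q'" by blast
    from r(2)[of n] obtain c N where c: "c \<noteq> 0" and dvd: "p n dvd Polynomial.smult c (r n ^ N)"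
      by (auto simp: Q_def)
    have "p n dvd Polynomial.smult (a ^ N) (Polynomial.smult c (r n ^ N)) * q' ^ N" by (rule dvd_mult2[OF dvd_smult[OF dvd]])
    also have "Polynomial.smult (a ^ N) (Polynomial.smult c (r n ^ N)) * q' ^ N = Polynomial.smult c (Polynomial.smult a (r n) ^ N * q' ^ N)"
      by (simp add: smult_power mult.commute)
    also have "\<dots> = Polynomial.smult (c * \<kappa> ^ N) ((r n0 * q') ^ N)"
      unfolding q \<kappa> by (simp add: power_mult_distrib smult_power)
    also have "\<dots> = Polynomial.smult (c * \<kappa> ^ N * b ^ N) (p n0 ^ N)"
      unfolding q'[symmetric] by (simp add: smult_power)
    finally have "p n dvd p n0 ^ N"
      by (rule unit_lead_dvd_cancel[OF unit, rotated]) (use c \<kappa>0 b in simp)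
    then show ?thesis ..
  qed
  then show ?thesis by (rule that)
qed

section \<open>Lines avoiding the common zeros of a system of forms\<close>

definition free_line :: "nat \<Rightarrow> (nat \<Rightarrow> 'k::field mpoly) \<Rightarrow> (nat \<Rightarrow> 'k) \<Rightarrow> (nat \<Rightarrow> 'k) \<Rightarrow> bool" where
  "free_line m F v w \<longleftrightarrow>
     (\<forall>\<alpha> \<beta>. \<alpha> \<noteq> 0 \<or> \<beta> \<noteq> 0 \<longrightarrow> (\<exists>i\<le>m. value_at (\<lambda>j. \<alpha> * v j + \<beta> * w j) (F i) \<noteq> 0))"

lemma comm_ring_hom_const_poly2: "comm_ring_hom (\<lambda>c::'a::comm_ring_1. [:[:c:]:])"
  by (rule comm_ring_hom_comp[OF comm_ring_hom_const_poly comm_ring_hom_const_poly])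

lemma comm_ring_hom_poly2: "comm_ring_hom (\<lambda>q. poly (poly q [:s::'a::comm_ring_1:]) t)"
  by (rule comm_ring_hom_comp[OF comm_ring_hom_poly comm_ring_hom_poly])

lemma poly2_peval:
  "poly (poly (peval (\<lambda>c. [:[:c:]:]) \<omega> p) [:s:]) t = value_at (\<lambda>j. poly (poly (\<omega> j) [:s:]) t) p"
  using hom_peval[OF comm_ring_hom_const_poly2 comm_ring_hom_poly2[of s t], of \<omega> p] by simp

lemma peval_const: 
  assumes "comm_ring_hom \<kappa>"
  shows "peval \<kappa> (\<lambda>j. \<kappa> (v j)) p = \<kappa> (value_at v p)"
  using hom_peval[OF comm_ring_hom_id assms, of v p] by simp

text \<open>A system of forms without zeros on some line has no nonconstant common factor, not even
  locally: every parallel system of forms is a multiple of it at each point. It is enough to see this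
  on the plane spanned by the line and the point, where elimination applies.\<close>

lemma parallel_forms_vanish:
  fixes F H :: "nat \<Rightarrow> 'k::alg_closed_field mpoly"
  assumes F: "\<And>i. i \<le> m \<Longrightarrow> F i \<in> forms m d"
    and line: "free_line m F v w"
    and par: "\<And>i j. i \<le> m \<Longrightarrow> j \<le> m \<Longrightarrow> H i * F j = H j * F i"
    and zero: "\<And>i. i \<le> m \<Longrightarrow> value_at x (F i) = 0"
    and i: "i \<le> m"
  shows "value_at x (H i) = 0"
proof -
  define \<omega> where "\<omega> j = [:[:x j, w j - x j:], [:v j:]:]" for j
  define y where "y i = peval (\<lambda>c. [:[:c:]:]) \<omega> (F i)" for i
  define z where "z i = peval (\<lambda>c. [:[:c:]:]) \<omega> (H i)" for i
  have y_val: "poly (poly (y i) [:s:]) t = value_at (\<lambda>j. x j + t * (w j - x j) + s * v j) (F i)" for i s t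
    unfolding y_def poly2_peval by (simp add: \<omega>_def algebra_simps)
  have z_val: "poly (poly (z i) [:s:]) t = value_at (\<lambda>j. x j + t * (w j - x j) + s * v j) (H i)" for i s t
    unfolding z_def poly2_peval by (simp add: \<omega>_def algebra_simps)
  from line[unfolded free_line_def, rule_format, of 1 0]
  obtain a where a: "a \<le> m" "value_at v (F a) \<noteq> 0" by auto
  have "top_coeff (1 * d) (y a) (peval (\<lambda>c. [:c:]) (\<lambda>j. [:v j:]) (F a))"
    unfolding y_def
  proof (rule top_coeff_peval[OF F[OF a(1)]])
    show "top_coeff 1 (\<omega> i) [:v i:]" for i by (auto simp: top_coeff_def \<omega>_def)
  qed
  then have top: "top_coeff d (y a) [:value_at v (F a):]"
    by (simp add: peval_const[OF comm_ring_hom_const_poly])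
  then have "degree (y a) = d" using a(2) by (auto simp: top_coeff_def intro!: antisym le_degree)
  then have lead: "lead_coeff (y a) = [:value_at v (F a):]" using top by (simp add: top_coeff_def)
  have ya: "y a \<noteq> 0" using lead a(2) by auto
  have "\<exists>i\<le>m. poly (poly (y i) [:s:]) 1 \<noteq> 0" for s
    using line[unfolded free_line_def, rule_format, of s 1] by (simp add: y_val add.commute)
  moreover have "poly (lead_coeff (y a)) 1 \<noteq> 0" unfolding lead using a(2) by simp
  ultimately obtain h c where h: "h \<noteq> 0" and c: "[:h:] = (\<Sum>i\<le>m. c i * y i)"
    using elimination[of a m y 1] a(1) by blast
  interpret ev: comm_ring_hom "peval (\<lambda>c::'k. [:[:c:]:]) \<omega>"
    by (rule peval_hom[OF comm_ring_hom_const_poly2])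
  have par': "z i * y j = z j * y i" if "i \<le> m" "j \<le> m" for i j
    using arg_cong[OF par[OF that], of "peval (\<lambda>c. [:[:c:]:]) \<omega>"] by (simp add: ev.hom_mult y_def z_def)
  have "Polynomial.smult h (z a) = [:h:] * z a" by simp
  also have "\<dots> = (\<Sum>i\<le>m. c i * (z a * y i))" unfolding c by (simp add: sum_distrib_left algebra_simps)
  also have "\<dots> = (\<Sum>i\<le>m. c i * (z i * y a))" by (rule sum.cong) (use par' a(1) in auto)
  also have "\<dots> = y a * (\<Sum>i\<le>m. c i * z i)" by (simp add: sum_distrib_left algebra_simps)
  finally have "y a dvd Polynomial.smult h (z a)" by simp
  then have "y a dvd z a"
    by (rule unit_lead_dvd_cancel[rotated 2]) (use a(2) h in \<open>simp_all add: lead is_unit_iff_degree\<close>)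
  then obtain q where q: "z a = y a * q" by (elim dvdE)
  have "y a * z i = y a * (q * y i)" using par'[OF i a(1)] q by (simp add: algebra_simps)
  then have "z i = q * y i" using ya by simp
  then have "poly (poly (z i) [:0:]) 0 = poly (poly q [:0:]) 0 * poly (poly (y i) [:0:]) 0" by simp
  then show ?thesis using zero[OF i] by (simp only: y_val z_val) simp
qed

section \<open>Restriction to all lines in one direction\<close>

text \<open>\<open>shift v p\<close> is \<open>p(u + s v)\<close>, a polynomial in \<open>s\<close> whose coefficients are polynomials in \<open>u\<close>.\<close>

definition shift :: "(nat \<Rightarrow> 'k::field) \<Rightarrow> 'k mpoly \<Rightarrow> 'k mpoly poly" where
  "shift v p = peval (\<lambda>c. [:Const c:]) (\<lambda>j. [:Var j, Const (v j):]) p"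

lemma comm_ring_hom_Const_poly: "comm_ring_hom (\<lambda>c::'k::field. [:Const c:])"
  by (rule comm_ring_hom_comp[OF comm_ring_hom_const_poly comm_ring_hom_single])

lemma comm_ring_hom_shift: "comm_ring_hom (shift v)"
proof -
  have "shift v = peval (\<lambda>c. [:Const c:]) (\<lambda>j. [:Var j, Const (v j):])" by (rule ext) (simp add: shift_def)
  then show ?thesis using peval_hom[OF comm_ring_hom_Const_poly] by simp
qed

interpretation shift_hom: comm_ring_hom "shift v" for v :: "nat \<Rightarrow> 'k::field"
  by (rule comm_ring_hom_shift)

abbreviation coeffs_at :: "(nat \<Rightarrow> 'k::field) \<Rightarrow> 'k mpoly poly \<Rightarrow> 'k poly" where
  "coeffs_at u \<equiv> map_poly (value_at u)"

interpretation coeffs_at_hom: comm_ring_hom "map_poly (value_at u)" for u :: "nat \<Rightarrow> 'k::field"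
  by (rule comm_ring_hom_map_poly[OF comm_ring_hom_value_at])

lemma poly_coeffs_at: "poly (coeffs_at u q) s = value_at u (poly q (Const s))"
  using value_at_hom.poly_map_poly[of u q "Const s"] by simp

lemma value_at_poly_shift: "value_at u (poly (shift v p) (Const s)) = value_at (\<lambda>j. u j + s * v j) p"
proof -
  have "comm_ring_hom (\<lambda>q. value_at u (poly q (Const s)))"
    by (rule comm_ring_hom_comp[OF comm_ring_hom_value_at comm_ring_hom_poly])
  from hom_peval[OF comm_ring_hom_Const_poly this, of "\<lambda>j. [:Var j, Const (v j):]" p]
  show ?thesis by (simp add: shift_def value_at_hom.hom_add value_at_hom.hom_mult del: One_nat_def)
qed

lemma poly_shift_0: "poly (shift v p) 0 = p"
proof -
  from hom_peval[OF comm_ring_hom_Const_poly comm_ring_hom_poly[of 0], of "\<lambda>j. [:Var j, Const (v j):]" p]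
  show ?thesis by (simp add: shift_def subst_poly_Var del: One_nat_def)
qed

lemma top_coeff_shift:
  assumes "p \<in> forms n d"
  shows "top_coeff d (shift v p) (Const (value_at v p))"
proof -
  have "top_coeff (1 * d) (shift v p) (peval Const (\<lambda>j. Const (v j)) p)"
    unfolding shift_def by (rule top_coeff_peval[OF assms]) (auto simp: top_coeff_def)
  then show ?thesis by (simp add: peval_const[OF comm_ring_hom_single])
qed

lemma Const_eq_0 [simp]: "Const c = 0 \<longleftrightarrow> c = 0"
  by (metis lookup_single_eq lookup_zero single_zero)

lemma Const_unit: "c \<noteq> 0 \<Longrightarrow> Const c dvd 1"
  by (rule dvdI[of _ _ "Const (inverse c)"]) (simp add: mult_single single_one)

lemma lead_shift:
  assumes "p \<in> forms n d" "value_at v p \<noteq> 0"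
  shows "degree (shift v p) = d" "lead_coeff (shift v p) = Const (value_at v p)"
proof -
  have top: "top_coeff d (shift v p) (Const (value_at v p))" by (rule top_coeff_shift[OF assms(1)])
  then show deg: "degree (shift v p) = d"
    using assms(2) by (auto simp: top_coeff_def intro!: antisym le_degree)
  show "lead_coeff (shift v p) = Const (value_at v p)" using top by (simp add: deg top_coeff_def)
qed

lemma lead_shift_unit:
  assumes "p \<in> forms n d" "value_at v p \<noteq> 0"
  shows "lead_coeff (shift v p) dvd 1"
  using lead_shift[OF assms] Const_unit assms(2) by simp

text \<open>The coefficient of \<open>p(u + s w)\<close> in top degree is the value at \<open>w\<close> of the homogeneous component of highest
  degree of \<open>p\<close>, a nonzero constant for general \<open>w\<close>.\<close>

lemma exists_unit_direction:
  fixes p :: "'k::field mpoly"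
  assumes inf: "infinite (UNIV :: 'k set)" and p: "p \<noteq> 0"
  shows "\<exists>w. lead_coeff (shift w p) dvd 1"
proof -
  let ?K = "Poly_Mapping.keys p"
  have K: "?K \<noteq> {}" using p by simp
  define D where "D = Max (mdeg ` ?K)"
  have D: "mdeg m \<le> D" if "m \<in> ?K" for m unfolding D_def by (rule Max_ge) (use that in auto)
  have "D \<in> mdeg ` ?K" unfolding D_def by (rule Max_in) (use K in auto)
  then obtain m0 where m0: "m0 \<in> ?K" "mdeg m0 = D" by auto
  define P where "P = (\<Sum>m\<in>?K. if mdeg m = D then Poly_Mapping.single m (Poly_Mapping.lookup p m) else 0)"
  have "Poly_Mapping.lookup P m0 = (\<Sum>m\<in>?K. if m = m0 then Poly_Mapping.lookup p m else 0)"
    unfolding P_def lookup_sum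
    by (rule sum.cong) (use m0 in \<open>auto simp: lookup_single when_def\<close>)
  then have "Poly_Mapping.lookup P m0 \<noteq> 0" using m0(1) by (simp add: in_keys_iff)
  then have "P \<noteq> 0" by auto
  then obtain w where w: "value_at w P \<noteq> 0" using value_at_all_zero_imp_zero[OF inf] by blast
  have "top_coeff D (shift w (\<Sum>m\<in>?K. Poly_Mapping.single m (Poly_Mapping.lookup p m)))
     (\<Sum>m\<in>?K. Const (value_at w (if mdeg m = D then Poly_Mapping.single m (Poly_Mapping.lookup p m) else 0)))"
    unfolding shift_hom.hom_sum
  proof (rule top_coeff_sum)
    fix m assume m: "m \<in> ?K"
    let ?s = "Poly_Mapping.single m (Poly_Mapping.lookup p m)"
    obtain n where "Poly_Mapping.keys m \<subseteq> {..n}"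
      using finite_nat_iff_bounded_le[of "Poly_Mapping.keys m"] by auto
    then have "?s \<in> forms n (mdeg m)" by (auto simp: forms_def)
    then have top: "top_coeff (mdeg m) (shift w ?s) (Const (value_at w ?s))" by (rule top_coeff_shift)
    show "top_coeff D (shift w ?s) (Const (value_at w (if mdeg m = D then ?s else 0)))"
    proof (cases "mdeg m = D")
      case True
      then show ?thesis using top by simp
    next
      case False
      then have "mdeg m < D" using D[OF m] by simp
      then show ?thesis using False top by (auto simp: top_coeff_def coeff_eq_0)
    qed
  qed
  also have "(\<Sum>m\<in>?K. Const (value_at w (if mdeg m = D then Poly_Mapping.single m (Poly_Mapping.lookup p m) else 0)))
    = Const (value_at w P)"
  proof -
    interpret c: comm_ring_hom "Const :: 'k \<Rightarrow> _" by (rule comm_ring_hom_single)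
    show ?thesis by (simp add: P_def value_at_hom.hom_sum c.hom_sum)
  qed
  finally have top: "top_coeff D (shift w p) (Const (value_at w P))"
    by (simp flip: poly_mapping_expansion)
  have "coeff (shift w p) D \<noteq> 0" using top w by (auto simp: top_coeff_def)
  then have "degree (shift w p) = D" using top by (auto simp: top_coeff_def intro!: antisym le_degree)
  then have "lead_coeff (shift w p) = Const (value_at w P)" using top by (simp add: top_coeff_def)
  then have "lead_coeff (shift w p) dvd 1" using Const_unit[OF w] by simp
  then show ?thesis by (rule exI[of _ w])
qed

lemma mpoly_poly_eq_0:
  fixes r :: "'k::field mpoly poly"
  assumes "infinite (UNIV :: 'k set)" "\<And>u. coeffs_at u r = 0"
  shows "r = 0"
proof (rule poly_eqI)
  fix n
  have "value_at u (coeff r n) = 0" for u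
    using arg_cong[OF assms(2)[of u], of "\<lambda>q. coeff q n"] by simp
  then show "coeff r n = coeff 0 n" using value_at_all_zero_imp_zero[OF assms(1)] by simp
qed

lemma degree_coeffs_at_le: "degree (coeffs_at u r) \<le> degree r"
  by (rule degree_le) (simp add: coeff_eq_0)

lemma degree_coeffs_at_unit:
  assumes "lead_coeff y dvd 1"
  shows "degree (coeffs_at u y) = degree y"
proof -
  have "value_at u (lead_coeff y) dvd value_at u 1" using assms by (auto elim!: dvdE simp flip: value_at_hom.hom_mult)
  then have "coeff (coeffs_at u y) (degree y) \<noteq> 0" by auto
  then show ?thesis using degree_coeffs_at_le[of u y] le_degree antisym by blast
qed

text \<open>The remainder of the division of \<open>z\<close> by \<open>y\<close> specializes to the remainders of the specializations, which vanish;
  so its coefficients vanish at all points.\<close>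

lemma unit_lead_dvd_pointwise:
  fixes y z :: "'k::field mpoly poly"
  assumes inf: "infinite (UNIV :: 'k set)" and unit: "lead_coeff y dvd 1"
    and dvd: "\<And>u. coeffs_at u y dvd coeffs_at u z"
  shows "y dvd z"
proof -
  obtain q r where z: "z = y * q + r" and r: "r = 0 \<or> degree r < degree y"
    using unit_lead_division[OF unit] by blast
  have "coeffs_at u r = 0" for u
  proof (rule ccontr)
    assume ne: "coeffs_at u r \<noteq> 0"
    then have "r \<noteq> 0" by auto
    have "coeffs_at u r = coeffs_at u z - coeffs_at u y * coeffs_at u q"
      by (simp add: z coeffs_at_hom.hom_add coeffs_at_hom.hom_mult)
    also have "coeffs_at u y dvd \<dots>" by (rule dvd_diff[OF dvd dvd_triv_left])
    finally have "degree (coeffs_at u y) \<le> degree (coeffs_at u r)" using ne by (rule dvd_imp_degree_le)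
    then show False
      using degree_coeffs_at_le[of u r] degree_coeffs_at_unit[OF unit, of u] r \<open>r \<noteq> 0\<close> by simp
  qed
  then have "r = 0" by (rule mpoly_poly_eq_0[OF inf])
  then show ?thesis using z by simp
qed

text \<open>The Nullstellensatz for a hypersurface reduces to one variable by restriction to the lines in direction \<open>v\<close>.\<close>

lemma hypersurface_subset_imp_dvd_power:
  fixes p T :: "'k::alg_closed_field mpoly"
  assumes p: "p \<in> forms n d" "value_at v p \<noteq> 0"
    and sub: "\<And>x. value_at x p = 0 \<Longrightarrow> value_at x T = 0"
  shows "shift v p dvd shift v T ^ d"
proof (rule unit_lead_dvd_pointwise[OF alg_closed_infinite lead_shift_unit[OF p]])
  fix u
  have deg: "degree (coeffs_at u (shift v p)) = d"
    using degree_coeffs_at_unit[OF lead_shift_unit[OF p]] lead_shift(1)[OF p] by simp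
  have "value_at u (lead_coeff (shift v p)) \<noteq> 0" using lead_shift(2)[OF p] p(2) by simp
  then have "coeffs_at u (shift v p) \<noteq> 0"
    by (metis coeff_0 coeff_map_poly value_at_hom.hom_zero)
  then have "coeffs_at u (shift v p) dvd coeffs_at u (shift v T) ^ degree (coeffs_at u (shift v p))"
    by (rule roots_subset_imp_dvd_power) (use sub in \<open>auto simp: poly_coeffs_at value_at_poly_shift\<close>)
  then show "coeffs_at u (shift v p) dvd coeffs_at u (shift v T ^ d)"
    unfolding deg by (simp add: coeffs_at_hom.hom_power)
qed

text \<open>Restricted to all lines in a direction \<open>v\<close> with \<open>T(v) \<noteq> 0\<close>, inclusions of hypersurfaces become divisibilities up to
  powers, to which the previous result on radicals applies.\<close>

lemma hypersurface_chain_stabilizes: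
  fixes p :: "nat \<Rightarrow> 'k::alg_closed_field mpoly"
  assumes p: "\<And>n. p n \<in> forms m (d n)" and T: "T \<noteq> 0"
    and sub: "\<And>n x. value_at x (p n) = 0 \<Longrightarrow> value_at x T = 0"
    and chain: "\<And>n x. value_at x (p n) = 0 \<Longrightarrow> value_at x (p (Suc n)) = 0"
  obtains n0 where "\<And>n x. n \<ge> n0 \<Longrightarrow> value_at x (p n) = 0 \<Longrightarrow> value_at x (p n0) = 0"
proof -
  obtain v where v: "value_at v T \<noteq> 0" using T value_at_all_zero_imp_zero[OF alg_closed_infinite] by blast
  then have pv: "value_at v (p n) \<noteq> 0" for n using sub by blast
  have "shift v T \<noteq> 0"
  proof
    assume "shift v T = 0"
    then have "T = 0" using poly_shift_0[of v T] by simp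
    with T show False ..
  qed
  moreover have "\<exists>N. shift v (p n) dvd shift v T ^ N" for n
    using hypersurface_subset_imp_dvd_power[OF p[of n] pv[of n], of T] sub by blast
  moreover have "\<exists>N. shift v (p n) dvd shift v (p (Suc n)) ^ N" for n
    using hypersurface_subset_imp_dvd_power[OF p[of n] pv[of n], of "p (Suc n)"] chain by blast
  ultimately obtain n0 where n0: "\<And>n. n \<ge> n0 \<Longrightarrow> \<exists>N. shift v (p n) dvd shift v (p n0) ^ N"
    using radical_chain_stabilizes[of "shift v T" "\<lambda>n. shift v (p n)"] lead_shift_unit[OF p pv] by blast
  have "value_at x (p n0) = 0" if n: "n \<ge> n0" and zero: "value_at x (p n) = 0" for n x
  proof -
    from n0[OF n] obtain N q where "shift v (p n0) ^ N = shift v (p n) * q" by (auto elim: dvdE)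
    from arg_cong[OF this, of "\<lambda>q. value_at x (poly q 0)"]
    have "value_at x (p n0) ^ N = 0" using zero by (simp add: poly_shift_0 value_at_hom.hom_mult value_at_hom.hom_power)
    then show ?thesis by simp
  qed
  then show ?thesis by (rule that)
qed

section \<open>Systems of forms without common factor\<close>

lemma dvd_if_dvd_on_lines:
  fixes b c :: "'k::field mpoly"
  assumes inf: "infinite (UNIV :: 'k set)" and unit: "lead_coeff (shift w b) dvd 1"
    and dvd: "\<And>u. coeffs_at u (shift w b) dvd coeffs_at u (shift w c)"
  shows "b dvd c"
proof -
  from unit_lead_dvd_pointwise[OF inf unit dvd] obtain q where "shift w c = shift w b * q" by (elim dvdE)
  from arg_cong[OF this, of "\<lambda>q. poly q 0"] show ?thesis by (simp add: poly_shift_0)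
qed

text \<open>Conversely to the above, forms without common factor have no common zero on a suitable line.
  Write \<open>N\<close> for an element of least degree in the ideal generated by the \<open>F\<^sub>i(u + s v)\<close>. If its degree in
  \<open>s\<close> is zero, it is a polynomial in \<open>u\<close>, and the line in direction \<open>v\<close> through any point \<open>u\<close> at which it
  does not vanish will do. Otherwise Gauss's lemma, applied on lines in the \<open>u\<close>-space, shows that the
  leading coefficient of \<open>N\<close> divides \<open>N\<close>; the quotient divides all \<open>F\<^sub>i(u + s v)\<close>, and substituting
  \<open>u = y - s\<^sub>0 v\<close> and \<open>s = s\<^sub>0\<close> produces a common factor of the \<open>F\<^sub>i\<close>, which vanishes somewhere for a
  suitable choice of \<open>s\<^sub>0\<close>.\<close>

lemma exists_free_line:
  fixes F :: "nat \<Rightarrow> 'k::alg_closed_field mpoly"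
  assumes F: "\<And>i. i \<le> m \<Longrightarrow> F i \<in> forms m d" and nz: "a \<le> m" "F a \<noteq> 0"
    and no_factor: "\<And>D x. (\<And>i. i \<le> m \<Longrightarrow> D dvd F i) \<Longrightarrow> (\<And>j. j > m \<Longrightarrow> x j = 0) \<Longrightarrow> value_at x D \<noteq> 0"
  shows "\<exists>v w. free_line m F v w"
proof -
  note inf = alg_closed_infinite[where 'k='k]
  obtain v0 where v0: "value_at v0 (F a) \<noteq> 0" using nz value_at_all_zero_imp_zero[OF inf] by blast
  define v where "v j = (if j \<le> m then v0 j else 0)" for j
  have "value_at v (F a) = value_at v0 (F a)"
    by (rule peval_forms_cong[OF F[OF nz(1)]]) (simp add: v_def)
  with v0 have v: "value_at v (F a) \<noteq> 0" by simp
  define y where "y i = shift v (F i)" for i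
  have unit: "lead_coeff (y a) dvd 1" unfolding y_def by (rule lead_shift_unit[OF F[OF nz(1)] v])
  then have ya: "y a \<noteq> 0" by auto
  obtain N c where N: "N \<noteq> 0" "N = (\<Sum>i\<le>m. c i * y i)"
    and div: "\<forall>i\<le>m. \<exists>a E. a \<noteq> 0 \<and> Polynomial.smult a (y i) = N * E"
    using ideal_least_degree[of a m y, OF nz(1) ya] by blast
  show ?thesis
  proof (cases "degree N = 0")
    case True
    then obtain b where b: "N = [:b:]" by (rule degree_eq_zeroE)
    with N(1) have "b \<noteq> 0" by auto
    then obtain u where u: "value_at u b \<noteq> 0" using value_at_all_zero_imp_zero[OF inf] by blast
    have on_line: "\<exists>i\<le>m. value_at (\<lambda>j. u j + s * v j) (F i) \<noteq> 0" for s
    proof (rule ccontr)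
      assume "\<not> ?thesis"
      then have z: "value_at u (poly (y i) (Const s)) = 0" if "i \<le> m" for i
        using that by (auto simp: y_def value_at_poly_shift)
      have "value_at u b = value_at u (poly N (Const s))" by (simp add: b)
      also have "\<dots> = (\<Sum>i\<le>m. value_at u (poly (c i) (Const s)) * value_at u (poly (y i) (Const s)))"
        by (subst N(2)) (simp add: poly_sum value_at_hom.hom_sum value_at_hom.hom_mult)
      also have "\<dots> = 0" by (simp add: z)
      finally show False using u by simp
    qed
    have "free_line m F v u"
      unfolding free_line_def
    proof (intro allI impI)
      fix \<alpha> \<beta> :: 'k
      assume nz: "\<alpha> \<noteq> 0 \<or> \<beta> \<noteq> 0"
      show "\<exists>i\<le>m. value_at (\<lambda>j. \<alpha> * v j + \<beta> * u j) (F i) \<noteq> 0"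
      proof (cases "\<beta> = 0")
        case True
        with nz have "\<alpha> \<noteq> 0" by simp
        have "value_at (\<lambda>j. \<alpha> * v j) (F a) = \<alpha> ^ d * value_at v (F a)"
          by (rule peval_forms_scale[OF F[OF \<open>a \<le> m\<close>]])
        with v \<open>\<alpha> \<noteq> 0\<close> True \<open>a \<le> m\<close> show ?thesis by auto
      next
        case False
        obtain i where i: "i \<le> m" "value_at (\<lambda>j. u j + (\<alpha> / \<beta>) * v j) (F i) \<noteq> 0" using on_line by blast
        have "value_at (\<lambda>j. \<beta> * (u j + (\<alpha> / \<beta>) * v j)) (F i) = \<beta> ^ d * value_at (\<lambda>j. u j + (\<alpha> / \<beta>) * v j) (F i)"
          by (rule peval_forms_scale[OF F[OF i(1)]])
        moreover have "(\<lambda>j. \<beta> * (u j + (\<alpha> / \<beta>) * v j)) = (\<lambda>j. \<alpha> * v j + \<beta> * u j)"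
          using False by (simp add: field_simps fun_eq_iff)
        ultimately show ?thesis using i False by auto
      qed
    qed
    then show ?thesis by blast
  next
    case False
    define b where "b = lead_coeff N"
    have b0: "b \<noteq> 0" using N(1) by (simp add: b_def)
    from div nz(1) obtain a0 E0 where a0: "a0 \<noteq> 0" "Polynomial.smult a0 (y a) = N * E0" by blast
    obtain w where w: "lead_coeff (shift w (b * a0)) dvd 1" using exists_unit_direction[OF inf, of "b * a0"] b0 a0 by auto
    have w_split: "lead_coeff (shift w b) * lead_coeff (shift w a0) dvd 1"
      using w by (simp add: shift_hom.hom_mult lead_coeff_mult)
    have wb: "lead_coeff (shift w b) dvd 1" using w_split by (rule dvd_mult_left)
    have wa: "lead_coeff (shift w a0) dvd 1" using w_split by (rule dvd_mult_right)
    have "b dvd coeff N j" for j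
    proof (rule dvd_if_dvd_on_lines[OF inf wb])
      fix u
      define \<rho> where "\<rho> p = coeffs_at u (shift w p)" for p
      have \<rho>_hom: "comm_ring_hom \<rho>"
      proof -
        have "\<rho> = (\<lambda>p. coeffs_at u (shift w p))" by (rule ext) (simp add: \<rho>_def)
        then show ?thesis using comm_ring_hom_comp[OF coeffs_at_hom.comm_ring_hom_axioms comm_ring_hom_shift] by simp
      qed
      interpret r: comm_ring_hom \<rho> by (rule \<rho>_hom)
      have map_hom: "comm_ring_hom (map_poly \<rho>)" by (rule comm_ring_hom_map_poly[OF \<rho>_hom])
      interpret mr: comm_ring_hom "map_poly \<rho>" by (rule map_hom)
      have nz': "\<rho> q \<noteq> 0" if "lead_coeff (shift w q) dvd 1" for q
      proof -
        have "value_at u (lead_coeff (shift w q)) dvd value_at u 1"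
          using that by (auto elim!: dvdE simp flip: value_at_hom.hom_mult)
        then have "coeff (\<rho> q) (degree (shift w q)) \<noteq> 0" by (auto simp: \<rho>_def)
        then show ?thesis by auto
      qed
      have dN: "degree (map_poly \<rho> N) = degree N"
        by (rule antisym[OF degree_le le_degree]) (use nz'[OF wb] in \<open>auto simp: coeff_eq_0 b_def\<close>)
      have eq: "Polynomial.smult (\<rho> a0) (map_poly \<rho> (y a)) = map_poly \<rho> N * map_poly \<rho> E0"
        using arg_cong[OF a0(2), of "map_poly \<rho>"] by (simp add: mr.hom_mult r.map_poly_hom_smult)
      from unit obtain k where "1 = lead_coeff (y a) * k" by (rule dvdE)
      then have "1 = \<rho> (lead_coeff (y a)) * \<rho> k" by (metis r.hom_mult r.hom_one)
      then have u1: "\<rho> (lead_coeff (y a)) dvd 1" by (rule dvdI)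
      have "degree (map_poly \<rho> (y a)) = degree (y a)"
        by (rule antisym[OF degree_le le_degree]) (use u1 in \<open>auto simp: coeff_eq_0\<close>)
      with u1 have "lead_coeff (map_poly \<rho> (y a)) dvd 1" by simp
      from lead_coeff_dvd_factor[OF eq nz'[OF wa] this, of j]
      show "coeffs_at u (shift w b) dvd coeffs_at u (shift w (coeff N j))"
        by (simp add: dN b_def \<rho>_def)
    qed
    then have "[:b:] dvd N" by (simp add: const_poly_dvd_iff)
    then obtain N' where N': "N = Polynomial.smult b N'" by (auto elim!: dvdE)
    have "b = b * lead_coeff N'" using arg_cong[OF N', of lead_coeff] by (simp only: b_def[symmetric] lead_coeff_smult)
    then have lead': "lead_coeff N' = 1" using b0 by simp
    have deg': "degree N' > 0" using False N' b0 by simp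
    have dvd_y: "N' dvd y i" if "i \<le> m" for i
    proof -
      from div that obtain a E where a: "a \<noteq> 0" "Polynomial.smult a (y i) = N * E" by blast
      then have "Polynomial.smult a (y i) = N' * Polynomial.smult b E" by (simp add: N')
      then have "N' dvd Polynomial.smult a (y i)" by (rule dvdI)
      then show ?thesis by (rule unit_lead_dvd_cancel[rotated 2]) (simp_all only: lead' a dvd_refl not_False_eq_True)
    qed
    have "degree (coeffs_at (\<lambda>_. 0) N') > 0"
      using degree_coeffs_at_unit[of N'] lead' deg' by simp
    then obtain s0 where s0: "poly (coeffs_at (\<lambda>_. 0) N') s0 = 0" using alg_closed_imp_poly_has_root by blast
    define \<chi> where "\<chi> q = subst_poly (\<lambda>j. Var j - Const (s0 * v j)) (poly q (Const s0))" for q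
    have \<chi>_hom: "comm_ring_hom \<chi>"
    proof -
      have "\<chi> = (\<lambda>q. subst_poly (\<lambda>j. Var j - Const (s0 * v j)) (poly q (Const s0)))" by (rule ext) (simp add: \<chi>_def)
      then show ?thesis
        using comm_ring_hom_comp[OF peval_hom[OF comm_ring_hom_single] comm_ring_hom_poly] by simp
    qed
    interpret \<chi>: comm_ring_hom \<chi> by (rule \<chi>_hom)
    have value_\<chi>: "value_at x (\<chi> q) = value_at (\<lambda>j. x j - s0 * v j) (poly q (Const s0))" for x q
      unfolding \<chi>_def value_at_subst_poly by (simp add: value_at_hom.hom_minus del: One_nat_def)
    have \<chi>_y: "\<chi> (y i) = F i" for i
    proof -
      have "value_at x (\<chi> (y i) - F i) = 0" for x
        by (simp add: value_at_hom.hom_minus value_\<chi> y_def value_at_poly_shift)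
      then show ?thesis using value_at_all_zero_imp_zero[OF inf] by fastforce
    qed
    have "\<chi> N' dvd F i" if "i \<le> m" for i
    proof -
      from dvd_y[OF that] obtain k where "y i = N' * k" by (rule dvdE)
      then have "F i = \<chi> N' * \<chi> k" by (metis \<chi>_y \<chi>.hom_mult)
      then show ?thesis by (rule dvdI)
    qed
    moreover have "value_at (\<lambda>j. s0 * v j) (\<chi> N') = 0"
      using s0 by (simp add: value_\<chi> poly_coeffs_at)
    ultimately have False using no_factor[of "\<chi> N'" "\<lambda>j. s0 * v j"] by (auto simp: v_def)
    then show ?thesis ..
  qed
qed

section \<open>Descending chains of zero sets\<close>

lemma nat_seq_mono_subseq:
  fixes s :: "nat \<Rightarrow> nat"
  shows "\<exists>r::nat \<Rightarrow> nat. strict_mono r \<and> (\<forall>i j. i \<le> j \<longrightarrow> s (r i) \<le> s (r j))"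
proof -
  obtain f where f: "strict_mono f" "monoseq (\<lambda>n. s (f n))" using seq_monosub[of s] by blast
  show ?thesis
  proof (cases "\<forall>m. \<forall>n\<ge>m. s (f m) \<le> s (f n)")
    case True
    then show ?thesis using f(1) by blast
  next
    case False
    then have dec: "\<And>m n. m \<le> n \<Longrightarrow> s (f n) \<le> s (f m)" using f(2) by (auto simp: monoseq_def)
    obtain n0 where n0: "\<And>n. s (f n0) \<le> s (f n)"
      using ex_has_least_nat[of "\<lambda>_. True" 0 "\<lambda>n. s (f n)"] by auto
    have "s (f (n0 + i)) = s (f n0)" for i using n0[of "n0 + i"] dec[of n0 "n0 + i"] by simp
    moreover have "strict_mono (\<lambda>i. f (n0 + i))" using f(1) by (simp add: strict_mono_def)
    ultimately show ?thesis by (intro exI[of _ "\<lambda>i. f (n0 + i)"]) simp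
  qed
qed

text \<open>Dickson's lemma: pass to a subsequence which is monotone in one more exponent at each step.\<close>

lemma monomial_seq_mono_subseq:
  fixes \<mu> :: "nat \<Rightarrow> nat \<Rightarrow>\<^sub>0 nat"
  shows "\<exists>r::nat \<Rightarrow> nat. strict_mono r \<and> (\<forall>x<n. \<forall>i j. i \<le> j \<longrightarrow> Poly_Mapping.lookup (\<mu> (r i)) x \<le> Poly_Mapping.lookup (\<mu> (r j)) x)"
proof (induction n)
  case 0
  show ?case by (intro exI[of _ "\<lambda>i. i"]) (auto simp: strict_mono_def)
next
  case (Suc n)
  then obtain r :: "nat \<Rightarrow> nat" where r: "strict_mono r"
    "\<forall>x<n. \<forall>i j. i \<le> j \<longrightarrow> Poly_Mapping.lookup (\<mu> (r i)) x \<le> Poly_Mapping.lookup (\<mu> (r j)) x"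
    by (elim exE conjE)
  from nat_seq_mono_subseq[of "\<lambda>i. Poly_Mapping.lookup (\<mu> (r i)) n"]
  obtain r' :: "nat \<Rightarrow> nat" where r': "strict_mono r'"
    "\<forall>i j. i \<le> j \<longrightarrow> Poly_Mapping.lookup (\<mu> (r (r' i))) n \<le> Poly_Mapping.lookup (\<mu> (r (r' j))) n"
    by (elim exE conjE)
  have "strict_mono (\<lambda>i. r (r' i))" using r(1) r'(1) by (simp add: strict_mono_def)
  moreover have "Poly_Mapping.lookup (\<mu> (r (r' i))) x \<le> Poly_Mapping.lookup (\<mu> (r (r' j))) x"
    if "x < Suc n" "i \<le> j" for x i j
  proof (cases "x = n")
    case True
    then show ?thesis using r'(2) that(2) by simp
  next
    case False
    then show ?thesis using r(2)[rule_format, of x "r' i" "r' j"] r'(1) that by (simp add: strict_mono_less_eq)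
  qed
  ultimately show ?case by blast
qed

lemma finite_monomials: "finite {m. Poly_Mapping.keys m \<subseteq> {..n} \<and> mdeg m = d}"
proof (rule finite_imageD)
  show "inj_on Poly_Mapping.lookup {m. Poly_Mapping.keys m \<subseteq> {..n} \<and> mdeg m = d}"
    by (rule inj_onI, rule poly_mapping_eqI) simp
  have "Poly_Mapping.lookup m i \<le> d" if "mdeg m = d" for m and i :: nat
  proof (cases "i \<in> Poly_Mapping.keys m")
    case True
    then show ?thesis using that member_le_sum[of i "Poly_Mapping.keys m" "Poly_Mapping.lookup m"] by simp
  qed (simp add: in_keys_iff)
  then have "Poly_Mapping.lookup ` {m. Poly_Mapping.keys m \<subseteq> {..n} \<and> mdeg m = d}
      \<subseteq> {f. \<forall>x. (x \<in> {..n} \<longrightarrow> f x \<in> {..d}) \<and> (x \<notin> {..n} \<longrightarrow> f x = 0)}"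
    by (auto simp: in_keys_iff subset_iff)
  then show "finite (Poly_Mapping.lookup ` {m. Poly_Mapping.keys m \<subseteq> {..n} \<and> mdeg m = d})"
    by (rule finite_subset) (rule finite_set_of_finite_funs, auto)
qed

lemma lookup_single_mult:
  fixes p :: "'k::field mpoly"
  shows "Poly_Mapping.lookup (Poly_Mapping.single a c * p) (a + b) = c * Poly_Mapping.lookup p b"
proof (induction p rule: poly_mapping_induct_single)
  case (single m c')
  then show ?case by (simp add: mult_single lookup_single when_def)
next
  case (add p q)
  then show ?case by (simp add: distrib_left lookup_add)
qed

text \<open>Hilbert's basis theorem in the form needed below. If the chain were strict, choose for each
  step a form which vanishes on the next set but not on the present one, with least possible leading
  monomial in its degree. By Dickson's lemma some leading monomial divides a later one, and reducing the
  later form by the earlier one contradicts the choice.\<close>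

lemma no_strict_chain_of_zero_sets:
  fixes Z :: "nat \<Rightarrow> (nat \<Rightarrow> 'k::field) set"
  assumes dec: "\<And>j. Z (Suc j) \<subseteq> Z j"
    and step: "\<And>j. \<exists>d. \<exists>p\<in>forms n d. (\<forall>x\<in>Z (Suc j). value_at x p = 0) \<and> (\<exists>x\<in>Z j. value_at x p \<noteq> 0)"
  shows False
proof -
  define P where "P j d p \<longleftrightarrow> p \<in> forms n d \<and> (\<forall>x\<in>Z (Suc j). value_at x p = 0) \<and> (\<exists>x\<in>Z j. value_at x p \<noteq> 0)"
    for j d p
  define lm where "lm p = Max (Poly_Mapping.keys p)" for p :: "'k mpoly"
  have "\<forall>j. \<exists>d p. P j d p" using step unfolding P_def by blast
  then obtain d where d: "\<And>j. \<exists>p. P j (d j) p" by metis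
  have nz: "p \<noteq> 0" if "P j e p" for j e p using that by (auto simp: P_def)
  have lm_key: "lm p \<in> Poly_Mapping.keys p" if "P j e p" for j e p
    unfolding lm_def by (rule Max_in) (use nz[OF that] in auto)
  have "\<exists>p. P j (d j) p \<and> (\<forall>q. P j (d j) q \<longrightarrow> lm p \<le> lm q)" for j
  proof -
    let ?L = "lm ` {p. P j (d j) p}"
    have "?L \<subseteq> {m. Poly_Mapping.keys m \<subseteq> {..n} \<and> mdeg m = d j}"
      using lm_key by (fastforce simp: P_def forms_def)
    then have fin: "finite ?L" by (rule finite_subset[OF _ finite_monomials])
    have "?L \<noteq> {}" using d by blast
    then have "Min ?L \<in> ?L" using fin by (rule Min_in[rotated])
    then obtain p where p: "P j (d j) p" "lm p = Min ?L" by auto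
    have "lm p \<le> lm q" if "P j (d j) q" for q unfolding p(2) by (rule Min_le[OF fin]) (use that in auto)
    with p(1) show ?thesis by blast
  qed
  then obtain p where p: "\<And>j. P j (d j) (p j)" and least: "\<And>j q. P j (d j) q \<Longrightarrow> lm (p j) \<le> lm q" by metis
  from monomial_seq_mono_subseq[of "Suc n" "\<lambda>j. lm (p j)"]
  obtain r :: "nat \<Rightarrow> nat" where r: "strict_mono r"
    "\<forall>x<Suc n. \<forall>i j. i \<le> j \<longrightarrow> Poly_Mapping.lookup (lm (p (r i))) x \<le> Poly_Mapping.lookup (lm (p (r j))) x"
    by (elim exE conjE)
  define i j where "i = r 0" and "j = r 1"
  have ij: "i < j" using r(1) by (simp add: i_def j_def strict_mono_def)
  have sub: "Z b \<subseteq> Z a" if "a \<le> b" for a b using lift_Suc_antimono_le[of Z, OF dec that] .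
  let ?a = "lm (p i)" and ?b = "lm (p j)"
  have keys: "Poly_Mapping.keys (lm (p l)) \<subseteq> {..n}" "mdeg (lm (p l)) = d l" for l
    using p[of l] lm_key[OF p[of l]] by (auto simp: P_def forms_def)
  have le: "Poly_Mapping.lookup ?a x \<le> Poly_Mapping.lookup ?b x" for x
  proof (cases "x \<le> n")
    case True
    then show ?thesis using r(2)[rule_format, of x 0 1] by (simp add: i_def j_def)
  next
    case False
    then have "x \<notin> Poly_Mapping.keys ?a" using keys(1)[of i] by auto
    then show ?thesis by (simp add: in_keys_iff)
  qed
  define \<delta> where "\<delta> = ?b - ?a"
  have b: "?b = \<delta> + ?a" by (rule poly_mapping_eqI) (simp add: \<delta>_def lookup_add lookup_minus le)
  define c where "c = Poly_Mapping.lookup (p j) ?b / Poly_Mapping.lookup (p i) ?a"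
  define q where "q = p j - Poly_Mapping.single \<delta> c * p i"
  have ca: "Poly_Mapping.lookup (p i) ?a \<noteq> 0" using lm_key[OF p[of i]] by (simp add: in_keys_iff)
  have "Poly_Mapping.keys \<delta> \<subseteq> {..n}"
    using keys(1)[of j] by (auto simp: \<delta>_def in_keys_iff lookup_minus subset_iff)
  then have "Poly_Mapping.single \<delta> c \<in> forms n (mdeg \<delta>)" by (auto simp: forms_def)
  moreover have "mdeg \<delta> + d i = d j" by (metis mdeg_add b keys(2))
  moreover have pij: "p i \<in> forms n (d i)" "p j \<in> forms n (d j)" using p by (auto simp: P_def)
  ultimately have "Poly_Mapping.single \<delta> c * p i \<in> forms n (d j)" using forms_mult by metis
  then have "q \<in> forms n (d j)" unfolding q_def by (rule forms_diff[OF pij(2)])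
  moreover have pi_0: "value_at x (p i) = 0" if "x \<in> Z j" for x
    using p[of i] sub[of "Suc i" j] ij that by (auto simp: P_def)
  then have qv: "value_at x q = value_at x (p j)" if "x \<in> Z j" for x
    using that by (simp add: q_def value_at_hom.hom_minus value_at_hom.hom_mult)
  ultimately have Pq: "P j (d j) q" using p[of j] dec[of j] by (auto simp: P_def subset_iff)
  have "lm q \<noteq> ?b"
  proof
    assume "lm q = ?b"
    then have "Poly_Mapping.lookup q ?b \<noteq> 0" using lm_key[OF Pq] by (simp add: in_keys_iff)
    moreover have "Poly_Mapping.lookup (Poly_Mapping.single \<delta> c * p i) ?b = c * Poly_Mapping.lookup (p i) ?a"
      unfolding b by (rule lookup_single_mult)
    ultimately show False using ca by (simp add: q_def lookup_minus c_def)
  qed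
  moreover have "lm q \<le> ?b"
  proof -
    have "lm q \<in> Poly_Mapping.keys (p j) \<union> Poly_Mapping.keys (Poly_Mapping.single \<delta> c * p i)"
      using lm_key[OF Pq] Poly_Mapping.keys_diff[of "p j" "Poly_Mapping.single \<delta> c * p i"] by (auto simp: q_def)
    then show ?thesis
    proof
      assume "lm q \<in> Poly_Mapping.keys (p j)"
      then show ?thesis unfolding lm_def[of "p j"] by (rule Max_ge[rotated]) simp
    next
      assume "lm q \<in> Poly_Mapping.keys (Poly_Mapping.single \<delta> c * p i)"
      then obtain k where k: "lm q = \<delta> + k" "k \<in> Poly_Mapping.keys (p i)"
        using Poly_Mapping.keys_mult[of "Poly_Mapping.single \<delta> c" "p i"] by (auto split: if_splits)
      have "k \<le> ?a" unfolding lm_def by (rule Max_ge) (use k in auto)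
      then show ?thesis unfolding k(1) b by (rule add_left_mono)
    qed
  qed
  ultimately show False using least[OF Pq] by simp
qed

section \<open>Thick sets of matrices\<close>

abbreviation mat_at :: "'k::field poly mat \<Rightarrow> 'k \<Rightarrow> 'k mat" where
  "mat_at M t \<equiv> map_mat (\<lambda>p. poly p t) M"

text \<open>A substitute for very general sets, the complements of countable unions of hypersurfaces, that needs no polynomials
  in the entries of a matrix. It is preserved under taking preimages by polynomial maps, because these map polynomial curves
  to polynomial curves.\<close>

definition thick :: "nat \<Rightarrow> 'k::field mat set \<Rightarrow> bool" where
  "thick N S \<longleftrightarrow> (\<forall>M\<in>carrier_mat N N. \<forall>t0. mat_at M t0 \<in> S \<longrightarrow> countable {t. mat_at M t \<notin> S})"

lemma thickI:
  assumes "\<And>M t0. M \<in> carrier_mat N N \<Longrightarrow> mat_at M t0 \<in> S \<Longrightarrow>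
    \<exists>h. h \<noteq> 0 \<and> (\<forall>t. poly h t \<noteq> 0 \<longrightarrow> mat_at M t \<in> S)"
  shows "thick N S"
  unfolding thick_def
proof (intro ballI allI impI)
  fix M t0 assume "M \<in> carrier_mat N N" "mat_at M t0 \<in> S"
  from assms[OF this] obtain h where h: "h \<noteq> 0" "\<And>t. poly h t \<noteq> 0 \<Longrightarrow> mat_at M t \<in> S" by blast
  then have "{t. mat_at M t \<notin> S} \<subseteq> {t. poly h t = 0}" by blast
  then show "countable {t. mat_at M t \<notin> S}"
    by (rule countable_subset) (rule countable_finite[OF poly_roots_finite[OF h(1)]])
qed

lemma thick_all:
  fixes S :: "nat \<Rightarrow> 'k::field mat set"
  assumes "\<And>k. thick N (S k)"
  shows "thick N {A. \<forall>k. A \<in> S k}"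
  unfolding thick_def
proof (intro ballI allI impI)
  fix M t0 assume M: "M \<in> carrier_mat N N" "mat_at M t0 \<in> {A. \<forall>k. A \<in> S k}"
  have "{t. mat_at M t \<notin> {A. \<forall>k. A \<in> S k}} = (\<Union>k. {t. mat_at M t \<notin> S k})" by auto
  also have "countable \<dots>" by (rule countable_UN) (use assms M in \<open>auto simp: thick_def\<close>)
  finally show "countable {t. mat_at M t \<notin> {A. \<forall>k. A \<in> S k}}" .
qed

lemma thick_Int:
  assumes "thick N S" "thick N S'"
  shows "thick N (S \<inter> S')"
  unfolding thick_def
proof (intro ballI allI impI)
  fix M t0 assume M: "M \<in> carrier_mat N N" "mat_at M t0 \<in> S \<inter> S'"
  have "{t. mat_at M t \<notin> S \<inter> S'} = {t. mat_at M t \<notin> S} \<union> {t. mat_at M t \<notin> S'}" by auto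
  then show "countable {t. mat_at M t \<notin> S \<inter> S'}" using assms M by (auto simp: thick_def)
qed

text \<open>On the line through a point of each set, both sets contain all but countably many points.\<close>

lemma thick_meet:
  assumes unc: "uncountable (UNIV :: 'k::field set)" and S: "thick N S" "thick N S'"
    and A: "A \<in> carrier_mat N N" "A \<in> S" and A': "A' \<in> carrier_mat N N" "(A' :: 'k mat) \<in> S'"
  shows "\<exists>B\<in>carrier_mat N N. B \<in> S \<and> B \<in> S'"
proof -
  define M where "M = mat N N (\<lambda>(i, j). [:A $$ (i, j), A' $$ (i, j) - A $$ (i, j):])"
  have M: "M \<in> carrier_mat N N" by (simp add: M_def)
  have "mat_at M 0 = A" "mat_at M 1 = A'" using A A' by (auto simp: M_def)
  with S M A A' have "countable {t. mat_at M t \<notin> S}" "countable {t. mat_at M t \<notin> S'}"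
    unfolding thick_def by metis+
  then have "countable ({t. mat_at M t \<notin> S} \<union> {t. mat_at M t \<notin> S'})" by simp
  then obtain t where "t \<notin> {t. mat_at M t \<notin> S} \<union> {t. mat_at M t \<notin> S'}"
    using unc by (metis UNIV_eq_I)
  then show ?thesis using M by (intro bexI[of _ "mat_at M t"]) auto
qed

lemma det_mat_at: "det (mat_at M t) = poly (det M) t"
  by (rule comm_ring_hom.hom_det[OF comm_ring_hom_poly])

lemma thick_det: "thick N {A. det A \<noteq> 0}"
proof (rule thickI)
  fix M :: "'a poly mat" and t0 assume "mat_at M t0 \<in> {A. det A \<noteq> 0}"
  then show "\<exists>h. h \<noteq> 0 \<and> (\<forall>t. poly h t \<noteq> 0 \<longrightarrow> mat_at M t \<in> {A. det A \<noteq> 0})"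
    by (intro exI[of _ "det M"]) (auto simp: det_mat_at)
qed

lemma adj_mat_at:
  assumes M: "M \<in> carrier_mat N N"
  shows "adj_mat (mat_at M t) = mat_at (adj_mat M) t"
proof (rule eq_matI)
  fix i j assume "i < dim_row (mat_at (adj_mat M) t)" "j < dim_col (mat_at (adj_mat M) t)"
  then have ij: "i < N" "j < N" using M by (auto simp: adj_mat_def)
  have "mat_delete (mat_at M t) j i = mat_at (mat_delete M j i) t"
    by (rule eq_matI) (use M ij in \<open>auto simp: mat_delete_def\<close>)
  then show "adj_mat (mat_at M t) $$ (i, j) = mat_at (adj_mat M) t $$ (i, j)"
    using M ij by (simp add: adj_mat_def cofactor_def det_mat_at)
qed (use M in \<open>auto simp: adj_mat_def\<close>)

lemma thick_adj:
  assumes "thick N S"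
  shows "thick N {A. adj_mat A \<in> S}"
  unfolding thick_def
proof (intro ballI allI impI)
  fix M t0 assume M: "M \<in> carrier_mat N N" "mat_at M t0 \<in> {A. adj_mat A \<in> S}"
  have "adj_mat M \<in> carrier_mat N N" using adj_mat[OF M(1)] by blast
  with assms M show "countable {t. mat_at M t \<notin> {A. adj_mat A \<in> S}}"
    by (auto simp: thick_def adj_mat_at[OF M(1)])
qed

section \<open>Iterating a system of forms followed by a generic linear map\<close>

definition form_map :: "nat \<Rightarrow> (nat \<Rightarrow> 'k::field mpoly) \<Rightarrow> 'k vec \<Rightarrow> 'k vec" where
  "form_map m F v = vec (Suc m) (\<lambda>i. eval (F i) v)"

lemma form_map_carrier [simp]: "form_map m F v \<in> carrier_vec (Suc m)"
  by (simp add: form_map_def)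

lemma eval_vec:
  assumes "p \<in> forms m d"
  shows "eval p (vec (Suc m) f) = value_at f p"
  unfolding eval_eq_value_at by (rule peval_forms_cong[OF assms]) simp

lemma eval_smult:
  assumes "p \<in> forms m d" "v \<in> carrier_vec (Suc m)"
  shows "eval p (c \<cdot>\<^sub>v v) = c ^ d * eval p v"
proof -
  have "eval p (c \<cdot>\<^sub>v v) = value_at (\<lambda>i. c * v $ i) p"
    unfolding eval_eq_value_at by (rule peval_forms_cong[OF assms(1)]) (use assms(2) in auto)
  then show ?thesis unfolding eval_eq_value_at by (simp add: peval_forms_scale[OF assms(1)])
qed

lemma form_map_smult:
  assumes "\<And>i. i \<le> m \<Longrightarrow> F i \<in> forms m d" "v \<in> carrier_vec (Suc m)"
  shows "form_map m F (c \<cdot>\<^sub>v v) = c ^ d \<cdot>\<^sub>v form_map m F v"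
  by (rule eq_vecI) (auto simp: form_map_def eval_smult[OF assms(1) assms(2)])

abbreviation twisted_map :: "nat \<Rightarrow> (nat \<Rightarrow> 'k::field mpoly) \<Rightarrow> 'k mat \<Rightarrow> 'k vec \<Rightarrow> 'k vec" where
  "twisted_map m F A v \<equiv> A *\<^sub>v form_map m F v"

lemma twisted_iterate_carrier:
  assumes "A \<in> carrier_mat (Suc m) (Suc m)" "v \<in> carrier_vec (Suc m)"
  shows "(twisted_map m F A ^^ k) v \<in> carrier_vec (Suc m)"
  by (induction k) (use assms in auto)

lemma twisted_iterate_smult:
  assumes F: "\<And>i. i \<le> m \<Longrightarrow> F i \<in> forms m d" and A: "A \<in> carrier_mat (Suc m) (Suc m)"
    and v: "v \<in> carrier_vec (Suc m)"
  shows "(twisted_map m F A ^^ k) (c \<cdot>\<^sub>v v) = c ^ (d ^ k) \<cdot>\<^sub>v (twisted_map m F A ^^ k) v"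
proof (induction k)
  case (Suc k)
  have "(twisted_map m F A ^^ Suc k) (c \<cdot>\<^sub>v v)
      = A *\<^sub>v ((c ^ (d ^ k)) ^ d \<cdot>\<^sub>v form_map m F ((twisted_map m F A ^^ k) v))"
    using Suc form_map_smult[OF F twisted_iterate_carrier[OF A v]] by simp
  also have "\<dots> = (c ^ (d ^ k)) ^ d \<cdot>\<^sub>v (A *\<^sub>v form_map m F ((twisted_map m F A ^^ k) v))"
    by (rule mult_mat_vec[OF A]) simp
  finally show ?case by (simp add: power_mult[symmetric] mult.commute)
qed simp

lemma mult_mat_vec_index:
  assumes "A \<in> carrier_mat (Suc m) (Suc m)" "u \<in> carrier_vec (Suc m)" "i \<le> m"
  shows "(A *\<^sub>v u) $ i = (\<Sum>j\<le>m. A $$ (i, j) * u $ j)"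
  using assms by (auto simp: scalar_prod_def lessThan_Suc_atMost atLeast0LessThan intro!: sum.cong)

text \<open>Vectors of the form \<open>(1, t, t^2, \<dots>)\<close> are orthogonal to a given nonzero vector for finitely many
  \<open>t\<close> only.\<close>

lemma linear_form_nonzero_on_finite:
  fixes U :: "'k::field vec set"
  assumes inf: "infinite (UNIV :: 'k set)" and U: "finite U" "U \<subseteq> carrier_vec N" "0\<^sub>v N \<notin> U"
  shows "\<exists>l\<in>carrier_vec N. \<forall>u\<in>U. l \<bullet> u \<noteq> 0"
proof -
  define p where "p u = (\<Sum>i<N. monom (u $ i) i)" for u :: "'k vec"
  have coeff_p: "coeff (p u) j = u $ j" if "j < N" for u j
    using that by (simp add: p_def coeff_sum)
  have "p u \<noteq> 0" if "u \<in> U" for u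
  proof
    assume "p u = 0"
    then have "u $ j = 0" if "j < N" for j using coeff_p[OF that, of u] by simp
    then have "u = 0\<^sub>v N" using U(2) \<open>u \<in> U\<close> by (intro eq_vecI) auto
    with U(3) \<open>u \<in> U\<close> show False by simp
  qed
  then have "finite (\<Union>u\<in>U. {t. poly (p u) t = 0})" using U(1) poly_roots_finite by blast
  then obtain t where t: "t \<notin> (\<Union>u\<in>U. {t. poly (p u) t = 0})" using inf by (metis UNIV_eq_I)
  have "vec N (\<lambda>i. t ^ i) \<bullet> u = poly (p u) t" if "u \<in> U" for u
  proof -
    have "dim_vec u = N" using that U(2) by auto
    then show ?thesis
      by (simp add: scalar_prod_def p_def poly_sum poly_monom atLeast0LessThan mult.commute)
  qed
  with t show ?thesis by (intro bexI[of _ "vec N (\<lambda>i. t ^ i)"]) auto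
qed

text \<open>The iterates of \<open>A \<circ> F\<close> over a ring \<open>R\<close> of parameters, on which \<open>A\<close> and the starting vector may
  depend. Evaluating the parameters is a ring homomorphism from \<open>R\<close> to the field.\<close>

primrec generic_iterate ::
  "nat \<Rightarrow> ('k::field \<Rightarrow> 'r::comm_ring_1) \<Rightarrow> (nat \<Rightarrow> 'k mpoly) \<Rightarrow> (nat \<Rightarrow> nat \<Rightarrow> 'r) \<Rightarrow> (nat \<Rightarrow> 'r) \<Rightarrow> nat \<Rightarrow> nat \<Rightarrow> 'r"
where
  "generic_iterate m \<kappa> F M y 0 = y"
| "generic_iterate m \<kappa> F M y (Suc k) = (\<lambda>i. \<Sum>j\<le>m. M i j * peval \<kappa> (generic_iterate m \<kappa> F M y k) (F j))"

lemma hom_generic_iterate: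
  assumes F: "\<And>i. i \<le> m \<Longrightarrow> F i \<in> forms m d" and A: "A \<in> carrier_mat (Suc m) (Suc m)"
    and \<kappa>: "comm_ring_hom \<kappa>" and h: "comm_ring_hom h" and h\<kappa>: "\<And>c. h (\<kappa> c) = c"
    and M: "\<And>i j. i \<le> m \<Longrightarrow> j \<le> m \<Longrightarrow> h (M i j) = A $$ (i, j)"
  shows "i \<le> m \<Longrightarrow> h (generic_iterate m \<kappa> F M y k i) = (twisted_map m F A ^^ k) (vec (Suc m) (\<lambda>i. h (y i))) $ i"
proof (induction k arbitrary: i)
  case (Suc k)
  interpret h: comm_ring_hom h by (rule h)
  let ?u = "(twisted_map m F A ^^ k) (vec (Suc m) (\<lambda>i. h (y i)))"
  have "h (generic_iterate m \<kappa> F M y (Suc k) i) = (\<Sum>j\<le>m. A $$ (i, j) * form_map m F ?u $ j)"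
    unfolding generic_iterate.simps h.hom_sum h.hom_mult
  proof (rule sum.cong[OF refl])
    fix j assume j: "j \<in> {..m}"
    have "h (peval \<kappa> (generic_iterate m \<kappa> F M y k) (F j)) = value_at (\<lambda>i. h (generic_iterate m \<kappa> F M y k i)) (F j)"
      unfolding hom_peval[OF \<kappa> h] h\<kappa> ..
    also have "\<dots> = eval (F j) ?u"
      unfolding eval_eq_value_at by (rule peval_forms_cong[OF F]) (use j Suc.IH in auto)
    finally show "h (M i j) * h (peval \<kappa> (generic_iterate m \<kappa> F M y k) (F j)) = A $$ (i, j) * form_map m F ?u $ j"
      using j Suc.prems by (simp add: M form_map_def)
  qed
  then show ?case using mult_mat_vec_index[OF A form_map_carrier Suc.prems] by simp
qed simp

subsection \<open>Lines mapped away from the origin by all iterates\<close>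

abbreviation line_vec :: "nat \<Rightarrow> (nat \<Rightarrow> 'k::field) \<Rightarrow> (nat \<Rightarrow> 'k) \<Rightarrow> 'k \<Rightarrow> 'k \<Rightarrow> 'k vec" where
  "line_vec m v w \<alpha> \<beta> \<equiv> vec (Suc m) (\<lambda>j. \<alpha> * v j + \<beta> * w j)"

definition iterates_avoid_zero :: "nat \<Rightarrow> (nat \<Rightarrow> 'k::field mpoly) \<Rightarrow> (nat \<Rightarrow> 'k) \<Rightarrow> (nat \<Rightarrow> 'k) \<Rightarrow> nat \<Rightarrow> 'k mat set" where
  "iterates_avoid_zero m F v w k =
     {A. \<forall>\<alpha> \<beta>. \<alpha> \<noteq> 0 \<or> \<beta> \<noteq> 0 \<longrightarrow> (twisted_map m F A ^^ k) (line_vec m v w \<alpha> \<beta>) \<noteq> 0\<^sub>v (Suc m)}"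

lemma free_line_form_map:
  assumes F: "\<And>i. i \<le> m \<Longrightarrow> F i \<in> forms m d"
  shows "free_line m F v w \<longleftrightarrow>
    (\<forall>\<alpha> \<beta>. \<alpha> \<noteq> 0 \<or> \<beta> \<noteq> 0 \<longrightarrow> form_map m F (line_vec m v w \<alpha> \<beta>) \<noteq> 0\<^sub>v (Suc m))"
proof -
  have "form_map m F (line_vec m v w \<alpha> \<beta>) \<noteq> 0\<^sub>v (Suc m) \<longleftrightarrow>
      (\<exists>i\<le>m. value_at (\<lambda>j. \<alpha> * v j + \<beta> * w j) (F i) \<noteq> 0)" for \<alpha> \<beta>
    by (auto simp: form_map_def vec_eq_iff eval_vec[OF F] less_Suc_eq_le)
  then show ?thesis by (simp add: free_line_def)
qed

text \<open>On a curve of matrices, the restriction of the iterate to the line consists of polynomials in the parameter \<open>t\<close> and the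
  coordinate \<open>s\<close> on the line. If they have no common root at \<open>t\<^sub>0\<close>, elimination provides a polynomial \<open>h(t)\<close> in their ideal,
  and there is no common root for \<open>h(t) \<noteq> 0\<close>. The point at infinity of the line is controlled by the coefficients \<open>l\<close>.\<close>

lemma thick_iterates_avoid_zero:
  fixes F :: "nat \<Rightarrow> 'k::alg_closed_field mpoly"
  assumes F: "\<And>i. i \<le> m \<Longrightarrow> F i \<in> forms m d"
  shows "thick (Suc m) (iterates_avoid_zero m F v w k)"
proof (rule thickI)
  fix M :: "'k poly mat" and t0
  assume M: "M \<in> carrier_mat (Suc m) (Suc m)" and t0: "mat_at M t0 \<in> iterates_avoid_zero m F v w k"
  have Mt: "mat_at M t \<in> carrier_mat (Suc m) (Suc m)" for t using M by simp
  \<comment> \<open>\<open>y\<close> restricts the iterates to the affine part \<open>w + s v\<close> of the line, \<open>l\<close> is their value at its remaining point \<open>v\<close>\<close>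
  define y where "y = generic_iterate m (\<lambda>c. [:[:c:]:]) F (\<lambda>i j. [:M $$ (i, j):]) (\<lambda>i. [:[:w i:], [:v i:]:])"
  define l where "l = generic_iterate m (\<lambda>c. [:c:]) F (\<lambda>i j. M $$ (i, j)) (\<lambda>i. [:v i:])"
  have top: "i \<le> m \<Longrightarrow> top_coeff (d ^ n) (y n i) (l n i)" for n i
  proof (induction n arbitrary: i)
    case 0
    show ?case by (simp add: y_def l_def top_coeff_def)
  next
    case (Suc n)
    have "top_coeff (d ^ Suc n) (\<Sum>j\<le>m. [:M $$ (i, j):] * peval (\<lambda>c. [:[:c:]:]) (y n) (F j))
      (\<Sum>j\<le>m. M $$ (i, j) * peval (\<lambda>c. [:c:]) (l n) (F j))"
    proof (rule top_coeff_sum)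
      fix j assume "j \<in> {..m}"
      then have "top_coeff (d ^ n * d) (peval (\<lambda>c. [:[:c:]:]) (y n) (F j)) (peval (\<lambda>c. [:c:]) (l n) (F j))"
        using top_coeff_peval[OF F, of j "d ^ n" "y n" "l n" "\<lambda>c. [:c:]"] Suc.IH by simp
      from top_coeff_mult[OF top_coeff_const this, of "M $$ (i, j)"]
      show "top_coeff (d ^ Suc n) ([:M $$ (i, j):] * peval (\<lambda>c. [:[:c:]:]) (y n) (F j))
        (M $$ (i, j) * peval (\<lambda>c. [:c:]) (l n) (F j))"
        by (simp add: mult.commute)
    qed
    then show ?case by (simp add: y_def l_def)
  qed
  have y_val: "poly (poly (y n i) [:s:]) t = (twisted_map m F (mat_at M t) ^^ n) (line_vec m v w s 1) $ i"
    if "i \<le> m" for n i s t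
  proof -
    have "vec (Suc m) (\<lambda>i. poly (poly [:[:w i:], [:v i:]:] [:s:]) t) = line_vec m v w s 1" by auto
    then show ?thesis
      using hom_generic_iterate[OF F Mt comm_ring_hom_const_poly2 comm_ring_hom_poly2[of s t], where i = i and k = n
        and M = "\<lambda>i j. [:M $$ (i, j):]" and y = "\<lambda>i. [:[:w i:], [:v i:]:]"] that M by (simp add: y_def)
  qed
  have l_val: "poly (l n i) t = (twisted_map m F (mat_at M t) ^^ n) (line_vec m v w 1 0) $ i" if "i \<le> m" for n i t
    using hom_generic_iterate[OF F Mt comm_ring_hom_const_poly comm_ring_hom_poly[of t], where i = i and k = n
      and M = "\<lambda>i j. M $$ (i, j)" and y = "\<lambda>i. [:v i:]"] that M by (simp add: l_def)
  have carr: "(twisted_map m F (mat_at M t) ^^ n) (line_vec m v w \<alpha> \<beta>) \<in> carrier_vec (Suc m)" for n t \<alpha> \<beta>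
    by (rule twisted_iterate_carrier[OF Mt]) simp
  have nonzero_iff: "u \<noteq> 0\<^sub>v (Suc m) \<longleftrightarrow> (\<exists>i\<le>m. u $ i \<noteq> 0)" if "u \<in> carrier_vec (Suc m)" for u :: "'k vec"
    using that by (auto simp: vec_eq_iff less_Suc_eq_le)
  have at_t0: "(twisted_map m F (mat_at M t0) ^^ k) (line_vec m v w \<alpha> \<beta>) \<noteq> 0\<^sub>v (Suc m)" if "\<alpha> \<noteq> 0 \<or> \<beta> \<noteq> 0" for \<alpha> \<beta>
    using t0 that by (auto simp: iterates_avoid_zero_def)
  have "(twisted_map m F (mat_at M t0) ^^ k) (line_vec m v w 1 0) \<noteq> 0\<^sub>v (Suc m)" by (rule at_t0) simp
  then obtain a where a: "a \<le> m" "(twisted_map m F (mat_at M t0) ^^ k) (line_vec m v w 1 0) $ a \<noteq> 0"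
    unfolding nonzero_iff[OF carr] by blast
  then have a: "a \<le> m" "poly (l k a) t0 \<noteq> 0" by (simp_all only: l_val not_False_eq_True)
  have "l k a \<noteq> 0" using a(2) by auto
  with top[OF a(1), of k] have deg: "degree (y k a) = d ^ k"
    by (auto simp: top_coeff_def intro!: antisym le_degree)
  have lead: "lead_coeff (y k a) = l k a" using top[OF a(1), of k] by (simp add: top_coeff_def deg)
  have "\<exists>i\<le>m. poly (poly (y k i) [:s:]) t0 \<noteq> 0" for s
  proof -
    have "(twisted_map m F (mat_at M t0) ^^ k) (line_vec m v w s 1) \<noteq> 0\<^sub>v (Suc m)" by (rule at_t0) simp
    then obtain i where "i \<le> m" "(twisted_map m F (mat_at M t0) ^^ k) (line_vec m v w s 1) $ i \<noteq> 0"
      unfolding nonzero_iff[OF carr] by blast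
    then have "poly (poly (y k i) [:s:]) t0 \<noteq> 0" by (simp_all only: y_val not_False_eq_True)
    with \<open>i \<le> m\<close> show ?thesis by blast
  qed
  then obtain h c where h: "h \<noteq> 0" and c: "[:h:] = (\<Sum>i\<le>m. c i * y k i)"
    using elimination[of a m "y k" t0] a lead by auto
  show "\<exists>h. h \<noteq> 0 \<and> (\<forall>t. poly h t \<noteq> 0 \<longrightarrow> mat_at M t \<in> iterates_avoid_zero m F v w k)"
  proof (intro exI[of _ "h * l k a"] conjI allI impI)
    show "h * l k a \<noteq> 0" using h \<open>l k a \<noteq> 0\<close> by simp
    fix t assume "poly (h * l k a) t \<noteq> 0"
    then have t: "poly h t \<noteq> 0" "poly (l k a) t \<noteq> 0" by auto
    show "mat_at M t \<in> iterates_avoid_zero m F v w k"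
      unfolding iterates_avoid_zero_def
    proof (intro CollectI allI impI)
      fix \<alpha> \<beta> :: 'k assume nz: "\<alpha> \<noteq> 0 \<or> \<beta> \<noteq> 0"
      have scale: "(twisted_map m F (mat_at M t) ^^ k) (c \<cdot>\<^sub>v line_vec m v w \<alpha>' \<beta>') \<noteq> 0\<^sub>v (Suc m)"
        if "c \<noteq> 0" "i \<le> m" "(twisted_map m F (mat_at M t) ^^ k) (line_vec m v w \<alpha>' \<beta>') $ i \<noteq> 0" for c \<alpha>' \<beta>' i
      proof -
        have "(twisted_map m F (mat_at M t) ^^ k) (c \<cdot>\<^sub>v line_vec m v w \<alpha>' \<beta>')
          = c ^ (d ^ k) \<cdot>\<^sub>v (twisted_map m F (mat_at M t) ^^ k) (line_vec m v w \<alpha>' \<beta>')"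
          by (rule twisted_iterate_smult[OF F Mt]) simp_all
        moreover have "\<dots> $ i \<noteq> 0" using that carr[of k t \<alpha>' \<beta>'] by auto
        ultimately show ?thesis using that(2) by auto
      qed
      show "(twisted_map m F (mat_at M t) ^^ k) (line_vec m v w \<alpha> \<beta>) \<noteq> 0\<^sub>v (Suc m)"
      proof (cases "\<beta> = 0")
        case True
        have "line_vec m v w \<alpha> \<beta> = \<alpha> \<cdot>\<^sub>v line_vec m v w 1 0" using True by auto
        then show ?thesis using scale[of \<alpha> a 1 0] nz True a(1) t(2) l_val[OF a(1)] by simp
      next
        case False
        have "\<exists>i\<le>m. poly (poly (y k i) [:\<alpha> / \<beta>:]) t \<noteq> 0"
        proof (rule ccontr)
          assume "\<not> ?thesis"
          then have "(\<Sum>i\<le>m. poly (poly (c i) [:\<alpha> / \<beta>:]) t * poly (poly (y k i) [:\<alpha> / \<beta>:]) t) = 0" by auto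
          moreover have "poly (poly [:h:] [:\<alpha> / \<beta>:]) t = (\<Sum>i\<le>m. poly (poly (c i) [:\<alpha> / \<beta>:]) t * poly (poly (y k i) [:\<alpha> / \<beta>:]) t)"
            unfolding c by (simp add: poly_sum)
          ultimately show False using t(1) by simp
        qed
        then obtain i where i: "i \<le> m" "poly (poly (y k i) [:\<alpha> / \<beta>:]) t \<noteq> 0" by blast
        have "line_vec m v w \<alpha> \<beta> = \<beta> \<cdot>\<^sub>v line_vec m v w (\<alpha> / \<beta>) 1" using False by (auto simp: field_simps)
        then show ?thesis using scale[of \<beta> i "\<alpha> / \<beta>" 1] False i y_val[OF i(1)] by simp
      qed
    qed
  qed
qed

text \<open>If the \<open>F\<^sub>i\<close> have no common zero on a line and \<open>A\<close> is a generic projection onto this line, then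
  the map \<open>A \<circ> F\<close> sends the line, without the origin, to itself.\<close>

lemma iterates_avoid_zero_nonempty:
  fixes F :: "nat \<Rightarrow> 'k::alg_closed_field mpoly"
  assumes F: "\<And>i. i \<le> m \<Longrightarrow> F i \<in> forms m d" and d: "d \<ge> 1" and line: "free_line m F v w"
  shows "\<exists>A\<in>carrier_mat (Suc m) (Suc m). \<forall>k. A \<in> iterates_avoid_zero m F v w k"
proof -
  note inf = alg_closed_infinite[where 'k='k]
  let ?L = "line_vec m v w" and ?F = "form_map m F"
  have FL: "?F (?L \<alpha> \<beta>) \<noteq> 0\<^sub>v (Suc m)" if "\<alpha> \<noteq> 0 \<or> \<beta> \<noteq> 0" for \<alpha> \<beta>
    using line that by (simp add: free_line_form_map[OF F])
  have L0: "?L \<alpha> \<beta> \<noteq> 0\<^sub>v (Suc m)" if "\<alpha> \<noteq> 0 \<or> \<beta> \<noteq> 0" for \<alpha> \<beta>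
  proof
    assume z: "?L \<alpha> \<beta> = 0\<^sub>v (Suc m)"
    have "?F (0 \<cdot>\<^sub>v 0\<^sub>v (Suc m)) = 0 ^ d \<cdot>\<^sub>v ?F (0\<^sub>v (Suc m))" by (rule form_map_smult[OF F]) auto
    moreover have "(0 :: 'k) \<cdot>\<^sub>v 0\<^sub>v (Suc m) = 0\<^sub>v (Suc m)" by auto
    ultimately have "?F (0\<^sub>v (Suc m)) = 0 \<cdot>\<^sub>v ?F (0\<^sub>v (Suc m))" using d by (simp add: power_0_left)
    also have "\<dots> = 0\<^sub>v (Suc m)" by (auto simp: form_map_def)
    finally show False using FL[OF that] z by simp
  qed
  obtain l1 where l1: "l1 \<in> carrier_vec (Suc m)" "l1 \<bullet> ?F (?L 1 0) \<noteq> 0"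
    using linear_form_nonzero_on_finite[OF inf, of "{?F (?L 1 0)}" "Suc m"] FL[of 1 0] by auto
  define g where "g = (\<Sum>i\<le>m. [:l1 $ i:] * peval (\<lambda>c. [:c:]) (\<lambda>j. [:w j, v j:]) (F i))"
  have l_prod: "l \<bullet> u = (\<Sum>i\<le>m. l $ i * u $ i)" if "u \<in> carrier_vec (Suc m)" for l u :: "'k vec"
    using that by (auto simp: scalar_prod_def lessThan_Suc_atMost atLeast0LessThan intro!: sum.cong)
  have "top_coeff d g (\<Sum>i\<le>m. l1 $ i * value_at v (F i))"
    unfolding g_def
  proof (rule top_coeff_sum)
    fix i assume "i \<in> {..m}"
    then have "top_coeff (1 * d) (peval (\<lambda>c. [:c:]) (\<lambda>j. [:w j, v j:]) (F i)) (value_at v (F i))"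
      using top_coeff_peval[OF F, of i 1 "\<lambda>j. [:w j, v j:]" v "\<lambda>c. c"] by (simp add: top_coeff_def)
    from top_coeff_mult[OF top_coeff_const this]
    show "top_coeff d ([:l1 $ i:] * peval (\<lambda>c. [:c:]) (\<lambda>j. [:w j, v j:]) (F i)) (l1 $ i * value_at v (F i))" by simp
  qed
  moreover have "(\<Sum>i\<le>m. l1 $ i * value_at v (F i)) = l1 \<bullet> ?F (?L 1 0)"
    by (subst l_prod) (auto simp: form_map_def eval_vec[OF F] intro!: sum.cong)
  ultimately have g0: "g \<noteq> 0" using l1(2) by (auto simp: top_coeff_def)
  have g_val: "poly g s = l1 \<bullet> ?F (?L s 1)" for s
  proof -
    have "poly (peval (\<lambda>c. [:c:]) (\<lambda>j. [:w j, v j:]) (F i)) s = value_at (\<lambda>j. s * v j + w j) (F i)" for i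
      using hom_peval[OF comm_ring_hom_const_poly comm_ring_hom_poly[of s], of "\<lambda>j. [:w j, v j:]" "F i"]
      by (simp add: add.commute)
    then show ?thesis
      by (subst l_prod) (auto simp: g_def poly_sum form_map_def eval_vec[OF F] intro!: sum.cong)
  qed
  obtain l2 where l2: "l2 \<in> carrier_vec (Suc m)" "\<And>s. poly g s = 0 \<Longrightarrow> l2 \<bullet> ?F (?L s 1) \<noteq> 0"
  proof -
    let ?U = "(\<lambda>s. ?F (?L s 1)) ` {s. poly g s = 0}"
    have fin: "finite ?U" by (rule finite_imageI[OF poly_roots_finite[OF g0]])
    have sub: "?U \<subseteq> carrier_vec (Suc m)" by (rule image_subsetI) (rule form_map_carrier)
    have "u \<noteq> 0\<^sub>v (Suc m)" if "u \<in> ?U" for u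
    proof -
      from that obtain s where "u = ?F (?L s 1)" by (elim imageE)
      moreover have "?F (?L s 1) \<noteq> 0\<^sub>v (Suc m)" by (rule FL) simp
      ultimately show ?thesis by (simp only: not_False_eq_True)
    qed
    then have "0\<^sub>v (Suc m) \<notin> ?U" by blast
    with fin sub have "\<exists>l\<in>carrier_vec (Suc m). \<forall>u\<in>?U. l \<bullet> u \<noteq> 0"
      by (rule linear_form_nonzero_on_finite[OF inf])
    then obtain l where l: "l \<in> carrier_vec (Suc m)" "\<forall>u\<in>?U. l \<bullet> u \<noteq> 0" by (elim bexE)
    show ?thesis by (rule that[OF l(1)]) (use l(2) in auto)
  qed
  have not_both: "l1 \<bullet> ?F (?L \<alpha> \<beta>) \<noteq> 0 \<or> l2 \<bullet> ?F (?L \<alpha> \<beta>) \<noteq> 0" if nz: "\<alpha> \<noteq> 0 \<or> \<beta> \<noteq> 0" for \<alpha> \<beta>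
  proof (cases "\<beta> = 0")
    case True
    have "?L \<alpha> \<beta> = \<alpha> \<cdot>\<^sub>v ?L 1 0" using True by auto
    then have "?F (?L \<alpha> \<beta>) = \<alpha> ^ d \<cdot>\<^sub>v ?F (?L 1 0)" using form_map_smult[OF F, where v = "?L 1 0" and c = \<alpha>] by simp
    then show ?thesis using l1 nz True by (simp add: scalar_prod_smult_right)
  next
    case False
    have "?L \<alpha> \<beta> = \<beta> \<cdot>\<^sub>v ?L (\<alpha> / \<beta>) 1" using False by (auto simp: field_simps)
    then have "?F (?L \<alpha> \<beta>) = \<beta> ^ d \<cdot>\<^sub>v ?F (?L (\<alpha> / \<beta>) 1)" using form_map_smult[OF F, where v = "?L (\<alpha> / \<beta>) 1" and c = \<beta>] by simp
    then show ?thesis using l1(1) l2(1) l2(2)[of "\<alpha> / \<beta>"] False g_val[of "\<alpha> / \<beta>"] by (cases "poly g (\<alpha> / \<beta>) = 0") (auto simp: scalar_prod_smult_right)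
  qed
  define A where "A = mat (Suc m) (Suc m) (\<lambda>(i, j). v i * l1 $ j + w i * l2 $ j)"
  have A: "A \<in> carrier_mat (Suc m) (Suc m)" by (simp add: A_def)
  have A_app: "A *\<^sub>v u = ?L (l1 \<bullet> u) (l2 \<bullet> u)" if u: "u \<in> carrier_vec (Suc m)" for u
  proof (rule eq_vecI)
    fix i assume "i < dim_vec (?L (l1 \<bullet> u) (l2 \<bullet> u))"
    then have i: "i \<le> m" by simp
    have "(A *\<^sub>v u) $ i = (\<Sum>j\<le>m. A $$ (i, j) * u $ j)" by (rule mult_mat_vec_index[OF A u i])
    also have "\<dots> = (\<Sum>j\<le>m. v i * (l1 $ j * u $ j) + w i * (l2 $ j * u $ j))"
      by (rule sum.cong) (use i in \<open>auto simp: A_def algebra_simps\<close>)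
    also have "\<dots> = ?L (l1 \<bullet> u) (l2 \<bullet> u) $ i"
      using i by (simp add: l_prod[OF u] sum.distrib algebra_simps flip: sum_distrib_left)
    finally show "(A *\<^sub>v u) $ i = ?L (l1 \<bullet> u) (l2 \<bullet> u) $ i" .
  qed (use A in auto)
  have on_line: "\<exists>\<alpha>' \<beta>'. (\<alpha>' \<noteq> 0 \<or> \<beta>' \<noteq> 0) \<and> (twisted_map m F A ^^ k) (?L \<alpha> \<beta>) = ?L \<alpha>' \<beta>'"
    if "\<alpha> \<noteq> 0 \<or> \<beta> \<noteq> 0" for k \<alpha> \<beta>
  proof (induction k)
    case 0
    then show ?case using that by auto
  next
    case (Suc k)
    then obtain \<alpha>' \<beta>' where *: "\<alpha>' \<noteq> 0 \<or> \<beta>' \<noteq> 0" "(twisted_map m F A ^^ k) (?L \<alpha> \<beta>) = ?L \<alpha>' \<beta>'" by blast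
    then have "(twisted_map m F A ^^ Suc k) (?L \<alpha> \<beta>) = ?L (l1 \<bullet> ?F (?L \<alpha>' \<beta>')) (l2 \<bullet> ?F (?L \<alpha>' \<beta>'))"
      by (simp add: A_app)
    with not_both[OF *(1)] show ?case by blast
  qed
  have "A \<in> iterates_avoid_zero m F v w k" for k
    unfolding iterates_avoid_zero_def
  proof (intro CollectI allI impI)
    fix \<alpha> \<beta> :: 'k assume nz: "\<alpha> \<noteq> 0 \<or> \<beta> \<noteq> 0"
    from on_line[OF nz, of k] obtain \<alpha>' \<beta>'
      where *: "\<alpha>' \<noteq> 0 \<or> \<beta>' \<noteq> 0" "(twisted_map m F A ^^ k) (?L \<alpha> \<beta>) = ?L \<alpha>' \<beta>'" by blast
    show "(twisted_map m F A ^^ k) (?L \<alpha> \<beta>) \<noteq> 0\<^sub>v (Suc m)" unfolding *(2) by (rule L0[OF *(1)])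
  qed
  with A show ?thesis by blast
qed

subsection \<open>Orbits of a point avoiding a hypersurface\<close>

definition orbit_avoids :: "nat \<Rightarrow> (nat \<Rightarrow> 'k::field mpoly) \<Rightarrow> 'k mpoly \<Rightarrow> 'k vec \<Rightarrow> nat \<Rightarrow> 'k mat set" where
  "orbit_avoids m F X q k = {A. eval X ((twisted_map m F A ^^ k) (A *\<^sub>v q)) \<noteq> 0}"

lemma thick_orbit_avoids:
  fixes F :: "nat \<Rightarrow> 'k::field mpoly"
  assumes F: "\<And>i. i \<le> m \<Longrightarrow> F i \<in> forms m d" and X: "X \<in> forms m e" and q: "q \<in> carrier_vec (Suc m)"
  shows "thick (Suc m) (orbit_avoids m F X q k)"
proof (rule thickI)
  fix M :: "'k poly mat" and t0
  assume M: "M \<in> carrier_mat (Suc m) (Suc m)" and t0: "mat_at M t0 \<in> orbit_avoids m F X q k"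
  have Mt: "mat_at M t \<in> carrier_mat (Suc m) (Suc m)" for t using M by simp
  define y where "y = generic_iterate m (\<lambda>c. [:c:]) F (\<lambda>i j. M $$ (i, j)) (\<lambda>i. \<Sum>j\<le>m. M $$ (i, j) * [:q $ j:])"
  have ev: "poly (peval (\<lambda>c. [:c:]) z p) t = value_at (\<lambda>i. poly (z i) t) p" for z p and t :: 'k
    using hom_peval[OF comm_ring_hom_const_poly comm_ring_hom_poly[of t], of z p] by simp
  have start: "vec (Suc m) (\<lambda>i. poly (\<Sum>j\<le>m. M $$ (i, j) * [:q $ j:]) t) = mat_at M t *\<^sub>v q" for t
  proof (rule eq_vecI)
    fix i assume "i < dim_vec (mat_at M t *\<^sub>v q)"
    then have i: "i \<le> m" using M by simp
    then show "vec (Suc m) (\<lambda>i. poly (\<Sum>j\<le>m. M $$ (i, j) * [:q $ j:]) t) $ i = (mat_at M t *\<^sub>v q) $ i"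
      using mult_mat_vec_index[OF Mt q i, of t] M by (simp add: poly_sum mult.commute)
  qed (use M in simp)
  have y_val: "poly (y n i) t = (twisted_map m F (mat_at M t) ^^ n) (mat_at M t *\<^sub>v q) $ i" if "i \<le> m" for n i t
    using hom_generic_iterate[OF F Mt comm_ring_hom_const_poly comm_ring_hom_poly[of t], where i = i and k = n
      and M = "\<lambda>i j. M $$ (i, j)" and y = "\<lambda>i. \<Sum>j\<le>m. M $$ (i, j) * [:q $ j:]"] that M start[of t]
    by (simp add: y_def)
  define h where "h = peval (\<lambda>c. [:c:]) (y k) X"
  have h_val: "poly h t = eval X ((twisted_map m F (mat_at M t) ^^ k) (mat_at M t *\<^sub>v q))" for t
    unfolding h_def ev eval_eq_value_at by (rule peval_forms_cong[OF X]) (rule y_val)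
  then have "poly h t0 \<noteq> 0" using t0 by (simp add: orbit_avoids_def)
  then have "h \<noteq> 0" by auto
  then show "\<exists>h. h \<noteq> 0 \<and> (\<forall>t. poly h t \<noteq> 0 \<longrightarrow> mat_at M t \<in> orbit_avoids m F X q k)"
    by (intro exI[of _ h]) (auto simp: orbit_avoids_def h_val)
qed

text \<open>For \<open>A\<close> of rank one, all points of the orbit are multiples of one vector.\<close>

lemma orbit_avoids_nonempty:
  fixes F :: "nat \<Rightarrow> 'k::field mpoly"
  assumes inf: "infinite (UNIV :: 'k set)"
    and F: "\<And>i. i \<le> m \<Longrightarrow> F i \<in> forms m d" and X: "X \<in> forms m e"
    and q: "q \<in> carrier_vec (Suc m)" "q \<noteq> 0\<^sub>v (Suc m)"
    and w: "w \<in> carrier_vec (Suc m)" "eval X w \<noteq> 0" "form_map m F w \<noteq> 0\<^sub>v (Suc m)"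
  shows "\<exists>A\<in>carrier_mat (Suc m) (Suc m). \<forall>k. A \<in> orbit_avoids m F X q k"
proof -
  have "\<exists>l\<in>carrier_vec (Suc m). \<forall>u\<in>{q, form_map m F w}. l \<bullet> u \<noteq> 0"
    by (rule linear_form_nonzero_on_finite[OF inf]) (use q w in auto)
  then obtain l where l: "l \<in> carrier_vec (Suc m)" "l \<bullet> q \<noteq> 0" "l \<bullet> form_map m F w \<noteq> 0" by auto
  define A where "A = mat (Suc m) (Suc m) (\<lambda>(i, j). w $ i * l $ j)"
  have A: "A \<in> carrier_mat (Suc m) (Suc m)" by (simp add: A_def)
  have A_app: "A *\<^sub>v u = (l \<bullet> u) \<cdot>\<^sub>v w" if u: "u \<in> carrier_vec (Suc m)" for u
  proof (rule eq_vecI)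
    fix i assume "i < dim_vec ((l \<bullet> u) \<cdot>\<^sub>v w)"
    then have i: "i \<le> m" using w(1) by auto
    have "(A *\<^sub>v u) $ i = (\<Sum>j\<le>m. A $$ (i, j) * u $ j)" by (rule mult_mat_vec_index[OF A u i])
    also have "\<dots> = (\<Sum>j\<le>m. w $ i * (l $ j * u $ j))"
      by (rule sum.cong) (use i in \<open>auto simp: A_def algebra_simps\<close>)
    also have "\<dots> = w $ i * (l \<bullet> u)"
      using u by (auto simp: scalar_prod_def lessThan_Suc_atMost atLeast0LessThan sum_distrib_left)
    finally show "(A *\<^sub>v u) $ i = ((l \<bullet> u) \<cdot>\<^sub>v w) $ i" using i w(1) by simp
  qed (use A w in auto)
  have "\<exists>c. c \<noteq> 0 \<and> (twisted_map m F A ^^ k) (A *\<^sub>v q) = c \<cdot>\<^sub>v w" for k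
  proof (induction k)
    case 0
    then show ?case using l(2) A_app[OF q(1)] by auto
  next
    case (Suc k)
    then obtain c where c: "c \<noteq> 0" "(twisted_map m F A ^^ k) (A *\<^sub>v q) = c \<cdot>\<^sub>v w" by blast
    have "(twisted_map m F A ^^ Suc k) (A *\<^sub>v q) = (l \<bullet> (c ^ d \<cdot>\<^sub>v form_map m F w)) \<cdot>\<^sub>v w"
      using c(2) form_map_smult[OF F w(1)] by (simp add: A_app)
    moreover have "l \<bullet> (c ^ d \<cdot>\<^sub>v form_map m F w) \<noteq> 0" using c l by (simp add: scalar_prod_smult_right)
    ultimately show ?case by blast
  qed
  then have "A \<in> orbit_avoids m F X q k" for k
  proof -
    obtain c where "c \<noteq> 0" "(twisted_map m F A ^^ k) (A *\<^sub>v q) = c \<cdot>\<^sub>v w"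
      using \<open>\<And>k. \<exists>c. c \<noteq> 0 \<and> (twisted_map m F A ^^ k) (A *\<^sub>v q) = c \<cdot>\<^sub>v w\<close> by blast
    then show ?thesis using w(2) by (simp add: orbit_avoids_def eval_smult[OF X w(1)])
  qed
  with A show ?thesis by blast
qed

section \<open>Points of projective space\<close>

lemma point_of_self: "v \<in> point_of v"
  unfolding point_of_def by (intro CollectI exI[of _ 1]) auto

lemma point_of_smult:
  assumes "c \<noteq> 0"
  shows "point_of (c \<cdot>\<^sub>v v) = point_of (v :: 'k::field vec)"
proof (rule Set.set_eqI)
  fix u
  have "u = b \<cdot>\<^sub>v v \<longleftrightarrow> u = (b / c) \<cdot>\<^sub>v (c \<cdot>\<^sub>v v)" for b using assms by (simp add: smult_smult_assoc)
  moreover have "u = b \<cdot>\<^sub>v (c \<cdot>\<^sub>v v) \<longleftrightarrow> u = (b * c) \<cdot>\<^sub>v v" for b by (simp add: smult_smult_assoc)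
  ultimately show "u \<in> point_of (c \<cdot>\<^sub>v v) \<longleftrightarrow> u \<in> point_of v"
    unfolding point_of_def mem_Collect_eq using assms by (metis divide_eq_0_iff mult_eq_0_iff)
qed

lemma proj_spaceI: "v \<in> carrier_vec (Suc n) \<Longrightarrow> v \<noteq> 0\<^sub>v (Suc n) \<Longrightarrow> point_of v \<in> proj_space n"
  by (auto simp: projectivization_def)

lemma smult_eq_0_vec: "v \<in> carrier_vec N \<Longrightarrow> c \<cdot>\<^sub>v v = 0\<^sub>v N \<longleftrightarrow> c = 0 \<or> v = 0\<^sub>v N"
  for v :: "'k::field vec"
  by (auto simp: vec_eq_iff)

lemma proj_spaceD:
  assumes "p \<in> proj_space n" "v \<in> p"
  shows "v \<in> carrier_vec (Suc n)" "v \<noteq> 0\<^sub>v (Suc n)" "p = point_of v"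
proof -
  from assms obtain w c where w: "w \<in> carrier_vec (Suc n)" "w \<noteq> 0\<^sub>v (Suc n)" "p = point_of w"
    and c: "c \<noteq> 0" "v = c \<cdot>\<^sub>v w"
    by (auto simp: projectivization_def point_of_def)
  show "v \<in> carrier_vec (Suc n)" "v \<noteq> 0\<^sub>v (Suc n)" using w c by (simp_all add: smult_eq_0_vec)
  show "p = point_of v" using w c by (simp add: point_of_smult)
qed

lemma proj_space_rep:
  assumes "p \<in> proj_space n"
  obtains v where "v \<in> p" "v \<in> carrier_vec (Suc n)" "v \<noteq> 0\<^sub>v (Suc n)" "p = point_of v"
  using assms that point_of_self by (auto simp: projectivization_def)

lemma nonzero_vec_iff: "v \<in> carrier_vec N \<Longrightarrow> v \<noteq> 0\<^sub>v N \<longleftrightarrow> (\<exists>i<N. v $ i \<noteq> 0)"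
  by (auto simp: vec_eq_iff)

lemma point_of_eq_iff:
  fixes v w :: "'k::field vec"
  assumes v: "v \<in> carrier_vec N" "v \<noteq> 0\<^sub>v N" and w: "w \<in> carrier_vec N" "w \<noteq> 0\<^sub>v N"
  shows "point_of v = point_of w \<longleftrightarrow> (\<forall>i<N. \<forall>j<N. v $ i * w $ j = v $ j * w $ i)"
proof
  assume "point_of v = point_of w"
  then have "v \<in> point_of w" using point_of_self[of v] by simp
  then obtain c where "v = c \<cdot>\<^sub>v w" by (auto simp: point_of_def)
  then show "\<forall>i<N. \<forall>j<N. v $ i * w $ j = v $ j * w $ i" using w by simp
next
  assume par: "\<forall>i<N. \<forall>j<N. v $ i * w $ j = v $ j * w $ i"
  from w obtain j where j: "j < N" "w $ j \<noteq> 0" by (auto simp: nonzero_vec_iff)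
  have eq: "v = (v $ j / w $ j) \<cdot>\<^sub>v w"
    by (rule eq_vecI) (use par j v w in \<open>auto simp: field_simps\<close>)
  have "v $ j / w $ j \<noteq> 0"
  proof
    assume "v $ j / w $ j = 0"
    then have "v = 0 \<cdot>\<^sub>v w" using eq by (simp only:)
    also have "\<dots> = 0\<^sub>v N" using w(1) by auto
    finally show False using v(2) by simp
  qed
  from point_of_smult[OF this, of w] eq show "point_of v = point_of w" by simp
qed

section \<open>The Zariski topology\<close>

lemma basic_open_iff:
  assumes F: "F \<in> forms n d" and v: "v \<in> p" and p: "p \<in> proj_space n"
  shows "p \<in> basic_open n F \<longleftrightarrow> eval F v \<noteq> 0"
proof -
  note pv = proj_spaceD[OF p v]
  have "\<forall>u\<in>p. eval F u \<noteq> 0" if "eval F v \<noteq> 0"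
    using that unfolding pv(3) by (auto simp: point_of_def eval_smult[OF F pv(1)])
  then show ?thesis using p v by (auto simp: basic_open_def)
qed

lemma basic_open_subset: "basic_open n F \<subseteq> proj_space n"
  by (auto simp: basic_open_def)

lemma basic_open_mult:
  "basic_open n (F * G) = basic_open n F \<inter> basic_open n (G :: 'k::field mpoly)"
  by (auto simp: basic_open_def eval_eq_value_at value_at_hom.hom_mult)

lemma openin_basic_open: "F \<in> forms n d \<Longrightarrow> openin (zariski n) (basic_open n F)"
  unfolding zariski_def by (rule topology_generated_by_Basis) blast

lemma basic_open_1: "basic_open n 1 = (proj_space n :: 'k::field point set)"
  by (auto simp: basic_open_def eval_eq_value_at)

lemma topspace_zariski: "topspace (zariski n) = (proj_space n :: 'k::field point set)"
proof -
  have "proj_space n \<in> {basic_open n F |F d. (F :: 'k mpoly) \<in> forms n d}"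
    using basic_open_1[of n] forms_1[of n] by blast
  moreover have "\<Union>{basic_open n F |F d. (F :: 'k mpoly) \<in> forms n d} \<subseteq> proj_space n"
    using basic_open_subset by blast
  ultimately show ?thesis unfolding zariski_def topology_generated_by_topspace by blast
qed

lemma openin_zariskiD:
  assumes "openin (zariski n) S" "p \<in> S"
  obtains F d where "F \<in> forms n d" "p \<in> basic_open n F" "basic_open n F \<subseteq> S"
proof -
  have "generate_topology_on {basic_open n F |F d. F \<in> forms n d} S"
    using assms(1) unfolding zariski_def by (rule openin_topology_generated_by)
  then have "\<forall>p\<in>S. \<exists>F d. F \<in> forms n d \<and> p \<in> basic_open n F \<and> basic_open n F \<subseteq> S"
  proof (induction rule: generate_topology_on.induct)
    case (Int a b)
    show ?case
    proof
      fix p assume "p \<in> a \<inter> b"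
      with Int obtain F d G e where "F \<in> forms n d" "p \<in> basic_open n F" "basic_open n F \<subseteq> a"
        "G \<in> forms n e" "p \<in> basic_open n G" "basic_open n G \<subseteq> b" by (meson IntD1 IntD2)
      then show "\<exists>F d. F \<in> forms n d \<and> p \<in> basic_open n F \<and> basic_open n F \<subseteq> a \<inter> b"
        by (intro exI[of _ "F * G"] exI[of _ "d + e"]) (auto simp: basic_open_mult forms_mult)
    qed
  next
    case (UN K)
    then show ?case by (meson UnionE Union_upper subset_trans)
  qed auto
  with assms(2) that show ?thesis by blast
qed

lemma nonzero_form_basic_open:
  fixes F :: "'k::alg_closed_field mpoly"
  assumes F: "F \<in> forms n d" "F \<noteq> 0"
  shows "basic_open n F \<noteq> {}"
proof -
  have "F * Var 0 \<noteq> 0" using F Var_nonzero[of 0] by simp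
  then obtain x where x: "value_at x (F * Var 0) \<noteq> 0"
    using value_at_all_zero_imp_zero[OF alg_closed_infinite] by blast
  then have x: "value_at x F \<noteq> 0" "x 0 \<noteq> 0" by (auto simp only: value_at_hom.hom_mult value_at_Var mult_zero_left mult_zero_right)
  let ?v = "vec (Suc n) x"
  have "?v $ 0 \<noteq> 0" using x by simp
  then have v: "?v \<noteq> 0\<^sub>v (Suc n)" by (metis index_zero_vec(1) zero_less_Suc)
  have "eval F ?v \<noteq> 0" using x(1) by (simp add: eval_vec[OF F(1)])
  then have "point_of ?v \<in> basic_open n F"
    using basic_open_iff[OF F(1) point_of_self proj_spaceI[OF _ v]] by simp
  then show ?thesis by blast
qed

lemma basic_open_nonzero: "p \<in> basic_open n F \<Longrightarrow> F \<noteq> (0 :: 'k::field mpoly)"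
proof
  assume "p \<in> basic_open n F" "F = 0"
  then obtain v where "v \<in> p" "eval 0 v \<noteq> (0::'k)"
    using proj_space_rep[of p n] by (auto simp: basic_open_def)
  then show False by (simp add: eval_def)
qed

lemma proj_space_opens_meet:
  fixes S S' :: "'k::alg_closed_field point set"
  assumes "openin (zariski n) S" "openin (zariski n) S'" "S \<noteq> {}" "S' \<noteq> {}"
  shows "S \<inter> S' \<noteq> {}"
proof -
  from assms obtain p p' where "p \<in> S" "p' \<in> S'" by blast
  from openin_zariskiD[OF assms(1) this(1)] openin_zariskiD[OF assms(2) this(2)]
  obtain F d G e where FG: "F \<in> forms n d" "p \<in> basic_open n F" "basic_open n F \<subseteq> S"
    "G \<in> forms n e" "p' \<in> basic_open n G" "basic_open n G \<subseteq> S'" by metis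
  have "F * G \<noteq> 0" using basic_open_nonzero[OF FG(2)] basic_open_nonzero[OF FG(5)] by simp
  from nonzero_form_basic_open[OF forms_mult[OF FG(1,4)] this] show ?thesis
    using FG by (auto simp: basic_open_mult)
qed

lemma irreducible_opens_meet:
  assumes irr: "irreducible_space X" and "openin X S" "openin X S'" "S \<noteq> {}" "S' \<noteq> {}"
  shows "S \<inter> S' \<noteq> {}"
proof
  assume "S \<inter> S' = {}"
  have sub: "S \<subseteq> topspace X" "S' \<subseteq> topspace X" using assms(2,3) by (auto dest: openin_subset)
  have "closedin X (topspace X - S)" "closedin X (topspace X - S')" using assms(2,3) by (auto simp: closedin_diff)
  moreover have "(topspace X - S) \<union> (topspace X - S') = topspace X" using \<open>S \<inter> S' = {}\<close> sub by auto
  ultimately have "topspace X - S = topspace X \<or> topspace X - S' = topspace X"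
    using irr unfolding irreducible_space_def by blast
  then show False using sub assms(4,5) by blast
qed

section \<open>Regular maps\<close>

lemma eval_subst_poly:
  assumes G: "G \<in> forms r e"
  shows "eval (subst_poly F G) v = eval G (form_map r F v)"
  unfolding eval_eq_value_at value_at_subst_poly
  by (rule peval_forms_cong[OF G]) (simp add: form_map_def eval_eq_value_at)

lemma form_map_subst_poly:
  assumes "\<And>i. i \<le> s \<Longrightarrow> G i \<in> forms r e"
  shows "form_map s (\<lambda>i. subst_poly F (G i)) v = form_map s G (form_map r F v)"
  by (rule eq_vecI) (auto simp: form_map_def[of s] eval_subst_poly[OF assms])

definition given_near :: "nat \<Rightarrow> 'k::field point set \<Rightarrow> nat \<Rightarrow> ('k point \<rightharpoonup> 'k point) \<Rightarrow> 'k point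
    \<Rightarrow> (nat \<Rightarrow> 'k mpoly) \<Rightarrow> nat \<Rightarrow> 'k point set \<Rightarrow> bool" where
  "given_near n X r f p F d S \<longleftrightarrow> openin (zariski n) S \<and> p \<in> S \<and> p \<in> X \<and> (\<forall>i\<le>r. F i \<in> forms n d) \<and>
     given_by r F f (S \<inter> X)"

definition regular_at :: "nat \<Rightarrow> 'k::field point set \<Rightarrow> nat \<Rightarrow> ('k point \<rightharpoonup> 'k point) \<Rightarrow> 'k point \<Rightarrow> bool" where
  "regular_at n X r f p \<longleftrightarrow> (\<exists>F d S. given_near n X r f p F d S)"

lemma given_by_form_map:
  "given_by r F f W \<longleftrightarrow> (\<forall>p\<in>W. \<forall>v\<in>p. form_map r F v \<noteq> 0\<^sub>v (Suc r) \<and> f p = Some (point_of (form_map r F v)))"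
  by (simp add: given_by_def form_map_def)

lemma regular_on_imp_regular_at:
  assumes "regular_on n r f U" "openin (zariski_on n X) U" "p \<in> U"
  shows "regular_at n X r f p"
proof -
  from assms obtain W d F where W: "openin (zariski_on n U) W" "p \<in> W" "\<forall>i\<le>r. F i \<in> forms n d" "given_by r F f W"
    by (auto simp: regular_on_def)
  from W(1) obtain S where S: "openin (zariski n) S" "W = S \<inter> U" by (auto simp: openin_subtopology)
  from assms(2) obtain S' where S': "openin (zariski n) S'" "U = S' \<inter> X" by (auto simp: openin_subtopology)
  have "given_near n X r f p F d (S \<inter> S')"
    using W S S' by (auto simp: given_near_def openin_Int Int_assoc)
  then show ?thesis by (auto simp: regular_at_def)
qed

lemma regular_at_comp:
  assumes X: "X \<subseteq> proj_space n" and f: "regular_at n X r f p" and q: "f p = Some q"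
    and g: "regular_at r Y s g q" and fY: "\<And>x y. x \<in> X \<Longrightarrow> f x = Some y \<Longrightarrow> y \<in> Y"
  shows "regular_at n X s (g \<circ>\<^sub>m f) p"
proof -
  from f obtain F d S where S: "given_near n X r f p F d S" by (auto simp: regular_at_def)
  from g obtain G e S' where S': "given_near r Y s g q G e S'" by (auto simp: regular_at_def)
  have "openin (zariski r) S'" "q \<in> S'" using S' by (auto simp: given_near_def)
  then obtain T t where T: "T \<in> forms r t" "q \<in> basic_open r T" "basic_open r T \<subseteq> S'" by (rule openin_zariskiD)
  have F: "\<And>i. i \<le> r \<Longrightarrow> F i \<in> forms n d" and G: "\<And>i. i \<le> s \<Longrightarrow> G i \<in> forms r e" using S S' by (auto simp: given_near_def)
  have TF: "subst_poly F T \<in> forms n (d * t)" by (rule forms_subst_poly[OF T(1) F])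
  have mem: "x \<in> basic_open n (subst_poly F T) \<longleftrightarrow> point_of (form_map r F v) \<in> basic_open r T"
    if x: "x \<in> proj_space n" "v \<in> x" "form_map r F v \<noteq> 0\<^sub>v (Suc r)" for x v
    unfolding basic_open_iff[OF TF x(2,1)] eval_subst_poly[OF T(1)]
    by (rule basic_open_iff[OF T(1) point_of_self proj_spaceI[OF form_map_carrier x(3)], symmetric])
  have local_f: "form_map r F v \<noteq> 0\<^sub>v (Suc r) \<and> f x = Some (point_of (form_map r F v))"
    if "x \<in> S \<inter> X" "v \<in> x" for x v
    using S that by (auto simp: given_near_def given_by_form_map)
  have pX: "p \<in> X" "p \<in> S" using S by (auto simp: given_near_def)
  have "given_near n X s (g \<circ>\<^sub>m f) p (\<lambda>i. subst_poly F (G i)) (d * e) (S \<inter> basic_open n (subst_poly F T))"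
    unfolding given_near_def
  proof (intro conjI)
    show "openin (zariski n) (S \<inter> basic_open n (subst_poly F T))"
      using S openin_basic_open[OF TF] by (auto simp: given_near_def openin_Int)
    obtain v where v: "v \<in> p" using proj_space_rep[of p n] pX X by blast
    have "point_of (form_map r F v) = q" using local_f[of p v] pX v q by simp
    then show "p \<in> S \<inter> basic_open n (subst_poly F T)"
      using mem[of p v] local_f[of p v] pX v X T(2) by auto
    show "p \<in> X" by fact
    show "\<forall>i\<le>s. subst_poly F (G i) \<in> forms n (d * e)"
    proof (intro allI impI)
      fix i assume "i \<le> s"
      show "subst_poly F (G i) \<in> forms n (d * e)" by (rule forms_subst_poly[OF G[OF \<open>i \<le> s\<close>] F])
    qed
    show "given_by s (\<lambda>i. subst_poly F (G i)) (g \<circ>\<^sub>m f) (S \<inter> basic_open n (subst_poly F T) \<inter> X)"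
      unfolding given_by_form_map
    proof (intro ballI)
      fix x v assume x: "x \<in> S \<inter> basic_open n (subst_poly F T) \<inter> X" and v: "v \<in> x"
      have fx: "form_map r F v \<noteq> 0\<^sub>v (Suc r)" "f x = Some (point_of (form_map r F v))"
        using local_f[of x v] x v by auto
      have "point_of (form_map r F v) \<in> S'" using mem[of x v] fx x v X T(3) by auto
      moreover have "point_of (form_map r F v) \<in> Y" using fY[OF _ fx(2)] x by simp
      ultimately have mem': "point_of (form_map r F v) \<in> S' \<inter> Y" by simp
      have "given_by s G g (S' \<inter> Y)" using S' by (simp add: given_near_def)
      then have "form_map s G (form_map r F v) \<noteq> 0\<^sub>v (Suc s) \<and>
        g (point_of (form_map r F v)) = Some (point_of (form_map s G (form_map r F v)))"
        unfolding given_by_form_map using mem' point_of_self by metis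
      then show "form_map s (\<lambda>i. subst_poly F (G i)) v \<noteq> 0\<^sub>v (Suc s) \<and>
        (g \<circ>\<^sub>m f) x = Some (point_of (form_map s (\<lambda>i. subst_poly F (G i)) v))"
        by (simp add: form_map_subst_poly[OF G] fx(2))
    qed
  qed
  then show ?thesis by (auto simp: regular_at_def)
qed

lemma regular_at_Some:
  fixes X :: "'k::field point set"
  assumes "p \<in> X" "X \<subseteq> proj_space n"
  shows "regular_at n X n Some p"
proof -
  have "form_map n Var v = v" if "v \<in> carrier_vec (Suc n)" for v :: "'k vec"
    by (rule eq_vecI) (use that in \<open>auto simp: form_map_def eval_eq_value_at simp del: One_nat_def\<close>)
  then have "form_map n Var v \<noteq> 0\<^sub>v (Suc n) \<and> Some q = Some (point_of (form_map n Var v))"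
    if "q \<in> proj_space n" "v \<in> q" for q and v :: "'k vec"
    using proj_spaceD[OF that] by (simp del: One_nat_def)
  moreover have "openin (zariski n) (proj_space n :: 'k point set)"
    using openin_topspace[of "zariski n"] by (simp only: topspace_zariski)
  moreover have "p \<in> proj_space n" using assms by blast
  moreover have "\<forall>i\<le>n. (Var i :: 'k mpoly) \<in> forms n 1" using forms_Var by blast
  ultimately have "given_near n X n Some p Var 1 (proj_space n)"
    using assms(1) unfolding given_near_def given_by_form_map by blast
  then show ?thesis by (auto simp: regular_at_def)
qed

text \<open>Continuity of regular maps: composing with forms gives forms, so preimages of basic open sets are locally basic open.\<close>

lemma regular_preimage_open:
  assumes X: "X \<subseteq> proj_space n" and U: "openin (zariski_on n X) U"
    and f: "\<And>p. p \<in> U \<Longrightarrow> regular_at n X r f p" and S: "openin (zariski r) S"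
  shows "openin (zariski_on n X) {p \<in> U. \<exists>y\<in>S. f p = Some y}"
proof (subst openin_subopen, intro ballI)
  fix p assume "p \<in> {p \<in> U. \<exists>y\<in>S. f p = Some y}"
  then obtain y where p: "p \<in> U" and y: "y \<in> S" "f p = Some y" by blast
  from f[OF p] obtain F d S0 where S0: "given_near n X r f p F d S0" by (auto simp: regular_at_def)
  obtain T t where T: "T \<in> forms r t" "y \<in> basic_open r T" "basic_open r T \<subseteq> S" using S y(1) by (rule openin_zariskiD)
  have F: "\<And>i. i \<le> r \<Longrightarrow> F i \<in> forms n d" and pX: "p \<in> X" "p \<in> S0" using S0 by (auto simp: given_near_def)
  have TF: "subst_poly F T \<in> forms n (d * t)" by (rule forms_subst_poly[OF T(1) F])
  have local_f: "form_map r F v \<noteq> 0\<^sub>v (Suc r)" "f x = Some (point_of (form_map r F v))"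
    "x \<in> basic_open n (subst_poly F T) \<longleftrightarrow> point_of (form_map r F v) \<in> basic_open r T"
    if "x \<in> S0 \<inter> X" "v \<in> x" for x v
  proof -
    show fx: "form_map r F v \<noteq> 0\<^sub>v (Suc r)" "f x = Some (point_of (form_map r F v))"
      using S0 that by (auto simp: given_near_def given_by_form_map)
    have x: "x \<in> proj_space n" using that X by auto
    show "x \<in> basic_open n (subst_poly F T) \<longleftrightarrow> point_of (form_map r F v) \<in> basic_open r T"
      unfolding basic_open_iff[OF TF that(2) x] eval_subst_poly[OF T(1)]
      by (rule basic_open_iff[OF T(1) point_of_self proj_spaceI[OF form_map_carrier fx(1)], symmetric])
  qed
  let ?W = "U \<inter> (X \<inter> (S0 \<inter> basic_open n (subst_poly F T)))"
  have "openin (zariski n) (S0 \<inter> basic_open n (subst_poly F T))"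
    using S0 openin_basic_open[OF TF] by (auto simp: given_near_def openin_Int)
  then have "openin (zariski_on n X) (X \<inter> (S0 \<inter> basic_open n (subst_poly F T)))"
    by (rule openin_subtopology_Int2)
  with U have "openin (zariski_on n X) ?W" by (rule openin_Int)
  moreover have "p \<in> ?W"
  proof -
    obtain v where v: "v \<in> p" using proj_space_rep[of p n] pX X by blast
    show ?thesis using local_f[of p v] v pX p y T(2) by auto
  qed
  moreover have "?W \<subseteq> {p \<in> U. \<exists>y\<in>S. f p = Some y}"
  proof
    fix x assume x: "x \<in> ?W"
    then obtain v where v: "v \<in> x" using proj_space_rep[of x n] X by blast
    show "x \<in> {p \<in> U. \<exists>y\<in>S. f p = Some y}" using local_f[of x v] v x T(3) by auto
  qed
  ultimately show "\<exists>W. openin (zariski_on n X) W \<and> p \<in> W \<and> W \<subseteq> {p \<in> U. \<exists>y\<in>S. f p = Some y}" by blast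
qed

text \<open>The points near \<open>p\<close> at which two local representations by forms differ form an open set. If it contains \<open>p\<close> it is not
  empty, and by irreducibility it meets \<open>D\<close>.\<close>

lemma regular_agree:
  assumes X: "X \<subseteq> proj_space n" and irr: "irreducible_space (zariski_on n X)"
    and f: "regular_at n X r f p" and g: "regular_at n X r g p"
    and D: "openin (zariski_on n X) D" "D \<noteq> {}" "\<And>q. q \<in> D \<Longrightarrow> f q = g q"
  shows "f p = g p"
proof (rule ccontr)
  assume ne: "f p \<noteq> g p"
  from f obtain F d S where S: "given_near n X r f p F d S" by (auto simp: regular_at_def)
  from g obtain G e S' where S': "given_near n X r g p G e S'" by (auto simp: regular_at_def)
  have local: "form_map r F v \<noteq> 0\<^sub>v (Suc r)" "f x = Some (point_of (form_map r F v))"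
      "form_map r G v \<noteq> 0\<^sub>v (Suc r)" "g x = Some (point_of (form_map r G v))"
    if "x \<in> S \<inter> S' \<inter> X" "v \<in> x" for x v
    using S S' that by (auto simp: given_near_def given_by_form_map)
  have pX: "p \<in> S \<inter> S' \<inter> X" using S S' by (auto simp: given_near_def)
  obtain v where v: "v \<in> p" using proj_space_rep[of p n] pX X by blast
  have "point_of (form_map r F v) \<noteq> point_of (form_map r G v)" using local[OF pX v] ne by auto
  then obtain i j where ij: "i \<le> r" "j \<le> r" "form_map r F v $ i * form_map r G v $ j \<noteq> form_map r F v $ j * form_map r G v $ i"
    using point_of_eq_iff[OF form_map_carrier local(1)[OF pX v] form_map_carrier local(3)[OF pX v]]
    by (auto simp: less_Suc_eq_le)
  define T where "T = F i * G j - F j * G i"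
  have T: "T \<in> forms n (d + e)"
    unfolding T_def using S S' ij by (intro forms_diff forms_mult) (auto simp: given_near_def)
  have eval_T: "eval T u = form_map r F u $ i * form_map r G u $ j - form_map r F u $ j * form_map r G u $ i" for u
    using ij by (simp add: T_def form_map_def eval_eq_value_at value_at_hom.hom_minus value_at_hom.hom_mult)
  let ?W = "X \<inter> (S \<inter> S' \<inter> basic_open n T)"
  have "openin (zariski n) (S \<inter> S' \<inter> basic_open n T)"
    using S S' openin_basic_open[OF T] by (auto simp: given_near_def openin_Int)
  then have "openin (zariski_on n X) ?W" by (rule openin_subtopology_Int2)
  moreover have "p \<in> basic_open n T"
    using basic_open_iff[OF T v] pX X ij(3) by (auto simp: eval_T)
  then have "?W \<noteq> {}" using pX by blast
  ultimately have "?W \<inter> D \<noteq> {}" using irreducible_opens_meet[OF irr _ D(1) _ D(2)] by blast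
  then obtain q where q: "q \<in> ?W" "q \<in> D" by blast
  obtain u where u: "u \<in> q" using proj_space_rep[of q n] q X by blast
  have qX: "q \<in> S \<inter> S' \<inter> X" using q by auto
  have "point_of (form_map r F u) = point_of (form_map r G u)"
    using local[OF qX u] D(3)[OF q(2)] by simp
  then have "eval T u = 0"
    using point_of_eq_iff[OF form_map_carrier local(1)[OF qX u] form_map_carrier local(3)[OF qX u]] ij
    by (auto simp: eval_T)
  moreover have "eval T u \<noteq> 0" using basic_open_iff[OF T u] q X by auto
  ultimately show False by simp
qed

section \<open>Iterates of systems of forms\<close>

primrec iterate_forms :: "(nat \<Rightarrow> 'k::field mpoly) \<Rightarrow> nat \<Rightarrow> nat \<Rightarrow> 'k mpoly" where
  "iterate_forms E 0 = Var"
| "iterate_forms E (Suc k) = (\<lambda>i. subst_poly (iterate_forms E k) (E i))"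

lemma iterate_forms_in_forms:
  assumes E: "\<And>i. i \<le> m \<Longrightarrow> E i \<in> forms m d"
  shows "i \<le> m \<Longrightarrow> iterate_forms E k i \<in> forms m (d ^ k)"
proof (induction k arbitrary: i)
  case 0
  then show ?case by (simp add: forms_Var del: One_nat_def)
next
  case (Suc k)
  then have "subst_poly (iterate_forms E k) (E i) \<in> forms m (d ^ k * d)"
    using E by (intro forms_subst_poly) auto
  then show ?case by (simp add: mult.commute)
qed

lemma form_map_iterate_forms:
  fixes v :: "'k::field vec"
  assumes E: "\<And>i. i \<le> m \<Longrightarrow> E i \<in> forms m d" and v: "v \<in> carrier_vec (Suc m)"
  shows "form_map m (iterate_forms E k) v = (form_map m E ^^ k) v"
proof (induction k)
  case 0
  show ?case
    by (rule eq_vecI) (use v in \<open>auto simp: form_map_def eval_eq_value_at simp del: One_nat_def\<close>)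
next
  case (Suc k)
  then show ?case by (simp add: form_map_subst_poly[OF E])
qed

lemma iterate_form_map_carrier: "v \<in> carrier_vec (Suc m) \<Longrightarrow> (form_map m E ^^ k) v \<in> carrier_vec (Suc m)"
  by (induction k) auto

lemma iterate_form_map_smult:
  assumes E: "\<And>i. i \<le> m \<Longrightarrow> E i \<in> forms m d" and v: "v \<in> carrier_vec (Suc m)"
  shows "(form_map m E ^^ k) (c \<cdot>\<^sub>v v) = c ^ (d ^ k) \<cdot>\<^sub>v (form_map m E ^^ k) v"
proof (induction k)
  case (Suc k)
  then show ?case
    using form_map_smult[OF E iterate_form_map_carrier[OF v]] by (simp add: power_mult[symmetric] mult.commute)
qed simp

lemma form_map_smult_point:
  assumes E: "\<And>i. i \<le> m \<Longrightarrow> E i \<in> forms m d" and p: "p \<in> proj_space m" and v: "v \<in> p" "u \<in> p"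
  shows "\<exists>c. c \<noteq> 0 \<and> form_map m E u = c \<cdot>\<^sub>v form_map m E v"
proof -
  note pv = proj_spaceD[OF p v(1)]
  from v(2) pv(3) obtain c where "c \<noteq> 0" "u = c \<cdot>\<^sub>v v" by (auto simp: point_of_def)
  then show ?thesis using form_map_smult[OF E pv(1), where c = c] by (intro exI[of _ "c ^ d"]) auto
qed

section \<open>Recurrence for automorphisms\<close>

locale regular_bijection =
  fixes n :: nat and V :: "'k::alg_closed_field point set" and a b :: "'k point \<Rightarrow> 'k point"
  assumes V: "V \<subseteq> proj_space n"
    and a_V: "p \<in> V \<Longrightarrow> a p \<in> V" and b_V: "p \<in> V \<Longrightarrow> b p \<in> V"
    and b_a: "p \<in> V \<Longrightarrow> b (a p) = p" and a_b: "p \<in> V \<Longrightarrow> a (b p) = p"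
    and a_regular: "p \<in> V \<Longrightarrow> regular_at n V n (\<lambda>p. if p \<in> V then Some (a p) else None) p"
    and b_regular: "p \<in> V \<Longrightarrow> regular_at n V n (\<lambda>p. if p \<in> V then Some (b p) else None) p"
begin

lemma inverse: "regular_bijection n V b a"
  by unfold_locales (use V a_V b_V b_a a_b a_regular b_regular in auto)

lemma iterate_V: "p \<in> V \<Longrightarrow> (a ^^ k) p \<in> V"
  by (induction k) (auto intro: a_V)

lemma iterate_inverse: "p \<in> V \<Longrightarrow> (b ^^ k) ((a ^^ k) p) = p"
proof (induction k arbitrary: p)
  case (Suc k)
  have "(b ^^ Suc k) ((a ^^ Suc k) p) = b ((b ^^ k) ((a ^^ k) (a p)))"
    by (simp add: funpow_swap1)
  also have "\<dots> = p" using Suc by (simp add: a_V b_a)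
  finally show ?case .
qed simp

lemma openin_V: "openin (zariski_on n V) V"
  using openin_topspace[of "zariski_on n V"] V by (simp add: topspace_zariski Int_absorb1)

lemma preimage_open:
  assumes "openin (zariski_on n V) S"
  shows "openin (zariski_on n V) {p \<in> V. a p \<in> S}"
proof -
  from assms obtain S' where S': "openin (zariski n) S'" "S = S' \<inter> V" by (auto simp: openin_subtopology)
  have "openin (zariski_on n V) {p \<in> V. \<exists>y\<in>S'. (if p \<in> V then Some (a p) else None) = Some y}"
    by (rule regular_preimage_open[OF V openin_V a_regular S'(1)])
  moreover have "{p \<in> V. \<exists>y\<in>S'. (if p \<in> V then Some (a p) else None) = Some y} = {p \<in> V. a p \<in> S}"
    using S'(2) a_V by auto
  ultimately show ?thesis by simp
qed

lemma iterate_preimage_open: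
  assumes "openin (zariski_on n V) S"
  shows "openin (zariski_on n V) {p \<in> V. (a ^^ k) p \<in> S}"
proof (induction k)
  case 0
  have "{p \<in> V. (a ^^ 0) p \<in> S} = S" using openin_subset[OF assms] by (auto simp: topspace_subtopology)
  then show ?case using assms by simp
next
  case (Suc k)
  have "{p \<in> V. (a ^^ Suc k) p \<in> S} = {p \<in> V. a p \<in> {p \<in> V. (a ^^ k) p \<in> S}}"
    using a_V by (auto simp: funpow_swap1)
  then show ?case using preimage_open[OF Suc] by simp
qed

lemma iterate_regular:
  assumes "p \<in> V"
  shows "regular_at n V n (\<lambda>p. if p \<in> V then Some ((a ^^ k) p) else None) p"
proof (induction k)
  case 0
  obtain F d S where "given_near n V n Some p F d S"
    using regular_at_Some[OF assms V] by (auto simp: regular_at_def)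
  then have "given_near n V n (\<lambda>p. if p \<in> V then Some ((a ^^ 0) p) else None) p F d S"
    by (auto simp: given_near_def given_by_def)
  then show ?case unfolding regular_at_def by blast
next
  case (Suc k)
  have "regular_at n V n ((\<lambda>p. if p \<in> V then Some (a p) else None) \<circ>\<^sub>m
      (\<lambda>p. if p \<in> V then Some ((a ^^ k) p) else None)) p"
    by (rule regular_at_comp[OF V Suc, of "(a ^^ k) p" V])
       (use assms iterate_V a_regular in \<open>auto split: if_splits\<close>)
  moreover have "((\<lambda>p. if p \<in> V then Some (a p) else None) \<circ>\<^sub>m
      (\<lambda>p. if p \<in> V then Some ((a ^^ k) p) else None)) = (\<lambda>p. if p \<in> V then Some ((a ^^ Suc k) p) else None)"
    by (rule ext) (use iterate_V in \<open>auto simp: map_comp_def\<close>)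
  ultimately show ?case by simp
qed

text \<open>The zero sets \<open>Z j\<close> are the cones over the closures of the forward orbits starting at time \<open>j M\<close>. This decreasing
  sequence cannot be strict, so the point at some time \<open>J M\<close> lies in the closure of the orbit from time \<open>(J + 1) M\<close> on. Applying
  the \<open>J M\<close>-th power of the inverse, \<open>z\<close> lies in the closure of its orbit from time \<open>M > N\<close> on.\<close>

lemma recurrence:
  assumes U: "openin (zariski_on n V) U" and z: "z \<in> U"
  shows "\<exists>k\<ge>N. (a ^^ k) z \<in> U"
proof -
  interpret inv: regular_bijection n V b a by (rule inverse)
  have zV: "z \<in> V" using z openin_subset[OF U] by (auto simp: topspace_subtopology)
  define M where "M = Suc N"
  define Z where "Z j = {x. vec (Suc n) x \<noteq> 0\<^sub>v (Suc n) \<and>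
    (\<forall>F d. F \<in> forms n d \<longrightarrow> (\<forall>k\<ge>j * M. \<forall>v\<in>(a ^^ k) z. eval F v = 0) \<longrightarrow> value_at x F = 0)}" for j
  have Z_dec: "Z (Suc j) \<subseteq> Z j" for j
  proof
    fix x assume x: "x \<in> Z (Suc j)"
    have "k \<ge> j * M" if "k \<ge> Suc j * M" for k using that by simp
    with x show "x \<in> Z j" unfolding Z_def by blast
  qed
  have "\<exists>J. \<forall>d. \<forall>F\<in>forms n d. (\<forall>x\<in>Z (Suc J). value_at x F = 0) \<longrightarrow> (\<forall>x\<in>Z J. value_at x F = 0)"
    using no_strict_chain_of_zero_sets[of Z n, OF Z_dec] by blast
  then obtain J where J: "\<And>d F. F \<in> forms n d \<Longrightarrow> (\<forall>x\<in>Z (Suc J). value_at x F = 0) \<Longrightarrow> (\<forall>x\<in>Z J. value_at x F = 0)"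
    by blast
  define p where "p = (a ^^ (J * M)) z"
  have pV: "p \<in> V" using iterate_V[OF zV] by (simp add: p_def)
  define Q where "Q = {y \<in> V. (b ^^ (J * M)) y \<in> U}"
  have Qo: "openin (zariski_on n V) Q" unfolding Q_def by (rule inv.iterate_preimage_open[OF U])
  have pQ: "p \<in> Q" using pV z iterate_inverse[OF zV] by (simp add: Q_def p_def)
  from Qo obtain S where S: "openin (zariski n) S" "Q = S \<inter> V" by (auto simp: openin_subtopology)
  obtain F d where F: "F \<in> forms n d" "p \<in> basic_open n F" "basic_open n F \<subseteq> S"
    using openin_zariskiD[OF S(1)] pQ S(2) by blast
  have "\<exists>k\<ge>Suc J * M. (a ^^ k) z \<in> Q"
  proof (rule ccontr)
    assume no: "\<not> ?thesis"
    have "eval F v = 0" if k: "k \<ge> Suc J * M" and v: "v \<in> (a ^^ k) z" for k v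
    proof (rule ccontr)
      assume "eval F v \<noteq> 0"
      then have "(a ^^ k) z \<in> basic_open n F" using basic_open_iff[OF F(1) v] iterate_V[OF zV] V by blast
      then have "(a ^^ k) z \<in> Q" using F(3) S(2) iterate_V[OF zV] by blast
      with no k show False by blast
    qed
    then have "\<forall>x\<in>Z (Suc J). value_at x F = 0" using F(1) unfolding Z_def by blast
    then have van: "\<forall>x\<in>Z J. value_at x F = 0" by (rule J[OF F(1)])
    obtain v where v: "v \<in> p" "v \<in> carrier_vec (Suc n)" "v \<noteq> 0\<^sub>v (Suc n)"
      using proj_space_rep[of p n] pV V by blast
    have vec: "vec (Suc n) (($) v) = v" using v(2) by auto
    have "(($) v) \<in> Z J"
      unfolding Z_def mem_Collect_eq vec using v(1,3) by (auto simp: p_def simp flip: eval_eq_value_at)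
    with van have "eval F v = 0" by (simp add: eval_eq_value_at)
    with basic_open_iff[OF F(1) v(1)] F(2) pV V show False by blast
  qed
  then obtain k where k: "k \<ge> Suc J * M" "(a ^^ k) z \<in> Q" by blast
  then have le: "J * M \<le> k" by simp
  have "(a ^^ k) z = (a ^^ (J * M)) ((a ^^ (k - J * M)) z)"
    using le by (simp flip: funpow_add[unfolded o_def, THEN fun_cong])
  then have "(b ^^ (J * M)) ((a ^^ k) z) = (a ^^ (k - J * M)) z"
    using iterate_inverse[OF iterate_V[OF zV]] by simp
  with k(2) have "(a ^^ (k - J * M)) z \<in> U" by (simp add: Q_def)
  moreover have "k - J * M \<ge> N" using k(1) by (simp add: M_def)
  ultimately show ?thesis by blast
qed

end

section \<open>Regularizable transformations\<close>

lemma zariski_on_proj_space: "zariski_on m (proj_space m) = (zariski m :: 'k::alg_closed_field point topology)"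
  using subtopology_topspace[of "zariski m"] by (simp add: topspace_zariski)

lemma irreducible_proj_space: "irreducible_space (zariski m :: 'k::alg_closed_field point topology)"
  unfolding irreducible_space_def
proof (intro conjI allI impI)
  have "basic_open m (1 :: 'k mpoly) \<noteq> {}" by (rule nonzero_form_basic_open[OF forms_1]) simp
  then show "topspace (zariski m :: 'k point topology) \<noteq> {}" by (simp add: basic_open_1 topspace_zariski)
  fix C D :: "'k point set"
  assume CD: "closedin (zariski m) C \<and> closedin (zariski m) D \<and> C \<union> D = topspace (zariski m)"
  show "C = topspace (zariski m) \<or> D = topspace (zariski m)"
  proof (rule ccontr)
    assume "\<not> ?thesis"
    then have "topspace (zariski m) - C \<noteq> {}" "topspace (zariski m) - D \<noteq> {}" using CD by auto
    then have "(topspace (zariski m) - C) \<inter> (topspace (zariski m) - D) \<noteq> {}"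
      using CD by (intro proj_space_opens_meet) auto
    with CD show False by auto
  qed
qed

locale regularization = regular_bijection n V a b
  for n V and a b :: "'k::alg_closed_field point \<Rightarrow> 'k point" +
  fixes m :: nat and \<phi> \<psi> :: "'k point \<rightharpoonup> 'k point"
  assumes irr: "irreducible_space (zariski_on n V)"
    and \<phi>_open: "openin (zariski_on n V) (dom \<phi>)" and \<phi>_reg: "regular_on n m \<phi> (dom \<phi>)"
    and \<phi>_ran: "ran \<phi> \<subseteq> proj_space m"
    and \<psi>_open: "openin (zariski m) (dom \<psi>)" and \<psi>_reg: "regular_on m n \<psi> (dom \<psi>)"
    and \<psi>_ran: "ran \<psi> \<subseteq> V"
    and \<psi>\<phi>: "rat_eq n V (\<psi> \<circ>\<^sub>m \<phi>) Some" and \<phi>\<psi>: "rat_eq m (proj_space m) (\<phi> \<circ>\<^sub>m \<psi>) Some"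
begin

lemma \<phi>_dom: "dom \<phi> \<subseteq> V"
  using openin_subset[OF \<phi>_open] by (auto simp: topspace_subtopology)

lemma \<psi>_dom: "dom \<psi> \<subseteq> proj_space m"
  using openin_subset[OF \<psi>_open] by (simp add: topspace_zariski)

lemma \<phi>_regular_at: "z \<in> dom \<phi> \<Longrightarrow> regular_at n V m \<phi> z"
  by (rule regular_on_imp_regular_at[OF \<phi>_reg \<phi>_open])

lemma \<psi>_regular_at: "x \<in> dom \<psi> \<Longrightarrow> regular_at m (proj_space m) n \<psi> x"
  by (rule regular_on_imp_regular_at[OF \<psi>_reg]) (simp_all add: zariski_on_proj_space \<psi>_open)

text \<open>By assumption \<open>\<psi> \<circ> \<phi>\<close> is the identity on some nonempty open set only; both sides being regular at \<open>z\<close>, they agree there too.\<close>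

lemma \<psi>_\<phi>_eq:
  assumes "\<phi> z = Some x" "x \<in> dom \<psi>"
  shows "\<psi> x = Some z"
proof -
  from \<psi>\<phi> obtain D where D: "openin (zariski_on n V) D" "D \<noteq> {}" "\<And>p. p \<in> D \<Longrightarrow> (\<psi> \<circ>\<^sub>m \<phi>) p = Some p"
    by (auto simp: rat_eq_def)
  have z: "z \<in> dom \<phi>" using assms by auto
  have "(\<psi> \<circ>\<^sub>m \<phi>) z = Some z"
  proof (rule regular_agree[OF V irr _ _ D])
    show "regular_at n V n (\<psi> \<circ>\<^sub>m \<phi>) z"
      by (rule regular_at_comp[OF V \<phi>_regular_at[OF z] assms(1) \<psi>_regular_at[OF assms(2)]])
         (use \<phi>_ran in \<open>auto simp: ran_def\<close>)
    show "regular_at n V n Some z" by (rule regular_at_Some[OF _ V]) (use z \<phi>_dom in auto)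
  qed
  then show ?thesis using assms by (simp add: map_comp_def)
qed

lemma \<phi>_\<psi>_eq:
  assumes "\<psi> x = Some z" "z \<in> dom \<phi>"
  shows "\<phi> z = Some x"
proof -
  from \<phi>\<psi> obtain D where D: "openin (zariski_on m (proj_space m)) D" "D \<noteq> {}" "\<And>p. p \<in> D \<Longrightarrow> (\<phi> \<circ>\<^sub>m \<psi>) p = Some p"
    by (auto simp: rat_eq_def)
  have x: "x \<in> dom \<psi>" using assms by auto
  have "(\<phi> \<circ>\<^sub>m \<psi>) x = Some x"
  proof (rule regular_agree[OF _ _ _ _ D])
    show "irreducible_space (zariski_on m (proj_space m) :: 'k point topology)"
      by (simp add: zariski_on_proj_space irreducible_proj_space)
    show "regular_at m (proj_space m) m (\<phi> \<circ>\<^sub>m \<psi>) x"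
      by (rule regular_at_comp[OF _ \<psi>_regular_at[OF x] assms(1) \<phi>_regular_at[OF assms(2)]])
         (use \<psi>_ran in \<open>auto simp: ran_def\<close>)
    show "regular_at m (proj_space m) m Some x" by (rule regular_at_Some) (use x \<psi>_dom in auto)
  qed simp
  then show ?thesis using assms by (simp add: map_comp_def)
qed

text \<open>The open sets identified by \<open>\<phi>\<close> and \<open>\<psi>\<close>.\<close>

definition "source = {z. \<exists>x. \<phi> z = Some x \<and> x \<in> dom \<psi>}"
definition "target = {x. \<exists>z. \<psi> x = Some z \<and> z \<in> dom \<phi>}"

lemma open_source: "openin (zariski_on n V) source"
proof -
  have "openin (zariski_on n V) {p \<in> dom \<phi>. \<exists>y\<in>dom \<psi>. \<phi> p = Some y}"
    by (rule regular_preimage_open[OF V \<phi>_open \<phi>_regular_at \<psi>_open])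
  moreover have "{p \<in> dom \<phi>. \<exists>y\<in>dom \<psi>. \<phi> p = Some y} = source" by (auto simp: source_def)
  ultimately show ?thesis by simp
qed

lemma source_subset: "source \<subseteq> V"
  using openin_subset[OF open_source] by (auto simp: topspace_subtopology)

lemma preimage_\<phi>_open:
  assumes "openin (zariski m) S"
  shows "openin (zariski_on n V) {z. \<exists>x\<in>S. \<phi> z = Some x}"
proof -
  have "openin (zariski_on n V) {p \<in> dom \<phi>. \<exists>y\<in>S. \<phi> p = Some y}"
    by (rule regular_preimage_open[OF V \<phi>_open \<phi>_regular_at assms])
  moreover have "{p \<in> dom \<phi>. \<exists>y\<in>S. \<phi> p = Some y} = {z. \<exists>x\<in>S. \<phi> z = Some x}" by auto
  ultimately show ?thesis by simp
qed

lemma preimage_\<psi>_open: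
  assumes "openin (zariski_on n V) S"
  shows "openin (zariski m) {x. \<exists>z\<in>S. \<psi> x = Some z}"
proof -
  from assms obtain S' where S': "openin (zariski n) S'" "S = S' \<inter> V" by (auto simp: openin_subtopology)
  have "openin (zariski_on m (proj_space m)) {p \<in> dom \<psi>. \<exists>y\<in>S'. \<psi> p = Some y}"
    by (rule regular_preimage_open[OF _ _ \<psi>_regular_at S'(1)]) (simp_all add: zariski_on_proj_space \<psi>_open)
  moreover have "{p \<in> dom \<psi>. \<exists>y\<in>S'. \<psi> p = Some y} = {x. \<exists>z\<in>S. \<psi> x = Some z}"
    using S'(2) \<psi>_ran by (auto simp: ran_def)
  ultimately show ?thesis by (simp add: zariski_on_proj_space)
qed

lemma open_target: "openin (zariski m) target"
proof -
  have "target = {x. \<exists>z\<in>dom \<phi>. \<psi> x = Some z}" by (auto simp: target_def)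
  then show ?thesis using preimage_\<psi>_open[OF \<phi>_open] by simp
qed

lemma target_nonempty: "target \<noteq> {}"
proof -
  from \<phi>\<psi> obtain D where "D \<noteq> {}" "\<And>p. p \<in> D \<Longrightarrow> (\<phi> \<circ>\<^sub>m \<psi>) p = Some p" by (auto simp: rat_eq_def)
  then show ?thesis by (fastforce simp: target_def map_comp_def split: option.splits)
qed

lemma target_source:
  assumes "x \<in> target"
  obtains z where "\<psi> x = Some z" "\<phi> z = Some x" "z \<in> source"
  using assms \<phi>_\<psi>_eq by (auto simp: target_def source_def)

lemma source_target:
  assumes "z \<in> source"
  obtains x where "\<phi> z = Some x" "\<psi> x = Some z" "x \<in> target"
  using assms \<psi>_\<phi>_eq by (auto simp: target_def source_def)

lemma source_nonempty: "source \<noteq> {}"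
  using target_nonempty target_source by blast

lemma opens_meet:
  "openin (zariski_on n V) S \<Longrightarrow> openin (zariski_on n V) S' \<Longrightarrow> S \<noteq> {} \<Longrightarrow> S' \<noteq> {} \<Longrightarrow> S \<inter> S' \<noteq> {}"
  by (rule irreducible_opens_meet[OF irr])

text \<open>Expresses that \<open>\<phi> \<circ> a \<circ> \<psi>\<close> is given by the forms \<open>E\<close>, but in terms of points of \<open>V\<close>, where iterating \<open>a\<close> causes no
  problem of domains.\<close>

definition represented_on :: "'k point set \<Rightarrow> (nat \<Rightarrow> 'k mpoly) \<Rightarrow> bool" where
  "represented_on W E \<longleftrightarrow> (\<forall>z\<in>W. \<exists>x y. \<phi> z = Some x \<and> \<phi> (a z) = Some y \<and>
     (\<forall>v\<in>x. form_map m E v \<noteq> 0\<^sub>v (Suc m) \<and> y = point_of (form_map m E v)))"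

text \<open>The conditions that \<open>z\<close>, \<open>a z\<close>, \<open>\<dots>\<close> all lie in \<open>W\<close> define nonempty open sets, and finitely many such sets meet
  by irreducibility of \<open>V\<close>.\<close>

lemma iterates_represented:
  assumes E: "\<And>i. i \<le> m \<Longrightarrow> E i \<in> forms m d"
    and W: "openin (zariski_on n V) W" "W \<noteq> {}" "represented_on W E"
  shows "\<exists>W'. openin (zariski_on n V) W' \<and> W' \<noteq> {} \<and>
    (\<forall>z\<in>W'. \<exists>x y. \<phi> z = Some x \<and> \<phi> ((a ^^ k) z) = Some y \<and>
     (\<forall>v\<in>x. (form_map m E ^^ k) v \<noteq> 0\<^sub>v (Suc m) \<and> y = point_of ((form_map m E ^^ k) v)))"
proof (induction k)
  case 0
  have "\<forall>z\<in>source. \<exists>x y. \<phi> z = Some x \<and> \<phi> ((a ^^ 0) z) = Some y \<and>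
     (\<forall>v\<in>x. (form_map m E ^^ 0) v \<noteq> 0\<^sub>v (Suc m) \<and> y = point_of ((form_map m E ^^ 0) v))"
  proof
    fix z assume "z \<in> source"
    then obtain x where x: "\<phi> z = Some x" "x \<in> dom \<psi>" by (auto simp: source_def)
    then have "x \<in> proj_space m" using \<psi>_dom by blast
    then have "\<forall>v\<in>x. v \<noteq> 0\<^sub>v (Suc m) \<and> x = point_of v" using proj_spaceD by blast
    with x show "\<exists>x y. \<phi> z = Some x \<and> \<phi> ((a ^^ 0) z) = Some y \<and>
     (\<forall>v\<in>x. (form_map m E ^^ 0) v \<noteq> 0\<^sub>v (Suc m) \<and> y = point_of ((form_map m E ^^ 0) v))" by auto
  qed
  then show ?case using open_source source_nonempty by blast
next
  case (Suc k)
  then obtain W' where W': "openin (zariski_on n V) W'" "W' \<noteq> {}"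
    and rep: "\<And>z. z \<in> W' \<Longrightarrow> \<exists>x y. \<phi> z = Some x \<and> \<phi> ((a ^^ k) z) = Some y \<and>
     (\<forall>v\<in>x. (form_map m E ^^ k) v \<noteq> 0\<^sub>v (Suc m) \<and> y = point_of ((form_map m E ^^ k) v))" by blast
  interpret inv: regular_bijection n V b a by (rule inverse)
  let ?W = "W' \<inter> {z \<in> V. (a ^^ k) z \<in> W}"
  have open_pre: "openin (zariski_on n V) {z \<in> V. (a ^^ k) z \<in> W}" by (rule iterate_preimage_open[OF W(1)])
  obtain w where w: "w \<in> W" "w \<in> V" using W(2) openin_subset[OF W(1)] by (auto simp: topspace_subtopology)
  then have "(b ^^ k) w \<in> {z \<in> V. (a ^^ k) z \<in> W}" by (simp add: inv.iterate_V inv.iterate_inverse)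
  then have "?W \<noteq> {}" using opens_meet[OF W'(1) open_pre W'(2)] by blast
  moreover have "openin (zariski_on n V) ?W" using W'(1) open_pre by (rule openin_Int)
  moreover have "\<exists>x y. \<phi> z = Some x \<and> \<phi> ((a ^^ Suc k) z) = Some y \<and>
     (\<forall>v\<in>x. (form_map m E ^^ Suc k) v \<noteq> 0\<^sub>v (Suc m) \<and> y = point_of ((form_map m E ^^ Suc k) v))"
    if z: "z \<in> ?W" for z
  proof -
    from rep[of z] z obtain x y where x: "\<phi> z = Some x" and y: "\<phi> ((a ^^ k) z) = Some y"
      and xy: "\<And>v. v \<in> x \<Longrightarrow> (form_map m E ^^ k) v \<noteq> 0\<^sub>v (Suc m) \<and> y = point_of ((form_map m E ^^ k) v)" by auto
    from W(3) z obtain y' u where y': "\<phi> ((a ^^ k) z) = Some y'" and u: "\<phi> (a ((a ^^ k) z)) = Some u"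
      and yu: "\<And>v. v \<in> y' \<Longrightarrow> form_map m E v \<noteq> 0\<^sub>v (Suc m) \<and> u = point_of (form_map m E v)"
      unfolding represented_on_def by blast
    have "(form_map m E ^^ Suc k) v \<noteq> 0\<^sub>v (Suc m) \<and> u = point_of ((form_map m E ^^ Suc k) v)" if "v \<in> x" for v
      using yu[of "(form_map m E ^^ k) v"] xy[OF that] y y' point_of_self[of "(form_map m E ^^ k) v"] by simp
    with x u show ?thesis by auto
  qed
  ultimately show ?case by blast
qed

text \<open>Wherever \<open>\<phi> \<circ> a^k \<circ> \<psi>\<close> is defined it is a composition of regular maps, hence locally given by forms without common
  zero. On a nonempty open set the \<open>k\<close>-th iterate of \<open>E\<close> represents the same map, so the two systems are parallel there,
  and an identity between forms on a nonempty open set holds everywhere.\<close>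

lemma local_forms:
  assumes E: "\<And>i. i \<le> m \<Longrightarrow> E i \<in> forms m d"
    and W: "openin (zariski_on n V) W" "W \<noteq> {}" "represented_on W E"
    and x: "\<psi> x = Some z" "v \<in> x" and y: "\<phi> ((a ^^ k) z) = Some y"
  shows "\<exists>H. (\<forall>i\<le>m. \<forall>j\<le>m. H i * iterate_forms E k j = H j * iterate_forms E k i) \<and>
    form_map m H v \<noteq> 0\<^sub>v (Suc m) \<and> y = point_of (form_map m H v)"
proof -
  let ?ak = "\<lambda>p. if p \<in> V then Some ((a ^^ k) p) else None"
  define \<theta> where "\<theta> = \<phi> \<circ>\<^sub>m (?ak \<circ>\<^sub>m \<psi>)"
  have xd: "x \<in> dom \<psi>" and xP: "x \<in> proj_space m" using x \<psi>_dom by auto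
  have zV: "z \<in> V" using x \<psi>_ran by (auto simp: ran_def)
  have "regular_at m (proj_space m) n (?ak \<circ>\<^sub>m \<psi>) x"
    by (rule regular_at_comp[OF _ \<psi>_regular_at[OF xd] x(1) iterate_regular[OF zV]])
       (use \<psi>_ran in \<open>auto simp: ran_def\<close>)
  moreover have "(?ak \<circ>\<^sub>m \<psi>) x = Some ((a ^^ k) z)" using x zV by (simp add: map_comp_def)
  moreover have "regular_at n V m \<phi> ((a ^^ k) z)" by (rule \<phi>_regular_at) (use y in auto)
  ultimately have "regular_at m (proj_space m) m \<theta> x"
    unfolding \<theta>_def by (rule regular_at_comp[OF subset_refl])
      (use iterate_V in \<open>auto simp: map_comp_def split: option.splits if_splits\<close>)
  then obtain H e S where near: "given_near m (proj_space m) m \<theta> x H e S" by (auto simp: regular_at_def)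
  have S: "openin (zariski m) S" "x \<in> S" and H: "\<And>i. i \<le> m \<Longrightarrow> H i \<in> forms m e"
    using near by (auto simp: given_near_def)
  have H_rep: "form_map m H u \<noteq> 0\<^sub>v (Suc m) \<and> \<theta> p = Some (point_of (form_map m H u))" if "p \<in> S" "u \<in> p" "p \<in> proj_space m" for p u
    using near that unfolding given_near_def given_by_form_map by blast
  let ?Ek = "iterate_forms E k"
  have Ek: "\<And>i. i \<le> m \<Longrightarrow> ?Ek i \<in> forms m (d ^ k)" by (rule iterate_forms_in_forms[OF E])
  obtain W' where W': "openin (zariski_on n V) W'" "W' \<noteq> {}"
    and rep: "\<And>z. z \<in> W' \<Longrightarrow> \<exists>x y. \<phi> z = Some x \<and> \<phi> ((a ^^ k) z) = Some y \<and>
     (\<forall>v\<in>x. (form_map m E ^^ k) v \<noteq> 0\<^sub>v (Suc m) \<and> y = point_of ((form_map m E ^^ k) v))"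
    using iterates_represented[OF E W, of k] by blast
  let ?D = "{p. \<exists>z\<in>W' \<inter> source. \<psi> p = Some z}"
  have D_open: "openin (zariski m) ?D" by (rule preimage_\<psi>_open[OF openin_Int[OF W'(1) open_source]])
  have "W' \<inter> source \<noteq> {}" by (rule opens_meet[OF W'(1) open_source W'(2) source_nonempty])
  then have D_ne: "?D \<noteq> {}" using source_target by blast
  have "H i * ?Ek j = H j * ?Ek i" if ij: "i \<le> m" "j \<le> m" for i j
  proof (rule ccontr)
    assume ne: "H i * ?Ek j \<noteq> H j * ?Ek i"
    define T where "T = H i * ?Ek j - H j * ?Ek i"
    have T: "T \<in> forms m (e + d ^ k)" unfolding T_def by (intro forms_diff forms_mult H Ek ij)
    have "T \<noteq> 0" using ne by (simp add: T_def)
    then have "basic_open m T \<noteq> {}" by (rule nonzero_form_basic_open[OF T])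
    moreover have "S \<inter> ?D \<noteq> {}" using proj_space_opens_meet[OF S(1) D_open] S(2) D_ne by blast
    ultimately have "basic_open m T \<inter> (S \<inter> ?D) \<noteq> {}"
      using proj_space_opens_meet[OF openin_basic_open[OF T] openin_Int[OF S(1) D_open]] by blast
    then obtain p where p: "p \<in> basic_open m T" "p \<in> S" "p \<in> ?D" by blast
    then have pP: "p \<in> proj_space m" using basic_open_subset by blast
    obtain u where u: "u \<in> p" "u \<in> carrier_vec (Suc m)" using proj_space_rep[OF pP] by metis
    from p(3) obtain z' where z': "\<psi> p = Some z'" "z' \<in> W'" "z' \<in> source" by blast
    from z'(3) obtain x' where "\<phi> z' = Some x'" "x' \<in> dom \<psi>" by (auto simp: source_def)
    then have "\<phi> z' = Some p" using \<phi>_\<psi>_eq[OF z'(1)] by auto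
    with rep[OF z'(2)] u(1) obtain y' where y': "\<phi> ((a ^^ k) z') = Some y'"
      "(form_map m E ^^ k) u \<noteq> 0\<^sub>v (Suc m)" "y' = point_of ((form_map m E ^^ k) u)" by auto
    have "z' \<in> V" using z'(3) source_subset by blast
    then have "\<theta> p = Some y'" using z'(1) y'(1) by (simp add: \<theta>_def map_comp_def)
    then have "point_of (form_map m H u) = point_of (form_map m ?Ek u)"
      using H_rep[OF p(2) u(1) pP] y'(3) by (simp add: form_map_iterate_forms[OF E u(2)])
    moreover have "form_map m ?Ek u \<noteq> 0\<^sub>v (Suc m)" using y'(2) by (simp add: form_map_iterate_forms[OF E u(2)])
    ultimately have "\<forall>i<Suc m. \<forall>j<Suc m. form_map m H u $ i * form_map m ?Ek u $ j = form_map m H u $ j * form_map m ?Ek u $ i"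
      using point_of_eq_iff[OF form_map_carrier _ form_map_carrier] H_rep[OF p(2) u(1) pP] by blast
    then have "form_map m H u $ i * form_map m ?Ek u $ j = form_map m H u $ j * form_map m ?Ek u $ i"
      using ij by simp
    then have "eval T u = 0"
      using ij by (simp add: T_def form_map_def eval_eq_value_at value_at_hom.hom_minus value_at_hom.hom_mult)
    then show False using basic_open_iff[OF T u(1) pP] p(1) by simp
  qed
  moreover have "\<theta> x = Some y" using x y zV by (simp add: \<theta>_def map_comp_def)
  ultimately show ?thesis using H_rep[OF S(2) x(2) xP] by auto
qed

end

text \<open>Let \<open>z\<close> be the point of \<open>V\<close> corresponding to \<open>v\<close>, and \<open>b\<close> the inverse of \<open>a\<close>. At every time \<open>k\<close> at which \<open>b^k z\<close> returns to
  the open set identified by \<open>\<phi>\<close> with a part of projective space, \<open>\<phi> \<circ> b^k \<circ> \<psi>\<close> is regular at the point \<open>v\<close> and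
  \<open>\<phi> \<circ> a^k \<circ> \<psi>\<close> is regular at its image, because \<open>a^k b^k z = z\<close>. The systems \<open>H\<close> and \<open>H'\<close> are local representations of
  these two maps, and \<open>T\<close> is the equation of a hypersurface off which \<open>\<psi>\<close> provides the point \<open>z\<close>.\<close>

lemma regularizable_recurrence:
  fixes g :: "'k::alg_closed_field point \<rightharpoonup> 'k point"
  assumes reg: "regularizable m (proj_space m) g"
    and E: "\<And>i. i \<le> m \<Longrightarrow> E i \<in> forms m d" and E': "\<And>i. i \<le> m \<Longrightarrow> E' i \<in> forms m e"
    and W0: "openin (zariski m) W0" "W0 \<noteq> {}" "given_by m E g W0"
    and inv: "\<forall>p\<in>W0. \<forall>v\<in>p. \<exists>c. c \<noteq> 0 \<and> form_map m E' (form_map m E v) = c \<cdot>\<^sub>v v"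
  shows "\<exists>T t. T \<in> forms m t \<and> T \<noteq> 0 \<and>
    (\<forall>v\<in>carrier_vec (Suc m). v \<noteq> 0\<^sub>v (Suc m) \<longrightarrow> eval T v \<noteq> 0 \<longrightarrow> (\<forall>N. \<exists>k\<ge>N. \<exists>H H'.
      (\<forall>i\<le>m. \<forall>j\<le>m. H i * iterate_forms E' k j = H j * iterate_forms E' k i) \<and>
      form_map m H v \<noteq> 0\<^sub>v (Suc m) \<and>
      (\<forall>i\<le>m. \<forall>j\<le>m. H' i * iterate_forms E k j = H' j * iterate_forms E k i) \<and>
      form_map m H' (form_map m H v) \<noteq> 0\<^sub>v (Suc m)))"
proof -
  from reg obtain n V \<phi> \<psi> \<alpha> where var: "projective_variety n V"
    and \<phi>: "birational_map n V m (proj_space m) \<phi>" and \<psi>: "birational_inverse n V m (proj_space m) \<phi> \<psi>"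
    and \<alpha>: "automorphism n V \<alpha>" and eq: "rat_eq n V (\<psi> \<circ>\<^sub>m g \<circ>\<^sub>m \<phi>) \<alpha>"
    unfolding regularizable_def by blast
  from \<alpha> obtain \<beta> where \<alpha>_reg: "regular_map n V n V \<alpha>" and \<beta>_reg: "regular_map n V n V \<beta>"
    and \<beta>\<alpha>: "\<beta> \<circ>\<^sub>m \<alpha> = Some |` V" and \<alpha>\<beta>: "\<alpha> \<circ>\<^sub>m \<beta> = Some |` V"
    unfolding automorphism_def by blast
  have VP: "V \<subseteq> proj_space n" using var closedin_subset[of "zariski n" V] by (simp add: projective_variety_def topspace_zariski)
  define a where "a p = the (\<alpha> p)" for p
  define b where "b p = the (\<beta> p)" for p
  have \<alpha>_eq: "(\<lambda>p. if p \<in> V then Some (a p) else None) = \<alpha>"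
    using \<alpha>_reg by (auto simp: regular_map_def a_def fun_eq_iff domIff)
  have \<beta>_eq: "(\<lambda>p. if p \<in> V then Some (b p) else None) = \<beta>"
    using \<beta>_reg by (auto simp: regular_map_def b_def fun_eq_iff domIff)
  have a_some: "\<alpha> p = Some (a p)" and b_some: "\<beta> p = Some (b p)" if "p \<in> V" for p
    using that \<alpha>_eq \<beta>_eq by (auto dest: fun_cong[of _ _ p])
  have open_V: "openin (zariski_on n V) V"
    using openin_topspace[of "zariski_on n V"] VP by (simp add: topspace_zariski Int_absorb1)
  interpret R: regularization n V a b m \<phi> \<psi>
  proof
    show "V \<subseteq> proj_space n" by (rule VP)
    show "a p \<in> V" if "p \<in> V" for p
      using a_some[OF that] \<alpha>_reg by (auto simp: regular_map_def ran_def)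
    show "b p \<in> V" if "p \<in> V" for p
      using b_some[OF that] \<beta>_reg by (auto simp: regular_map_def ran_def)
    show "b (a p) = p" if "p \<in> V" for p
    proof -
      have "a p \<in> V" using a_some[OF that] \<alpha>_reg by (auto simp: regular_map_def ran_def)
      then show ?thesis using fun_cong[OF \<beta>\<alpha>, of p] a_some[OF that] b_some[of "a p"] that
        by (simp add: map_comp_def)
    qed
    show "a (b p) = p" if "p \<in> V" for p
    proof -
      have "b p \<in> V" using b_some[OF that] \<beta>_reg by (auto simp: regular_map_def ran_def)
      then show ?thesis using fun_cong[OF \<alpha>\<beta>, of p] b_some[OF that] a_some[of "b p"] that
        by (simp add: map_comp_def)
    qed
    show "regular_at n V n (\<lambda>p. if p \<in> V then Some (a p) else None) p" if "p \<in> V" for p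
      unfolding \<alpha>_eq by (rule regular_on_imp_regular_at[OF _ open_V that]) (use \<alpha>_reg in \<open>simp add: regular_map_def\<close>)
    show "regular_at n V n (\<lambda>p. if p \<in> V then Some (b p) else None) p" if "p \<in> V" for p
      unfolding \<beta>_eq by (rule regular_on_imp_regular_at[OF _ open_V that]) (use \<beta>_reg in \<open>simp add: regular_map_def\<close>)
    show "irreducible_space (zariski_on n V)" using var by (simp add: projective_variety_def)
    show "openin (zariski_on n V) (dom \<phi>)" "regular_on n m \<phi> (dom \<phi>)" "ran \<phi> \<subseteq> proj_space m"
      using \<phi> by (simp_all add: birational_map_def rational_map_def)
    show "openin (zariski m) (dom \<psi>)" "regular_on m n \<psi> (dom \<psi>)" "ran \<psi> \<subseteq> V"
      using \<psi> by (simp_all add: birational_inverse_def rational_map_def zariski_on_proj_space)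
    show "rat_eq n V (\<psi> \<circ>\<^sub>m \<phi>) Some" "rat_eq m (proj_space m) (\<phi> \<circ>\<^sub>m \<psi>) Some"
      using \<psi> by (simp_all add: birational_inverse_def)
  qed
  interpret I: regular_bijection n V b a by (rule R.inverse)
  interpret J: regularization n V b a m \<phi> \<psi>
    by unfold_locales (use R.irr R.\<phi>_open R.\<phi>_reg R.\<phi>_ran R.\<psi>_open R.\<psi>_reg R.\<psi>_ran R.\<psi>\<phi> R.\<phi>\<psi> in auto)
  from eq obtain U0 where U0: "openin (zariski_on n V) U0" "U0 \<noteq> {}"
    and U0_eq: "\<And>z. z \<in> U0 \<Longrightarrow> (\<psi> \<circ>\<^sub>m g \<circ>\<^sub>m \<phi>) z = \<alpha> z" by (auto simp: rat_eq_def)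
  let ?W1 = "{z. \<exists>x\<in>W0. \<phi> z = Some x}" and ?W2 = "{z \<in> V. a z \<in> dom \<phi>}"
  have W1: "openin (zariski_on n V) ?W1" by (rule R.preimage_\<phi>_open[OF W0(1)])
  have W1_ne: "?W1 \<noteq> {}"
  proof -
    have "W0 \<inter> R.target \<noteq> {}" by (rule proj_space_opens_meet[OF W0(1) R.open_target W0(2) R.target_nonempty])
    then obtain x where "x \<in> W0" "x \<in> R.target" by blast
    then show ?thesis by (auto elim!: R.target_source)
  qed
  have W2: "openin (zariski_on n V) ?W2" by (rule R.preimage_open[OF R.\<phi>_open])
  have W2_ne: "?W2 \<noteq> {}"
  proof -
    obtain y where y: "y \<in> R.source" using R.source_nonempty by blast
    then have "y \<in> V" "y \<in> dom \<phi>" using R.source_subset by (auto simp: R.source_def)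
    then have "b y \<in> ?W2" by (simp add: R.b_V R.a_b)
    then show ?thesis by blast
  qed
  define W where "W = U0 \<inter> (?W1 \<inter> ?W2)"
  have W: "openin (zariski_on n V) W" unfolding W_def by (intro openin_Int U0 W1 W2)
  have "?W1 \<inter> ?W2 \<noteq> {}" by (rule R.opens_meet[OF W1 W2 W1_ne W2_ne])
  then have W_ne: "W \<noteq> {}" unfolding W_def by (rule R.opens_meet[OF U0(1) openin_Int[OF W1 W2] U0(2)])
  have W_point: "\<exists>x y. x \<in> W0 \<and> \<phi> z = Some x \<and> \<phi> (a z) = Some y \<and>
      (\<forall>v\<in>x. form_map m E v \<noteq> 0\<^sub>v (Suc m) \<and> y = point_of (form_map m E v))" if z: "z \<in> W" for z
  proof -
    from z obtain x where x: "x \<in> W0" "\<phi> z = Some x" by (auto simp: W_def)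
    from z have zV: "z \<in> V" "a z \<in> dom \<phi>" by (auto simp: W_def)
    have g: "form_map m E v \<noteq> 0\<^sub>v (Suc m) \<and> g x = Some (point_of (form_map m E v))" if "v \<in> x" for v
      using W0(3) x(1) that unfolding given_by_form_map by blast
    have "x \<in> proj_space m" using R.\<phi>_ran x(2) by (auto simp: ran_def)
    then obtain v where v: "v \<in> x" using proj_space_rep by metis
    define y where "y = point_of (form_map m E v)"
    have gx: "g x = Some y" using g[OF v] by (simp add: y_def)
    have "(\<psi> \<circ>\<^sub>m g \<circ>\<^sub>m \<phi>) z = Some (a z)" using U0_eq[of z] z a_some[OF zV(1)] by (simp add: W_def)
    then have "\<psi> y = Some (a z)" using x(2) gx by (simp add: map_comp_def)
    then have "\<phi> (a z) = Some y" using zV(2) by (rule R.\<phi>_\<psi>_eq)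
    with x g gx show ?thesis by (intro exI[of _ x] exI[of _ y]) auto
  qed
  then have rep: "R.represented_on W E" unfolding R.represented_on_def by blast
  define W' where "W' = {z \<in> V. b z \<in> W}"
  have W': "openin (zariski_on n V) W'" unfolding W'_def by (rule I.preimage_open[OF W])
  have W'_ne: "W' \<noteq> {}"
  proof -
    obtain y where "y \<in> W" using W_ne by blast
    moreover then have "y \<in> V" by (auto simp: W_def)
    ultimately have "a y \<in> W'" by (simp add: W'_def R.a_V R.b_a)
    then show ?thesis by blast
  qed
  have rep': "J.represented_on W' E'"
    unfolding J.represented_on_def
  proof
    fix z assume z: "z \<in> W'"
    then have zV: "z \<in> V" and bz: "b z \<in> W" by (auto simp: W'_def)
    from W_point[OF bz] obtain x y where x: "x \<in> W0" "\<phi> (b z) = Some x" and y: "\<phi> z = Some y"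
      and xy: "\<And>v. v \<in> x \<Longrightarrow> form_map m E v \<noteq> 0\<^sub>v (Suc m) \<and> y = point_of (form_map m E v)"
      using R.a_b[OF zV] by auto
    have xP: "x \<in> proj_space m" and yP: "y \<in> proj_space m" using R.\<phi>_ran x(2) y by (auto simp: ran_def)
    obtain v where v: "v \<in> x" "v \<in> carrier_vec (Suc m)" "v \<noteq> 0\<^sub>v (Suc m)" "x = point_of v"
      using proj_space_rep[OF xP] by metis
    obtain c where c: "c \<noteq> 0" "form_map m E' (form_map m E v) = c \<cdot>\<^sub>v v" using inv x(1) v(1) by blast
    have "form_map m E' u \<noteq> 0\<^sub>v (Suc m) \<and> x = point_of (form_map m E' u)" if u: "u \<in> y" for u
    proof -
      have Ev: "form_map m E v \<in> y" using xy[OF v(1)] point_of_self by metis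
      have "\<exists>c. c \<noteq> 0 \<and> form_map m E' u = c \<cdot>\<^sub>v form_map m E' (form_map m E v)"
        by (rule form_map_smult_point[OF _ yP Ev u]) (rule E')
      then obtain c' where c': "c' \<noteq> 0"
        "form_map m E' u = c' \<cdot>\<^sub>v form_map m E' (form_map m E v)" by (elim exE conjE)
      have eq: "form_map m E' u = (c' * c) \<cdot>\<^sub>v v" unfolding c'(2) c(2) by (rule smult_smult_assoc)
      have cc: "c' * c \<noteq> 0" using c(1) c'(1) by simp
      show ?thesis unfolding eq v(4) point_of_smult[OF cc] smult_eq_0_vec[OF v(2)] using cc v(3) by simp
    qed
    with x y show "\<exists>x y. \<phi> z = Some x \<and> \<phi> (b z) = Some y \<and>
       (\<forall>v\<in>x. form_map m E' v \<noteq> 0\<^sub>v (Suc m) \<and> y = point_of (form_map m E' v))" by blast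
  qed
  obtain p where "p \<in> R.target" using R.target_nonempty by blast
  with R.open_target obtain T t where T: "T \<in> forms m t" "p \<in> basic_open m T" "basic_open m T \<subseteq> R.target"
    by (rule openin_zariskiD)
  have "\<exists>k\<ge>N. \<exists>H H'.
      (\<forall>i\<le>m. \<forall>j\<le>m. H i * iterate_forms E' k j = H j * iterate_forms E' k i) \<and>
      form_map m H v \<noteq> 0\<^sub>v (Suc m) \<and>
      (\<forall>i\<le>m. \<forall>j\<le>m. H' i * iterate_forms E k j = H' j * iterate_forms E k i) \<and>
      form_map m H' (form_map m H v) \<noteq> 0\<^sub>v (Suc m)"
    if v: "v \<in> carrier_vec (Suc m)" "v \<noteq> 0\<^sub>v (Suc m)" "eval T v \<noteq> 0" for v N
  proof -
    let ?x = "point_of v"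
    have "?x \<in> R.target"
      using basic_open_iff[OF T(1) point_of_self proj_spaceI[OF v(1,2)]] v(3) T(3) by blast
    then obtain z where z: "\<psi> ?x = Some z" "\<phi> z = Some ?x" "z \<in> R.source" by (rule R.target_source)
    obtain k where k: "k \<ge> N" "(b ^^ k) z \<in> R.source" using I.recurrence[OF R.open_source z(3)] by blast
    from k(2) obtain y where y: "\<phi> ((b ^^ k) z) = Some y" "\<psi> y = Some ((b ^^ k) z)" "y \<in> R.target" by (rule R.source_target)
    obtain H where H: "\<forall>i\<le>m. \<forall>j\<le>m. H i * iterate_forms E' k j = H j * iterate_forms E' k i"
      "form_map m H v \<noteq> 0\<^sub>v (Suc m)" "y = point_of (form_map m H v)"
      using J.local_forms[OF E' W' W'_ne rep' z(1) point_of_self y(1)] by blast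
    have zV: "z \<in> V" using z(3) R.source_subset by blast
    have "\<phi> ((a ^^ k) ((b ^^ k) z)) = Some ?x" using I.iterate_inverse[OF zV] z(2) by simp
    moreover have "form_map m H v \<in> y" unfolding H(3) by (rule point_of_self)
    ultimately obtain H' where "\<forall>i\<le>m. \<forall>j\<le>m. H' i * iterate_forms E k j = H' j * iterate_forms E k i"
      "form_map m H' (form_map m H v) \<noteq> 0\<^sub>v (Suc m)"
      using R.local_forms[OF E W W_ne rep y(2)] by blast
    with k(1) H show ?thesis by blast
  qed
  with T(1) basic_open_nonzero[OF T(2)] show ?thesis by blast
qed

section \<open>Forms representing a birational map and its inverse\<close>

text \<open>This is the polynomial \<open>p(\<lambda> x)\<close> in \<open>\<lambda>\<close>, with the variables beyond \<open>x\<^sub>m\<close> set to zero. Its coefficients are the homogeneous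
  components of \<open>p\<close>.\<close>

definition graded :: "nat \<Rightarrow> 'k::field mpoly \<Rightarrow> 'k mpoly poly" where
  "graded m p = peval (\<lambda>c. [:Const c:]) (\<lambda>i. if i \<le> m then [:0, Var i:] else 0) p"

lemma comm_ring_hom_graded: "comm_ring_hom (graded m :: 'k::field mpoly \<Rightarrow> _)"
proof -
  have "(graded m :: 'k mpoly \<Rightarrow> _) = peval (\<lambda>c. [:Const c:]) (\<lambda>i. if i \<le> m then [:0, Var i:] else 0)"
    by (rule ext) (simp add: graded_def)
  then show ?thesis by (simp only:) (rule peval_hom[OF comm_ring_hom_Const_poly])
qed

interpretation graded_hom: comm_ring_hom "graded m" for m by (rule comm_ring_hom_graded)

lemma coeff_graded_in_forms: "coeff (graded m p) j \<in> forms m j"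
proof -
  define C where "C q \<longleftrightarrow> (\<forall>j. coeff q j \<in> forms m j)" for q :: "'a mpoly poly"
  have C_mult: "C (q * q')" if "C q" "C q'" for q q'
    unfolding C_def coeff_mult
  proof (intro allI forms_sum)
    fix j i :: nat assume "i \<in> {..j}"
    then show "coeff q i * coeff q' (j - i) \<in> forms m j"
      using forms_mult[of "coeff q i" m i "coeff q' (j - i)" "j - i"] that by (simp add: C_def)
  qed
  have C_const: "C [:Const c:]" for c
    unfolding C_def by (auto simp: coeff_pCons forms_Const split: nat.split)
  have C_1: "C 1" using C_const[of 1] by (simp add: single_one one_pCons)
  have C_var: "C (if i \<le> m then [:0, Var i:] else 0)" for i
    unfolding C_def by (auto simp: coeff_pCons forms_Var split: nat.split simp del: One_nat_def)
      (use forms_Var in auto)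
  have C_power: "C (q ^ k)" if "C q" for q k by (induction k) (auto intro: C_mult C_1 that)
  have C_prod: "C (prod q I)" if "\<And>i. C (q i)" for q :: "nat \<Rightarrow> _" and I
    by (induction I rule: infinite_finite_induct) (auto intro: C_mult C_1 that)
  have C_sum: "C (sum q I)" if "\<And>i. C (q i)" for q :: "(nat \<Rightarrow>\<^sub>0 nat) \<Rightarrow> _" and I
    unfolding C_def coeff_sum using that by (auto simp: C_def intro: forms_sum)
  have "C (graded m p)" unfolding graded_def peval_def
    by (intro C_sum C_mult C_const C_prod C_power C_var)
  then show ?thesis by (simp add: C_def)
qed

lemma graded_form:
  assumes "p \<in> forms m d"
  shows "graded m p = monom p d"
proof -
  have "graded m p = peval (\<lambda>c. [:Const c:]) (\<lambda>i. [:0, 1:] * [:Var i:]) p"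
    unfolding graded_def by (rule peval_forms_cong[OF assms]) simp
  also have "\<dots> = [:0, 1:] ^ d * peval (\<lambda>c. [:Const c:]) (\<lambda>i. [:Var i:]) p"
    by (rule peval_forms_scale[OF assms])
  also have "peval (\<lambda>c. [:Const c:]) (\<lambda>i. [:Var i:]) p = [:p:]"
    using hom_peval[OF comm_ring_hom_single comm_ring_hom_const_poly, of Var p] by (simp add: subst_poly_Var del: One_nat_def)
  also have "[:0, 1:] ^ d * [:p:] = monom p d"
    by (simp add: monom_altdef)
  finally show ?thesis .
qed

text \<open>A factor of a homogeneous polynomial is homogeneous: compare degrees in \<open>\<lambda>\<close> in the product of \<open>D(\<lambda> x)\<close> with the cofactor.
  Since \<open>D\<close> vanishes at \<open>x\<close> it is not a constant, so that dividing it out decreases the degree.\<close>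

lemma divide_common_factor:
  fixes G :: "nat \<Rightarrow> 'k::alg_closed_field mpoly"
  assumes G: "\<And>i. i \<le> m \<Longrightarrow> G i \<in> forms m e" and nz: "a \<le> m" "G a \<noteq> 0"
    and D: "\<And>i. i \<le> m \<Longrightarrow> D dvd G i" "value_at x D = 0" "\<And>j. j > m \<Longrightarrow> x j = 0"
  shows "\<exists>c D' G'. c \<ge> 1 \<and> c \<le> e \<and> (\<forall>i\<le>m. G' i \<in> forms m (e - c) \<and> G i = D' * G' i)"
proof -
  have "\<forall>i. \<exists>g. i \<le> m \<longrightarrow> G i = D * g" using D(1) by (auto elim!: dvdE)
  then obtain g where g: "\<And>i. i \<le> m \<Longrightarrow> G i = D * g i" by metis
  have eq: "monom (G i) e = graded m D * graded m (g i)" if "i \<le> m" for i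
    using graded_form[OF G[OF that]] g[OF that] by (metis graded_hom.hom_mult)
  have nzD: "graded m D \<noteq> 0" using eq[OF nz(1)] nz(2) by auto
  define c where "c = degree (graded m D)"
  have deg: "graded m (g i) = 0 \<or> c + degree (graded m (g i)) = e" if "i \<le> m" for i
  proof (cases "graded m (g i) = 0")
    case False
    then have "degree (monom (G i) e) = c + degree (graded m (g i))"
      using nzD by (simp add: eq[OF that] degree_mult_eq c_def)
    moreover have "G i \<noteq> 0" using eq[OF that] nzD False by auto
    ultimately show ?thesis by (simp add: degree_monom_eq)
  qed simp
  have ce: "c \<le> e" using deg[OF nz(1)] eq[OF nz(1)] nz(2) by auto
  have "c \<noteq> 0"
  proof
    assume "c = 0"
    then obtain \<kappa> where \<kappa>: "graded m D = [:\<kappa>:]" unfolding c_def by (rule degree_eq_zeroE)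
    have form: "\<kappa> \<in> forms m 0" using coeff_graded_in_forms[of m D 0] by (simp add: \<kappa>)
    have hom: "comm_ring_hom (\<lambda>q. value_at x (poly q 1))"
      by (rule comm_ring_hom_comp[OF comm_ring_hom_value_at comm_ring_hom_poly])
    have "value_at x \<kappa> = value_at x (poly (graded m D) 1)" by (simp add: \<kappa>)
    also have "\<dots> = value_at (\<lambda>i. value_at x (poly (if i \<le> m then [:0, Var i:] else 0) 1)) D"
      unfolding graded_def using hom_peval[OF comm_ring_hom_Const_poly hom, of "\<lambda>i. if i \<le> m then [:0, Var i:] else 0" D]
      by (simp del: One_nat_def)
    also have "(\<lambda>i. value_at x (poly (if i \<le> m then [:0, Var i:] else 0) 1)) = x"
      by (rule ext) (use D(3) in \<open>auto simp del: One_nat_def\<close>)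
    finally have "value_at x \<kappa> = 0" using D(2) by simp
    moreover have "value_at y \<kappa> = value_at x \<kappa>" for y
      using peval_forms_scale[OF form, of "\<lambda>c. c" 0 x] peval_forms_scale[OF form, of "\<lambda>c. c" 0 y] by simp
    ultimately have "\<kappa> = 0" using value_at_all_zero_imp_zero[OF alg_closed_infinite, of \<kappa>] by simp
    then show False using \<kappa> nzD by simp
  qed
  moreover have "G i = lead_coeff (graded m D) * coeff (graded m (g i)) (e - c)" if "i \<le> m" for i
  proof -
    have "top_coeff (c + (e - c)) (graded m D * graded m (g i)) (lead_coeff (graded m D) * coeff (graded m (g i)) (e - c))"
      by (rule top_coeff_mult) (use deg[OF that] in \<open>auto simp: top_coeff_def c_def\<close>)
    then have "coeff (monom (G i) e) e = lead_coeff (graded m D) * coeff (graded m (g i)) (e - c)"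
      using ce by (simp add: top_coeff_def eq[OF that])
    then show ?thesis by simp
  qed
  ultimately show ?thesis using ce coeff_graded_in_forms
    by (intro exI[of _ c] exI[of _ "lead_coeff (graded m D)"] exI[of _ "\<lambda>i. coeff (graded m (g i)) (e - c)"]) auto
qed

text \<open>A representation of least degree has no common factor, because a common factor could be divided out.\<close>

lemma exists_representation_with_free_line:
  fixes f :: "'k::alg_closed_field point \<rightharpoonup> 'k point"
  assumes f: "rational_map m (proj_space m) m (proj_space m) f"
  shows "\<exists>G e W. (\<forall>i\<le>m. G i \<in> forms m e) \<and> openin (zariski m) W \<and> W \<noteq> {} \<and> given_by m G f W \<and>
    (\<exists>v w. free_line m G v w)"
proof -
  define R where "R e G \<longleftrightarrow> (\<forall>i\<le>m. G i \<in> forms m e) \<and> (\<exists>W. openin (zariski m) W \<and> W \<noteq> {} \<and> given_by m G f W)"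
    for e G
  obtain p where p: "p \<in> dom f" using f unfolding rational_map_def by blast
  have "regular_at m (proj_space m) m f p"
    by (rule regular_on_imp_regular_at[OF _ _ p]) (use f in \<open>simp_all add: rational_map_def\<close>)
  then obtain G0 e0 S where S: "given_near m (proj_space m) m f p G0 e0 S" by (auto simp: regular_at_def)
  have "S \<subseteq> proj_space m" using S openin_subset[of "zariski m" S] by (auto simp: given_near_def topspace_zariski)
  then have "S \<inter> proj_space m = S" by blast
  with S have "R e0 G0" unfolding R_def given_near_def by (intro conjI exI[of _ S]) auto
  define e where "e = (LEAST e. \<exists>G. R e G)"
  have "\<exists>G. R e G" unfolding e_def by (rule LeastI_ex) (use \<open>R e0 G0\<close> in blast)
  then obtain G where G: "R e G" by blast
  have least: "e \<le> e'" if "R e' G'" for e' G' unfolding e_def by (rule Least_le) (use that in blast)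
  from G obtain W where Gf: "\<And>i. i \<le> m \<Longrightarrow> G i \<in> forms m e" and W: "openin (zariski m) W" "W \<noteq> {}" "given_by m G f W"
    by (auto simp: R_def)
  obtain q where q: "q \<in> W" using W(2) by blast
  have WP: "W \<subseteq> proj_space m" using openin_subset[OF W(1)] by (simp add: topspace_zariski)
  then obtain u where u: "u \<in> q" using proj_space_rep[of q m] q by blast
  have "form_map m G u \<noteq> 0\<^sub>v (Suc m)" using W(3) q u unfolding given_by_form_map by blast
  then obtain a where a: "a \<le> m" "eval (G a) u \<noteq> 0"
    unfolding nonzero_vec_iff[OF form_map_carrier] by (auto simp: form_map_def less_Suc_eq_le)
  then have Ga: "G a \<noteq> 0" by (auto simp: eval_def)
  have "\<exists>v w. free_line m G v w"
  proof (rule exists_free_line[where F = G, OF Gf a(1) Ga])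
    fix D and x :: "nat \<Rightarrow> 'k" assume D: "\<And>i. i \<le> m \<Longrightarrow> D dvd G i" "\<And>j. m < j \<Longrightarrow> x j = 0"
    show "value_at x D \<noteq> 0"
    proof
      assume zero: "value_at x D = 0"
      from divide_common_factor[where G = G, OF Gf a(1) Ga D(1) zero D(2)] obtain c D' G' where c: "c \<ge> 1" "c \<le> e"
        and G': "\<And>i. i \<le> m \<Longrightarrow> G' i \<in> forms m (e - c) \<and> G i = D' * G' i" by blast
      have eq: "form_map m G v = eval D' v \<cdot>\<^sub>v form_map m G' v" for v
        by (rule eq_vecI) (use G' in \<open>auto simp: form_map_def eval_eq_value_at value_at_hom.hom_mult\<close>)
      have "given_by m G' f W"
        unfolding given_by_form_map
      proof (intro ballI)
        fix p v assume pv: "p \<in> W" "v \<in> p"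
        have Gv: "form_map m G v \<noteq> 0\<^sub>v (Suc m)" "f p = Some (point_of (form_map m G v))"
          using W(3) pv unfolding given_by_form_map by blast+
        then have "eval D' v \<noteq> 0" "form_map m G' v \<noteq> 0\<^sub>v (Suc m)"
          unfolding eq by (simp_all add: smult_eq_0_vec)
        then show "form_map m G' v \<noteq> 0\<^sub>v (Suc m) \<and> f p = Some (point_of (form_map m G' v))"
          using Gv(2) by (simp add: eq point_of_smult)
      qed
      then have "R (e - c) G'" unfolding R_def using G' W by blast
      from least[OF this] c show False by simp
    qed
  qed
  with Gf W show ?thesis by blast
qed

text \<open>The \<open>2 \<times> 2\<close> minors of the pair \<open>(F \<circ> G, id)\<close> are forms which vanish on a nonempty open set, hence vanish.\<close>

lemma composition_parallel:
  fixes f f' :: "'k::alg_closed_field point \<rightharpoonup> 'k point"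
  assumes F: "\<And>i. i \<le> m \<Longrightarrow> F i \<in> forms m d" "openin (zariski m) W" "W \<noteq> {}" "given_by m F f W"
    and G: "\<And>i. i \<le> m \<Longrightarrow> G i \<in> forms m e" "openin (zariski m) W'" "W' \<noteq> {}" "given_by m G f' W'"
    and f': "rational_map m (proj_space m) m (proj_space m) f'"
    and ff': "rat_eq m (proj_space m) (f \<circ>\<^sub>m f') Some" and f'f: "rat_eq m (proj_space m) (f' \<circ>\<^sub>m f) Some"
  shows "i \<le> m \<Longrightarrow> j \<le> m \<Longrightarrow> subst_poly G (F i) * Var j = subst_poly G (F j) * Var i"
    and "\<exists>i\<le>m. subst_poly G (F i) \<noteq> 0"
proof -
  from ff' obtain D where D: "openin (zariski m) D" "D \<noteq> {}" "\<And>p. p \<in> D \<Longrightarrow> (f \<circ>\<^sub>m f') p = Some p"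
    by (auto simp: rat_eq_def zariski_on_proj_space)
  from f'f obtain D' where D': "openin (zariski m) D'" "D' \<noteq> {}" "\<And>p. p \<in> D' \<Longrightarrow> (f' \<circ>\<^sub>m f) p = Some p"
    by (auto simp: rat_eq_def zariski_on_proj_space)
  have f'_open: "openin (zariski m) (dom f')" and f'_reg: "regular_on m m f' (dom f')"
    using f' by (simp_all add: rational_map_def zariski_on_proj_space)
  let ?B = "{p \<in> dom f'. \<exists>y\<in>W. f' p = Some y}"
  have "openin (zariski_on m (proj_space m)) ?B"
    by (rule regular_preimage_open[OF _ _ _ F(2)])
       (use f'_open f'_reg regular_on_imp_regular_at[OF f'_reg] in \<open>auto simp: zariski_on_proj_space\<close>)
  then have B: "openin (zariski m) ?B" by (simp add: zariski_on_proj_space)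
  have B_ne: "?B \<noteq> {}"
  proof -
    have "D' \<inter> W \<noteq> {}" by (rule proj_space_opens_meet[OF D'(1) F(2) D'(2) F(3)])
    then obtain q where q: "q \<in> D'" "q \<in> W" by blast
    from D'(3)[OF q(1)] obtain p where "f q = Some p" "f' p = Some q"
      by (auto simp: map_comp_def split: option.splits)
    with q show ?thesis by blast
  qed
  let ?S = "W' \<inter> (?B \<inter> D)"
  have S: "openin (zariski m) ?S" by (intro openin_Int G(2) B D(1))
  have "?B \<inter> D \<noteq> {}" by (rule proj_space_opens_meet[OF B D(1) B_ne D(2)])
  then have S_ne: "?S \<noteq> {}" by (rule proj_space_opens_meet[OF G(2) openin_Int[OF B D(1)] G(3)])
  have SP: "?S \<subseteq> proj_space m" using openin_subset[OF S] by (simp add: topspace_zariski)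
  have point: "form_map m F (form_map m G v) \<noteq> 0\<^sub>v (Suc m) \<and> point_of (form_map m F (form_map m G v)) = p"
    if p: "p \<in> ?S" and v: "v \<in> p" for p v
  proof -
    have Gv: "form_map m G v \<noteq> 0\<^sub>v (Suc m)" "f' p = Some (point_of (form_map m G v))"
      using G(4) p v unfolding given_by_form_map by blast+
    have "point_of (form_map m G v) \<in> W" using p Gv(2) by auto
    then have "form_map m F (form_map m G v) \<noteq> 0\<^sub>v (Suc m)"
      "f (point_of (form_map m G v)) = Some (point_of (form_map m F (form_map m G v)))"
      using F(4) point_of_self unfolding given_by_form_map by blast+
    moreover have "(f \<circ>\<^sub>m f') p = Some p" using D(3) p by blast
    ultimately show ?thesis using Gv(2) by (simp add: map_comp_def)
  qed
  have val: "eval (subst_poly G (F i)) v = form_map m F (form_map m G v) $ i" if "i \<le> m" for i v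
    using that by (simp add: eval_subst_poly[OF F(1)] form_map_def[of m F])
  show "subst_poly G (F i) * Var j = subst_poly G (F j) * Var i" if ij: "i \<le> m" "j \<le> m" for i j
  proof (rule ccontr)
    assume ne: "subst_poly G (F i) * Var j \<noteq> subst_poly G (F j) * Var i"
    define T where "T = subst_poly G (F i) * Var j - subst_poly G (F j) * Var i"
    have FG: "subst_poly G (F i) \<in> forms m (e * d)" if "i \<le> m" for i by (rule forms_subst_poly[OF F(1)[OF that] G(1)])
    have T: "T \<in> forms m (e * d + 1)" unfolding T_def by (intro forms_diff forms_mult FG forms_Var ij)
    have "T \<noteq> 0" using ne by (simp add: T_def)
    then have "basic_open m T \<inter> ?S \<noteq> {}"
      by (intro proj_space_opens_meet[OF openin_basic_open[OF T] S _ S_ne] nonzero_form_basic_open[OF T])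
    then obtain p where p: "p \<in> basic_open m T" "p \<in> ?S" by blast
    have pP: "p \<in> proj_space m" using p(2) SP by blast
    obtain v where v: "v \<in> p" "v \<in> carrier_vec (Suc m)" "v \<noteq> 0\<^sub>v (Suc m)" "p = point_of v"
      using proj_space_rep[OF pP] by metis
    have "\<forall>i<Suc m. \<forall>j<Suc m. form_map m F (form_map m G v) $ i * v $ j = form_map m F (form_map m G v) $ j * v $ i"
      using point_of_eq_iff[OF form_map_carrier _ v(2,3)] point[OF p(2) v(1)] v(4) by blast
    then have "eval T v = 0"
      using ij by (simp add: T_def eval_eq_value_at value_at_hom.hom_minus value_at_hom.hom_mult
        val[unfolded eval_eq_value_at] less_Suc_eq_le del: One_nat_def)
    then show False using basic_open_iff[OF T v(1) pP] p(1) by simp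
  qed
  obtain p where p: "p \<in> ?S" using S_ne by blast
  obtain v where v: "v \<in> p" using proj_space_rep[of p m] p SP by blast
  have "form_map m F (form_map m G v) \<noteq> 0\<^sub>v (Suc m)" using point[OF p v] by blast
  then obtain i where "i \<le> m" "form_map m F (form_map m G v) $ i \<noteq> 0"
    unfolding nonzero_vec_iff[OF form_map_carrier] by (auto simp: less_Suc_eq_le)
  then have "eval (subst_poly G (F i)) v \<noteq> 0" by (simp add: val)
  then have "subst_poly G (F i) \<noteq> 0" by (auto simp: eval_def)
  with \<open>i \<le> m\<close> show "\<exists>i\<le>m. subst_poly G (F i) \<noteq> 0" by blast
qed

section \<open>Forms in inverse position\<close>

text \<open>The two compositions represent the identity, that is, \<open>F(G(y))\<close> and \<open>G(F(y))\<close> are proportional to \<open>y\<close>, possibly zero.\<close>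

locale inverse_forms =
  fixes m :: nat and F G :: "nat \<Rightarrow> 'k::alg_closed_field mpoly" and d e :: nat
  assumes F: "i \<le> m \<Longrightarrow> F i \<in> forms m d" and G: "i \<le> m \<Longrightarrow> G i \<in> forms m e"
    and d: "d \<ge> 1" and e: "e \<ge> 1"
    and FG: "i \<le> m \<Longrightarrow> j \<le> m \<Longrightarrow> subst_poly G (F i) * Var j = subst_poly G (F j) * Var i"
    and GF: "i \<le> m \<Longrightarrow> j \<le> m \<Longrightarrow> subst_poly F (G i) * Var j = subst_poly F (G j) * Var i"
begin

lemma form_map_zero: "form_map m F (0\<^sub>v (Suc m)) = 0\<^sub>v (Suc m)"
proof -
  have "form_map m F (0 \<cdot>\<^sub>v 0\<^sub>v (Suc m)) = 0 ^ d \<cdot>\<^sub>v form_map m F (0\<^sub>v (Suc m))" by (rule form_map_smult[OF F]) auto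
  moreover have "(0 :: 'k) \<cdot>\<^sub>v 0\<^sub>v (Suc m) = 0\<^sub>v (Suc m)" by auto
  ultimately have "form_map m F (0\<^sub>v (Suc m)) = 0 \<cdot>\<^sub>v form_map m F (0\<^sub>v (Suc m))" using d by (simp add: power_0_left)
  also have "\<dots> = 0\<^sub>v (Suc m)" by (auto simp: form_map_def)
  finally show ?thesis .
qed

lemma FG_index:
  assumes "i \<le> m" "j \<le> m"
  shows "form_map m F (form_map m G v) $ i * v $ j = form_map m F (form_map m G v) $ j * v $ i"
proof -
  have "eval (subst_poly G (F i) * Var j) v = eval (subst_poly G (F j) * Var i) v" using FG[OF assms] by simp
  then show ?thesis
    using assms by (simp add: eval_eq_value_at value_at_hom.hom_mult eval_subst_poly[OF F, unfolded eval_eq_value_at]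
      form_map_def[of m F] del: One_nat_def)
qed

lemma inverse: "inverse_forms m G F e d"
  by unfold_locales (use F G d e FG GF in auto)

lemma G_zero: "form_map m G (0\<^sub>v (Suc m)) = 0\<^sub>v (Suc m)"
  by (rule inverse_forms.form_map_zero[OF inverse])

lemma FG_multiple:
  assumes v: "v \<in> carrier_vec (Suc m)"
  shows "\<exists>c. form_map m F (form_map m G v) = c \<cdot>\<^sub>v v"
proof (cases "v = 0\<^sub>v (Suc m)")
  case True
  then show ?thesis by (intro exI[of _ 1]) (simp add: G_zero form_map_zero)
next
  case False
  then obtain j where j: "j \<le> m" "v $ j \<noteq> 0" unfolding nonzero_vec_iff[OF v] by (auto simp: less_Suc_eq_le)
  show ?thesis
    by (rule exI[of _ "form_map m F (form_map m G v) $ j / v $ j"], rule eq_vecI)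
       (use v FG_index[OF _ j(1), of _ v] j in \<open>auto simp: field_simps less_Suc_eq_le\<close>)
qed

text \<open>If \<open>F \<circ> G\<close> has degree at least \<open>2\<close> then it vanishes at some nonzero vector. The first two
  coordinates of its restriction to the line \<open>e\<^sub>0 + s e\<^sub>1\<close> are \<open>p\<^sub>0(s)\<close> and \<open>s p\<^sub>0(s)\<close>: if \<open>p\<^sub>0\<close> has a root,
  it yields a zero, and otherwise \<open>p\<^sub>0\<close> is constant and \<open>e\<^sub>1\<close> is a zero.\<close>

lemma composition_zero:
  assumes m: "m \<ge> 1" and de: "d * e \<ge> 2"
  shows "\<exists>q\<in>carrier_vec (Suc m). q \<noteq> 0\<^sub>v (Suc m) \<and> form_map m F (form_map m G q) = 0\<^sub>v (Suc m)"
proof -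
  let ?K = "\<lambda>i. subst_poly G (F i)"
  let ?x = "\<lambda>j::nat. if j = 0 then 1 else 0 :: 'k" and ?v = "\<lambda>j::nat. if j = 1 then 1 else 0 :: 'k"
  have K: "?K i \<in> forms m (e * d)" if "i \<le> m" for i by (rule forms_subst_poly[OF F[OF that] G])
  have val: "form_map m F (form_map m G (vec (Suc m) x)) $ i = value_at x (?K i)" if "i \<le> m" for i x
  proof -
    have "value_at x (?K i) = eval (?K i) (vec (Suc m) x)" by (rule eval_vec[OF K[OF that], symmetric])
    then show ?thesis using that by (simp add: eval_subst_poly[OF F] form_map_def[of m F])
  qed
  define p where "p i = peval (\<lambda>c. [:c:]) (\<lambda>j. [:?x j, ?v j:]) (?K i)" for i
  have p_val: "poly (p i) s = value_at (\<lambda>j. ?x j + s * ?v j) (?K i)" for i s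
    using hom_peval[OF comm_ring_hom_const_poly comm_ring_hom_poly[of s], of "\<lambda>j. [:?x j, ?v j:]" "?K i"]
    by (simp add: p_def)
  have p_top: "top_coeff (e * d) (p i) (value_at ?v (?K i))" if "i \<le> m" for i
    using top_coeff_peval[OF K[OF that], of 1 "\<lambda>j. [:?x j, ?v j:]" ?v "\<lambda>c. c"] by (simp add: top_coeff_def p_def)
  have p1: "p 1 = [:0, 1:] * p 0"
  proof -
    have "poly (p 1 - [:0, 1:] * p 0) s = 0" for s
    proof -
      let ?y = "vec (Suc m) (\<lambda>j. ?x j + s * ?v j)"
      have "form_map m F (form_map m G ?y) $ 1 * ?y $ 0 = form_map m F (form_map m G ?y) $ 0 * ?y $ 1"
        by (rule FG_index) (use m in auto)
      then show ?thesis using m by (simp add: val p_val mult.commute)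
    qed
    then have "p 1 - [:0, 1:] * p 0 = 0" by (rule poly_all_zero_imp_zero[OF alg_closed_infinite])
    then show ?thesis by simp
  qed
  have zero: ?thesis if x: "i \<le> m" "x i \<noteq> 0" "value_at x (?K i) = 0" for x i
  proof -
    let ?q = "vec (Suc m) x"
    obtain c where c: "form_map m F (form_map m G ?q) = c \<cdot>\<^sub>v ?q" using FG_multiple[of ?q] by auto
    then have "c * x i = value_at x (?K i)" using val[OF x(1), of x] x(1) by simp
    then have "c = 0" using x by simp
    then have "form_map m F (form_map m G ?q) = 0\<^sub>v (Suc m)" unfolding c by auto
    moreover have "?q $ i \<noteq> 0" using x by simp
    then have "?q \<noteq> 0\<^sub>v (Suc m)" using x(1) by (metis index_zero_vec(1) le_imp_less_Suc)
    ultimately show ?thesis by (intro bexI[of _ ?q]) auto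
  qed
  show ?thesis
  proof (cases "\<exists>s. poly (p 0) s = 0")
    case True
    then obtain s where "poly (p 0) s = 0" by blast
    then show ?thesis using zero[of 0 "\<lambda>j. ?x j + s * ?v j"] by (simp add: p_val)
  next
    case False
    then have "degree (p 0) = 0" using alg_closed_imp_poly_has_root by blast
    then obtain c where "p 0 = [:c:]" by (rule degree_eq_zeroE)
    then have "coeff (p 1) (e * d) = 0"
      using p1 de by (auto simp: coeff_pCons mult.commute split: nat.split)
    then have "value_at ?v (?K 1) = 0" using p_top[of 1] m by (simp add: top_coeff_def)
    then show ?thesis using zero[of 1 ?v] m by simp
  qed
qed

end

section \<open>The choice of the projective linear map\<close>

text \<open>The adjugate of the adjugate of \<open>B\<close> is a multiple of \<open>B\<close>, so conditions on iterates have to be compared for proportional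
  matrices.\<close>

lemma twisted_iterate_smult_mat:
  assumes F: "\<And>i. i \<le> m \<Longrightarrow> F i \<in> forms m d" and A: "A \<in> carrier_mat (Suc m) (Suc m)"
    and v: "v \<in> carrier_vec (Suc m)" and c: "c \<noteq> (0 :: 'k::field)"
  shows "\<exists>b. b \<noteq> 0 \<and> (twisted_map m F (c \<cdot>\<^sub>m A) ^^ k) v = b \<cdot>\<^sub>v (twisted_map m F A ^^ k) v"
proof (induction k)
  case 0
  show ?case by (rule exI[of _ 1]) simp
next
  case (Suc k)
  then obtain b where b: "b \<noteq> 0" "(twisted_map m F (c \<cdot>\<^sub>m A) ^^ k) v = b \<cdot>\<^sub>v (twisted_map m F A ^^ k) v" by blast
  let ?u = "(twisted_map m F A ^^ k) v"
  have u: "?u \<in> carrier_vec (Suc m)" by (rule twisted_iterate_carrier[OF A v])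
  have "(twisted_map m F (c \<cdot>\<^sub>m A) ^^ Suc k) v = (c \<cdot>\<^sub>m A) *\<^sub>v (b ^ d \<cdot>\<^sub>v form_map m F ?u)"
    using b form_map_smult[OF F u] by simp
  also have "\<dots> = c \<cdot>\<^sub>v (A *\<^sub>v (b ^ d \<cdot>\<^sub>v form_map m F ?u))"
  proof (rule eq_vecI)
    fix i assume "i < dim_vec (c \<cdot>\<^sub>v (A *\<^sub>v (b ^ d \<cdot>\<^sub>v form_map m F ?u)))"
    then have i: "i < Suc m" using A by simp
    have "(c \<cdot>\<^sub>v row A i) \<bullet> (b ^ d \<cdot>\<^sub>v form_map m F ?u) = c * (row A i \<bullet> (b ^ d \<cdot>\<^sub>v form_map m F ?u))"
      by (rule scalar_prod_smult_left) (use A i in \<open>simp add: form_map_def\<close>)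
    then show "((c \<cdot>\<^sub>m A) *\<^sub>v (b ^ d \<cdot>\<^sub>v form_map m F ?u)) $ i = (c \<cdot>\<^sub>v (A *\<^sub>v (b ^ d \<cdot>\<^sub>v form_map m F ?u))) $ i"
      using A i by simp
  qed (use A in simp)
  also have "\<dots> = (c * b ^ d) \<cdot>\<^sub>v (A *\<^sub>v form_map m F ?u)"
    unfolding mult_mat_vec[OF A form_map_carrier] by (rule smult_smult_assoc)
  finally show ?case using b c by (intro exI[of _ "c * b ^ d"]) simp
qed

lemma det_adj_mat_nonzero:
  fixes B :: "'k::field mat"
  assumes B: "B \<in> carrier_mat N N" "det B \<noteq> 0"
  shows "det (adj_mat B) \<noteq> 0"
proof -
  have "det B * det (adj_mat B) = det (det B \<cdot>\<^sub>m 1\<^sub>m N)"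
    using det_mult[OF B(1) adj_mat(1)[OF B(1)]] adj_mat(2)[OF B(1)] by simp
  also have "\<dots> = det B ^ N" by simp
  also have "\<dots> \<noteq> 0" using B(2) by simp
  finally show ?thesis by auto
qed

lemma adj_adj_mat:
  fixes B :: "'k::field mat"
  assumes B: "B \<in> carrier_mat N N" "det B \<noteq> 0"
  shows "\<exists>c. c \<noteq> 0 \<and> adj_mat (adj_mat B) = c \<cdot>\<^sub>m B"
proof -
  let ?A = "adj_mat B"
  have A: "?A \<in> carrier_mat N N" by (rule adj_mat(1)[OF B(1)])
  have AA: "adj_mat ?A \<in> carrier_mat N N" by (rule adj_mat(1)[OF A])
  have "(B * ?A) * adj_mat ?A = B * (?A * adj_mat ?A)" by (rule assoc_mult_mat[OF B(1) A AA])
  then have "det B \<cdot>\<^sub>m adj_mat ?A = det ?A \<cdot>\<^sub>m B"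
    unfolding adj_mat(2)[OF A] adj_mat(2)[OF B(1)]
    using mult_smult_assoc_mat[OF one_carrier_mat AA, of "det B"] mult_smult_distrib[OF B(1) one_carrier_mat, of "det ?A"]
      left_mult_one_mat[OF AA] right_mult_one_mat[OF B(1)] by simp
  then have "(1 / det B) \<cdot>\<^sub>m (det B \<cdot>\<^sub>m adj_mat ?A) = (1 / det B) \<cdot>\<^sub>m (det ?A \<cdot>\<^sub>m B)" by simp
  moreover have "(1 / det B) \<cdot>\<^sub>m (det B \<cdot>\<^sub>m adj_mat ?A) = adj_mat ?A" by (rule eq_matI) (use AA B(2) in auto)
  moreover have "(1 / det B) \<cdot>\<^sub>m (det ?A \<cdot>\<^sub>m B) = (det ?A / det B) \<cdot>\<^sub>m B" by (rule eq_matI) auto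
  ultimately show ?thesis using B(2) det_adj_mat_nonzero[OF B] by (intro exI[of _ "det ?A / det B"]) auto
qed

text \<open>The sets of matrices fulfilling one of the four requirements are thick and nonempty: the identity is invertible, a matrix of rank
  two satisfies the requirement on the iterates of \<open>F\<close>, and a matrix of rank one the requirement on the orbit of \<open>q\<close>. For the requirement
  on the adjugate, take an invertible matrix \<open>B\<close> such that the iterates of \<open>B \<circ> G\<close> avoid zero; the adjugate of \<open>adj_mat B\<close> is a nonzero
  multiple of \<open>B\<close>.\<close>

lemma exists_generic_matrix:
  fixes F G :: "nat \<Rightarrow> 'k::alg_closed_field mpoly"
  assumes unc: "uncountable (UNIV :: 'k set)"
    and F: "\<And>i. i \<le> m \<Longrightarrow> F i \<in> forms m d" "d \<ge> 1" "free_line m F v w"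
    and G: "\<And>i. i \<le> m \<Longrightarrow> G i \<in> forms m e" "e \<ge> 1" "free_line m G v' w'"
    and X: "X \<in> forms m x" and q: "q \<in> carrier_vec (Suc m)" "q \<noteq> 0\<^sub>v (Suc m)"
    and u: "u \<in> carrier_vec (Suc m)" "eval X u \<noteq> 0" "form_map m F u \<noteq> 0\<^sub>v (Suc m)"
  shows "\<exists>A\<in>carrier_mat (Suc m) (Suc m). det A \<noteq> 0 \<and> (\<forall>k. A \<in> iterates_avoid_zero m F v w k) \<and>
    (\<forall>k. adj_mat A \<in> iterates_avoid_zero m G v' w' k) \<and> (\<forall>k. A \<in> orbit_avoids m F X q k)"
proof -
  let ?N = "Suc m" and ?D = "{A :: 'k mat. det A \<noteq> 0}"
  define SF where "SF = {A. \<forall>k. A \<in> iterates_avoid_zero m F v w k}"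
  define SG where "SG = {A. \<forall>k. A \<in> iterates_avoid_zero m G v' w' k}"
  define SX where "SX = {A. \<forall>k. A \<in> orbit_avoids m F X q k}"
  have thick: "thick ?N SF" "thick ?N SG" "thick ?N SX" "thick ?N ?D"
    unfolding SF_def SG_def SX_def
    by (rule thick_all thick_iterates_avoid_zero[OF F(1)] thick_iterates_avoid_zero[OF G(1)]
        thick_orbit_avoids[OF F(1) X q(1)] thick_det | assumption)+
  obtain A1 where A1: "A1 \<in> carrier_mat ?N ?N" "A1 \<in> SF"
    using iterates_avoid_zero_nonempty[OF F] by (auto simp: SF_def)
  obtain B1 where B1: "B1 \<in> carrier_mat ?N ?N" "B1 \<in> SG"
    using iterates_avoid_zero_nonempty[OF G] by (auto simp: SG_def)
  obtain A2 where A2: "A2 \<in> carrier_mat ?N ?N" "A2 \<in> SX"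
    using orbit_avoids_nonempty[OF alg_closed_infinite F(1) X q u] by (auto simp: SX_def)
  have one: "1\<^sub>m ?N \<in> carrier_mat ?N ?N" "(1\<^sub>m ?N :: 'k mat) \<in> ?D" by simp_all
  obtain B where B: "B \<in> carrier_mat ?N ?N" "B \<in> SG" "det B \<noteq> 0"
    using thick_meet[OF unc thick(2,4) B1 one] by auto
  obtain c where c: "c \<noteq> 0" "adj_mat (adj_mat B) = c \<cdot>\<^sub>m B" using adj_adj_mat[OF B(1,3)] by blast
  have "adj_mat (adj_mat B) \<in> SG"
    unfolding SG_def iterates_avoid_zero_def mem_Collect_eq
  proof (intro allI impI)
    fix k and \<alpha> \<beta> :: 'k
    assume nz: "\<alpha> \<noteq> 0 \<or> \<beta> \<noteq> 0"
    let ?l = "line_vec m v' w' \<alpha> \<beta>"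
    have "\<exists>b. b \<noteq> 0 \<and> (twisted_map m G (c \<cdot>\<^sub>m B) ^^ k) ?l = b \<cdot>\<^sub>v (twisted_map m G B ^^ k) ?l"
      by (rule twisted_iterate_smult_mat[OF _ B(1) _ c(1)]) (erule G(1), simp)
    then obtain b where b: "b \<noteq> 0" "(twisted_map m G (c \<cdot>\<^sub>m B) ^^ k) ?l = b \<cdot>\<^sub>v (twisted_map m G B ^^ k) ?l"
      by (elim exE conjE)
    have "(twisted_map m G B ^^ k) ?l \<noteq> 0\<^sub>v (Suc m)"
      using B(2) nz unfolding SG_def iterates_avoid_zero_def by blast
    then show "(twisted_map m G (adj_mat (adj_mat B)) ^^ k) ?l \<noteq> 0\<^sub>v (Suc m)"
      unfolding c(2) b(2) using b(1) twisted_iterate_carrier[OF B(1), where v = ?l and F = G and k = k] by (simp add: smult_eq_0_vec)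
  qed
  then have A3: "adj_mat B \<in> carrier_mat ?N ?N" "adj_mat B \<in> {A. adj_mat A \<in> SG}"
    using adj_mat(1)[OF B(1)] by auto
  obtain A4 where A4: "A4 \<in> carrier_mat ?N ?N" "A4 \<in> SF \<inter> SX"
    using thick_meet[OF unc thick(1,3) A1 A2] by auto
  obtain A5 where A5: "A5 \<in> carrier_mat ?N ?N" "A5 \<in> SF \<inter> SX \<inter> ?D"
    using thick_meet[OF unc thick_Int[OF thick(1,3)] thick(4) A4 one] by auto
  obtain A where "A \<in> carrier_mat ?N ?N" "A \<in> SF \<inter> SX \<inter> ?D" "adj_mat A \<in> SG"
    using thick_meet[OF unc thick_Int[OF thick_Int[OF thick(1,3)] thick(4)] thick_adj[OF thick(2)] A5 A3] by auto
  then show ?thesis by (intro bexI[of _ A]) (auto simp: SF_def SG_def SX_def)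
qed

section \<open>Contracted hypersurfaces have infinitely many preimages\<close>

locale generic_twist = inverse_forms m F G d e
  for m and F G :: "nat \<Rightarrow> 'k::alg_closed_field mpoly" and d e +
  fixes A :: "'k mat" and v w v' w' :: "nat \<Rightarrow> 'k" and q :: "'k vec"
  assumes A: "A \<in> carrier_mat (Suc m) (Suc m)" and det_A: "det A \<noteq> 0"
    and avoid_F: "A \<in> iterates_avoid_zero m F v w k"
    and avoid_G: "adj_mat A \<in> iterates_avoid_zero m G v' w' k"
    and q: "q \<in> carrier_vec (Suc m)" and q_contracted: "form_map m F (form_map m G q) = 0\<^sub>v (Suc m)"
    and orbit: "A \<in> orbit_avoids m F (Var 0 * subst_poly F (G 0)) q k"
begin

text \<open>The adjugate replaces the inverse of \<open>A\<close>; this changes the map \<open>G \<circ> B\<close> of projective space not at all, but makes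
  \<open>B\<close> depend polynomially on \<open>A\<close>.\<close>

definition B :: "'k mat" where "B = adj_mat A"
definition FA :: "nat \<Rightarrow> 'k mpoly" where "FA i = (\<Sum>j\<le>m. Const (A $$ (i, j)) * F j)"
definition GB :: "nat \<Rightarrow> 'k mpoly" where "GB i = subst_poly (\<lambda>l. \<Sum>j\<le>m. Const (B $$ (l, j)) * Var j) (G i)"

lemma B: "B \<in> carrier_mat (Suc m) (Suc m)"
  unfolding B_def by (rule adj_mat(1)[OF A])

lemma A_B: "u \<in> carrier_vec (Suc m) \<Longrightarrow> A *\<^sub>v (B *\<^sub>v u) = det A \<cdot>\<^sub>v u"
  and B_A: "u \<in> carrier_vec (Suc m) \<Longrightarrow> B *\<^sub>v (A *\<^sub>v u) = det A \<cdot>\<^sub>v u"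
proof -
  assume u: "u \<in> carrier_vec (Suc m)"
  have scalar: "(det A \<cdot>\<^sub>m 1\<^sub>m (Suc m)) *\<^sub>v u = det A \<cdot>\<^sub>v u"
    by (rule eq_vecI) (use u in \<open>auto simp: scalar_prod_smult_left\<close>)
  show "A *\<^sub>v (B *\<^sub>v u) = det A \<cdot>\<^sub>v u"
    using assoc_mult_mat_vec[OF A B u] adj_mat(2)[OF A] scalar by (simp add: B_def)
  show "B *\<^sub>v (A *\<^sub>v u) = det A \<cdot>\<^sub>v u"
    using assoc_mult_mat_vec[OF B A u] adj_mat(3)[OF A] scalar by (simp add: B_def)
qed

lemma FA: "i \<le> m \<Longrightarrow> FA i \<in> forms m d"
  unfolding FA_def by (intro forms_sum forms_Const_mult F) simp

lemma GB: "i \<le> m \<Longrightarrow> GB i \<in> forms m e"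
proof -
  assume "i \<le> m"
  have "(\<Sum>j\<le>m. Const (B $$ (l, j)) * Var j) \<in> forms m 1" for l
    by (intro forms_sum forms_Const_mult forms_Var) simp
  from forms_subst_poly[OF G[OF \<open>i \<le> m\<close>] this] show "GB i \<in> forms m e" by (simp add: GB_def)
qed

lemma form_map_FA: "form_map m FA u = A *\<^sub>v form_map m F u"
proof (rule eq_vecI)
  fix i assume "i < dim_vec (A *\<^sub>v form_map m F u)"
  then have i: "i \<le> m" using A by simp
  have "(A *\<^sub>v form_map m F u) $ i = (\<Sum>j\<le>m. A $$ (i, j) * form_map m F u $ j)"
    by (rule mult_mat_vec_index[OF A form_map_carrier i])
  then show "form_map m FA u $ i = (A *\<^sub>v form_map m F u) $ i"
    using i by (simp add: form_map_def FA_def eval_eq_value_at value_at_hom.hom_sum value_at_hom.hom_mult)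
qed (use A in \<open>auto simp: form_map_def\<close>)

lemma form_map_GB:
  assumes u: "u \<in> carrier_vec (Suc m)"
  shows "form_map m GB u = form_map m G (B *\<^sub>v u)"
proof -
  have "form_map m (\<lambda>l. \<Sum>j\<le>m. Const (B $$ (l, j)) * Var j) u = B *\<^sub>v u"
  proof (rule eq_vecI)
    fix i assume "i < dim_vec (B *\<^sub>v u)"
    then have i: "i \<le> m" using B by simp
    show "form_map m (\<lambda>l. \<Sum>j\<le>m. Const (B $$ (l, j)) * Var j) u $ i = (B *\<^sub>v u) $ i"
      using i by (simp add: mult_mat_vec_index[OF B u i] form_map_def eval_eq_value_at value_at_hom.hom_sum
        value_at_hom.hom_mult del: One_nat_def index_mult_mat_vec)
  qed (use B in \<open>auto simp: form_map_def\<close>)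
  then show ?thesis unfolding GB_def by (simp add: form_map_subst_poly[OF G])
qed

lemma FA_GB_multiple:
  assumes u: "u \<in> carrier_vec (Suc m)"
  shows "\<exists>c. form_map m FA (form_map m GB u) = c \<cdot>\<^sub>v u"
proof -
  have Bu: "B *\<^sub>v u \<in> carrier_vec (Suc m)" using B u by auto
  obtain c where "form_map m F (form_map m G (B *\<^sub>v u)) = c \<cdot>\<^sub>v (B *\<^sub>v u)" using FG_multiple[OF Bu] by blast
  then have "form_map m FA (form_map m GB u) = (c * det A) \<cdot>\<^sub>v u"
    using A_B[OF u] by (simp add: form_map_FA form_map_GB[OF u] mult_mat_vec[OF A Bu] smult_smult_assoc)
  then show ?thesis by blast
qed

lemma GB_FA: "form_map m GB (form_map m FA u) = det A ^ e \<cdot>\<^sub>v form_map m G (form_map m F u)"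
  using form_map_smult[OF G form_map_carrier, where c = "det A"]
  by (simp add: form_map_GB form_map_FA[of u] B_A mult_mat_vec_carrier[OF A form_map_carrier])

lemma FA_iterate: "i \<le> m \<Longrightarrow> iterate_forms FA k i \<in> forms m (d ^ k)"
  by (rule iterate_forms_in_forms) (rule FA)

lemma GB_iterate: "i \<le> m \<Longrightarrow> iterate_forms GB k i \<in> forms m (e ^ k)"
  by (rule iterate_forms_in_forms) (rule GB)

lemma form_map_FA_iterate: "u \<in> carrier_vec (Suc m) \<Longrightarrow> form_map m (iterate_forms FA k) u = (form_map m FA ^^ k) u"
  by (rule form_map_iterate_forms) (erule FA)

lemma form_map_GB_iterate: "u \<in> carrier_vec (Suc m) \<Longrightarrow> form_map m (iterate_forms GB k) u = (form_map m GB ^^ k) u"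
  by (rule form_map_iterate_forms) (erule GB)

lemma FA_zero: "form_map m FA (0\<^sub>v (Suc m)) = 0\<^sub>v (Suc m)"
  using A by (auto simp: form_map_FA form_map_zero)

lemma FA_iterate_zero: "(form_map m FA ^^ k) (0\<^sub>v (Suc m)) = 0\<^sub>v (Suc m)"
  by (induction k) (simp_all add: FA_zero)

abbreviation round_trip :: "nat \<Rightarrow> 'k vec \<Rightarrow> 'k vec" where
  "round_trip k u \<equiv> (form_map m FA ^^ k) ((form_map m GB ^^ k) u)"

text \<open>The innermost step back and forth multiplies by a scalar, which comes out of the remaining steps by homogeneity.\<close>

lemma round_trip_Suc:
  assumes u: "u \<in> carrier_vec (Suc m)"
  shows "\<exists>c. round_trip (Suc k) u = c \<cdot>\<^sub>v round_trip k u"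
proof -
  let ?g = "(form_map m GB ^^ k) u"
  have g: "?g \<in> carrier_vec (Suc m)" by (rule iterate_form_map_carrier[OF u])
  obtain c where c: "form_map m FA (form_map m GB ?g) = c \<cdot>\<^sub>v ?g" using FA_GB_multiple[OF g] by blast
  have "round_trip (Suc k) u = (form_map m FA ^^ k) (form_map m FA (form_map m GB ?g))"
    by (simp add: funpow_swap1)
  also have "\<dots> = c ^ (d ^ k) \<cdot>\<^sub>v round_trip k u"
    unfolding c by (rule iterate_form_map_smult[OF _ g]) (rule FA)
  finally show ?thesis by (rule exI)
qed

lemma round_trip_multiple:
  assumes u: "u \<in> carrier_vec (Suc m)"
  shows "\<exists>c. round_trip k u = c \<cdot>\<^sub>v u"
proof (induction k)
  case 0
  show ?case by (rule exI[of _ 1]) simp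
next
  case (Suc k)
  then show ?case using round_trip_Suc[OF u, of k] by (metis smult_smult_assoc)
qed

lemma round_trip_zero_mono:
  assumes u: "u \<in> carrier_vec (Suc m)" and "k \<le> l" and zero: "round_trip k u = 0\<^sub>v (Suc m)"
  shows "round_trip l u = 0\<^sub>v (Suc m)"
  using \<open>k \<le> l\<close>
proof (induction rule: dec_induct)
  case base
  show ?case by (rule zero)
next
  case (step l)
  obtain c where "round_trip (Suc l) u = c \<cdot>\<^sub>v round_trip l u" using round_trip_Suc[OF u] by blast
  then show ?case using step by auto
qed

text \<open>The line for \<open>A \<circ> F\<close> is that of the genericity assumption. The assumption on \<open>B\<close> concerns \<open>B \<circ> G\<close>, which is conjugate to
  \<open>G \<circ> B\<close> by \<open>B\<close>; so the line for \<open>G \<circ> B\<close> is the image under \<open>A\<close> of the given one.\<close>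

lemma free_line_FA_iterate: "free_line m (iterate_forms FA k) v w"
proof (subst free_line_form_map[OF FA_iterate], assumption, intro allI impI)
  fix \<alpha> \<beta> :: 'k assume nz: "\<alpha> \<noteq> 0 \<or> \<beta> \<noteq> 0"
  have "form_map m FA = twisted_map m F A" by (rule ext) (rule form_map_FA)
  then have "form_map m (iterate_forms FA k) (line_vec m v w \<alpha> \<beta>) = (twisted_map m F A ^^ k) (line_vec m v w \<alpha> \<beta>)"
    using form_map_FA_iterate[of "line_vec m v w \<alpha> \<beta>"] by simp
  then show "form_map m (iterate_forms FA k) (line_vec m v w \<alpha> \<beta>) \<noteq> 0\<^sub>v (Suc m)"
    using avoid_F[of k] nz unfolding iterates_avoid_zero_def by auto
qed

lemma GB_iterate_conjugate:
  assumes u: "u \<in> carrier_vec (Suc m)"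
  shows "B *\<^sub>v (form_map m GB ^^ k) u = (twisted_map m G B ^^ k) (B *\<^sub>v u)"
proof (induction k)
  case (Suc k)
  then show ?case by (simp add: form_map_GB[OF iterate_form_map_carrier[OF u]])
qed simp

lemma free_line_GB_iterate:
  "\<exists>v'' w''. free_line m (iterate_forms GB k) v'' w''"
proof -
  define Av where "Av x = A *\<^sub>v vec (Suc m) x" for x
  have Av: "Av x \<in> carrier_vec (Suc m)" for x using A by (simp add: Av_def)
  have "free_line m (iterate_forms GB k) (($) (Av v')) (($) (Av w'))"
  proof (subst free_line_form_map[OF GB_iterate], assumption, intro allI impI)
    fix \<alpha> \<beta> :: 'k assume nz: "\<alpha> \<noteq> 0 \<or> \<beta> \<noteq> 0"
    let ?z = "line_vec m v' w' \<alpha> \<beta>"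
    have line: "line_vec m (($) (Av v')) (($) (Av w')) \<alpha> \<beta> = A *\<^sub>v ?z"
    proof (rule eq_vecI)
      fix i assume "i < dim_vec (A *\<^sub>v ?z)"
      then have i: "i \<le> m" using A by simp
      show "line_vec m (($) (Av v')) (($) (Av w')) \<alpha> \<beta> $ i = (A *\<^sub>v ?z) $ i"
        using i by (simp add: Av_def mult_mat_vec_index[OF A _ i] sum_distrib_left sum.distrib algebra_simps
          del: index_mult_mat_vec)
    qed (use A in auto)
    have Az: "A *\<^sub>v ?z \<in> carrier_vec (Suc m)" using A by auto
    have "(twisted_map m G B ^^ k) (B *\<^sub>v (A *\<^sub>v ?z)) = det A ^ (e ^ k) \<cdot>\<^sub>v (twisted_map m G B ^^ k) ?z"
      by (subst B_A) (simp_all add: twisted_iterate_smult[OF G B])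
    also have "\<dots> \<noteq> 0\<^sub>v (Suc m)"
    proof -
      have "(twisted_map m G B ^^ k) ?z \<noteq> 0\<^sub>v (Suc m)"
        using avoid_G[of k] nz unfolding iterates_avoid_zero_def B_def by blast
      then show ?thesis using det_A twisted_iterate_carrier[OF B, where v = ?z and F = G and k = k] by (simp add: smult_eq_0_vec)
    qed
    finally have "B *\<^sub>v (form_map m GB ^^ k) (A *\<^sub>v ?z) \<noteq> 0\<^sub>v (Suc m)" unfolding GB_iterate_conjugate[OF Az] .
    then have "(form_map m GB ^^ k) (A *\<^sub>v ?z) \<noteq> 0\<^sub>v (Suc m)" using B by auto
    then show "form_map m (iterate_forms GB k) (line_vec m (($) (Av v')) (($) (Av w')) \<alpha> \<beta>) \<noteq> 0\<^sub>v (Suc m)"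
      unfolding line form_map_GB_iterate[OF Az] .
  qed
  then show ?thesis by blast
qed

definition orb :: "nat \<Rightarrow> 'k vec" where "orb k = (twisted_map m F A ^^ k) (A *\<^sub>v q)"

lemma orb: "orb k \<in> carrier_vec (Suc m)"
  unfolding orb_def by (rule twisted_iterate_carrier[OF A]) (use A q in auto)

lemma orb_nonzero: "orb k $ 0 \<noteq> 0" "form_map m G (form_map m F (orb k)) \<noteq> 0\<^sub>v (Suc m)"
proof -
  have "eval (Var 0 * subst_poly F (G 0)) (orb k) \<noteq> 0" using orbit[of k] by (simp only: orbit_avoids_def orb_def mem_Collect_eq not_False_eq_True)
  then have *: "orb k $ 0 * form_map m G (form_map m F (orb k)) $ 0 \<noteq> 0"
    unfolding eval_eq_value_at value_at_hom.hom_mult value_at_Var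
    by (simp add: eval_subst_poly[OF G, unfolded eval_eq_value_at] form_map_def[of m G] eval_eq_value_at)
  then show "orb k $ 0 \<noteq> 0" by auto
  from * show "form_map m G (form_map m F (orb k)) \<noteq> 0\<^sub>v (Suc m)" by auto
qed

text \<open>Each step back from a point \<open>orb (Suc k)\<close> leads to a nonzero multiple of \<open>orb k\<close>, as \<open>G(F(y))\<close> does not vanish at \<open>y = orb k\<close>.\<close>

lemma orb_backward: "\<exists>c. c \<noteq> 0 \<and> (form_map m GB ^^ k) (orb k) = c \<cdot>\<^sub>v orb 0"
proof (induction k)
  case 0
  show ?case by (rule exI[of _ 1]) simp
next
  case (Suc k)
  then obtain c where c: "c \<noteq> 0" "(form_map m GB ^^ k) (orb k) = c \<cdot>\<^sub>v orb 0" by blast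
  obtain b where b: "form_map m G (form_map m F (orb k)) = b \<cdot>\<^sub>v orb k"
    using inverse_forms.FG_multiple[OF inverse orb] by blast
  have b0: "b \<noteq> 0"
  proof
    assume "b = 0"
    then have "form_map m G (form_map m F (orb k)) = 0\<^sub>v (Suc m)" using b orb[of k] by auto
    with orb_nonzero(2) show False by blast
  qed
  have "form_map m GB (orb (Suc k)) = (det A ^ e * b) \<cdot>\<^sub>v orb k"
    using GB_FA[of "orb k"] b by (simp add: orb_def form_map_FA smult_smult_assoc)
  then have "(form_map m GB ^^ Suc k) (orb (Suc k)) = (form_map m GB ^^ k) ((det A ^ e * b) \<cdot>\<^sub>v orb k)"
    by (simp add: funpow_swap1)
  also have "\<dots> = ((det A ^ e * b) ^ (e ^ k) * c) \<cdot>\<^sub>v orb 0"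
    using c by (simp add: iterate_form_map_smult[OF GB orb] smult_smult_assoc)
  finally show ?case using b0 c det_A by (intro exI[of _ "(det A ^ e * b) ^ (e ^ k) * c"]) simp
qed

text \<open>Going \<open>k\<close> steps back from \<open>orb k\<close> and forth again leads to a nonzero multiple of \<open>orb k\<close>. One more step back
  leads from \<open>A q\<close> to \<open>G(q)\<close>, where \<open>F\<close> vanishes.\<close>

lemma round_trip_orb: "round_trip k (orb k) \<noteq> 0\<^sub>v (Suc m)" "round_trip (Suc k) (orb k) = 0\<^sub>v (Suc m)"
proof -
  obtain c where c: "c \<noteq> 0" "(form_map m GB ^^ k) (orb k) = c \<cdot>\<^sub>v orb 0" using orb_backward by blast
  have FA_iter: "(form_map m FA ^^ k) (orb 0) = orb k"
  proof -
    have "form_map m FA = twisted_map m F A" by (rule ext) (rule form_map_FA)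
    then show ?thesis by (simp add: orb_def)
  qed
  have "round_trip k (orb k) = c ^ (d ^ k) \<cdot>\<^sub>v orb k"
    by (simp add: c(2) iterate_form_map_smult[OF FA orb] FA_iter)
  moreover have "orb k \<noteq> 0\<^sub>v (Suc m)" using orb_nonzero(1)[of k] by auto
  ultimately show "round_trip k (orb k) \<noteq> 0\<^sub>v (Suc m)" using c(1) orb by (simp add: smult_eq_0_vec)
  have "form_map m GB (orb 0) = det A ^ e \<cdot>\<^sub>v form_map m G q"
    using form_map_GB[OF orb[of 0]] B_A[OF q] form_map_smult[OF G q, where c = "det A"] by (simp add: orb_def)
  then have "(form_map m GB ^^ Suc k) (orb k) = (c ^ e * det A ^ e) \<cdot>\<^sub>v form_map m G q"
    by (simp add: c(2) form_map_smult[OF GB orb] smult_smult_assoc)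
  moreover have "(form_map m FA ^^ Suc k) (b \<cdot>\<^sub>v form_map m G q) = 0\<^sub>v (Suc m)" for b
  proof -
    have "form_map m FA (b \<cdot>\<^sub>v form_map m G q) = b ^ d \<cdot>\<^sub>v form_map m FA (form_map m G q)"
      by (rule form_map_smult[OF _ form_map_carrier]) (rule FA)
    also have "\<dots> = b ^ d \<cdot>\<^sub>v (A *\<^sub>v 0\<^sub>v (Suc m))" by (simp add: form_map_FA q_contracted)
    also have "\<dots> = 0\<^sub>v (Suc m)" using A by auto
    finally show ?thesis by (simp only: funpow_Suc_right o_apply FA_iterate_zero)
  qed
  ultimately show "round_trip (Suc k) (orb k) = 0\<^sub>v (Suc m)" by simp
qed

text \<open>The first coordinates of the round trips define an increasing sequence of hypersurfaces. If the zeros of the round trips were contained in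
  the hypersurface of \<open>T\<close>, these hypersurfaces would be contained in that of \<open>T x\<^sub>0\<close> and the sequence would stabilize,
  contradicting the behaviour of the round trips at the points \<open>orb k\<close>.\<close>

lemma round_trip_zeros_unbounded:
  assumes T: "T \<in> forms m t" "T \<noteq> 0"
  shows "\<exists>u\<in>carrier_vec (Suc m). u \<noteq> 0\<^sub>v (Suc m) \<and> eval T u \<noteq> 0 \<and> (\<exists>k. round_trip k u = 0\<^sub>v (Suc m))"
proof (rule ccontr)
  assume "\<not> ?thesis"
  then have contained: "eval T u = 0" if "u \<in> carrier_vec (Suc m)" "u \<noteq> 0\<^sub>v (Suc m)" "round_trip k u = 0\<^sub>v (Suc m)" for u k
    using that by blast
  define p where "p k = subst_poly (iterate_forms GB k) (iterate_forms FA k 0)" for k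
  have p: "p k \<in> forms m (e ^ k * d ^ k)" for k
    unfolding p_def by (rule forms_subst_poly[OF FA_iterate GB_iterate]) simp_all
  have p_eval: "eval (p k) u = round_trip k u $ 0" if "u \<in> carrier_vec (Suc m)" for u k
  proof -
    have "eval (p k) u = eval (iterate_forms FA k 0) (form_map m (iterate_forms GB k) u)"
      unfolding p_def by (rule eval_subst_poly[OF FA_iterate]) simp
    also have "\<dots> = form_map m (iterate_forms FA k) (form_map m (iterate_forms GB k) u) $ 0"
      by (simp add: form_map_def[of m "iterate_forms FA k"])
    also have "\<dots> = round_trip k u $ 0"
      using that iterate_form_map_carrier[OF that] by (simp add: form_map_FA_iterate form_map_GB_iterate)
    finally show ?thesis .
  qed
  have p_val: "value_at x (p k) = round_trip k (vec (Suc m) x) $ 0" for x k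
    using eval_vec[OF p, of k x] p_eval[of "vec (Suc m) x" k] by simp
  have sub: "value_at x (T * Var 0) = 0" if "value_at x (p k) = 0" for x k
  proof (cases "x 0 = 0")
    case True
    then show ?thesis by (simp only: value_at_hom.hom_mult value_at_Var mult_zero_right)
  next
    case False
    let ?u = "vec (Suc m) x"
    obtain c where c: "round_trip k ?u = c \<cdot>\<^sub>v ?u" using round_trip_multiple[of ?u k] by auto
    then have "c * x 0 = 0" using that by (simp add: p_val)
    then have "c = 0" using False by simp
    then have "round_trip k ?u = 0\<^sub>v (Suc m)" unfolding c by auto
    moreover have "?u \<noteq> 0\<^sub>v (Suc m)"
    proof
      assume "?u = 0\<^sub>v (Suc m)"
      from arg_cong[OF this, of "\<lambda>u. u $ 0"] False show False by simp
    qed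
    ultimately have "eval T ?u = 0" using contained[of ?u k] by simp
    then show ?thesis by (simp add: eval_vec[OF T(1)] value_at_hom.hom_mult)
  qed
  have chain: "value_at x (p (Suc k)) = 0" if "value_at x (p k) = 0" for x k
  proof -
    let ?u = "vec (Suc m) x"
    obtain c where c: "round_trip (Suc k) ?u = c \<cdot>\<^sub>v round_trip k ?u" using round_trip_Suc[of ?u k] by auto
    have "round_trip k ?u \<in> carrier_vec (Suc m)" by (intro iterate_form_map_carrier) simp
    then have "round_trip (Suc k) ?u $ 0 = c * round_trip k ?u $ 0" unfolding c by simp
    then show ?thesis using that by (simp only: p_val mult_zero_right)
  qed
  have "T * Var 0 \<noteq> 0" using T(2) Var_nonzero by (metis mult_eq_0_iff)
  then obtain n0 where n0: "\<And>k x. k \<ge> n0 \<Longrightarrow> value_at x (p k) = 0 \<Longrightarrow> value_at x (p n0) = 0"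
    using hypersurface_chain_stabilizes[of p m "\<lambda>k. e ^ k * d ^ k" "T * Var 0"] p sub chain by blast
  let ?x = "($) (orb n0)"
  have vec: "vec (Suc m) ?x = orb n0" using orb[of n0] by auto
  have "value_at ?x (p (Suc n0)) = 0" unfolding p_val vec round_trip_orb(2) by simp
  then have "value_at ?x (p n0) = 0" by (rule n0[rotated]) simp
  then have zero: "round_trip n0 (orb n0) $ 0 = 0" unfolding p_val vec .
  obtain c where c: "round_trip n0 (orb n0) = c \<cdot>\<^sub>v orb n0" using round_trip_multiple[OF orb] by blast
  have "c * orb n0 $ 0 = 0" using zero orb[of n0] unfolding c by simp
  then have "c = 0" using orb_nonzero(1) by simp
  then have "round_trip n0 (orb n0) = 0\<^sub>v (Suc m)" unfolding c using orb[of n0] by auto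
  with round_trip_orb(1) show False by blast
qed

text \<open>Off the hypersurface of \<open>T\<close>, infinitely many round trips are nonzero by recurrence, hence all are; but the zeros of the
  round trips are not contained in this hypersurface.\<close>

lemma not_regularizable:
  assumes W: "openin (zariski m) W" "W \<noteq> {}" "given_by m F f W"
  shows "\<not> regularizable m (proj_space m) (projectivity A \<circ>\<^sub>m f)"
proof
  assume reg: "regularizable m (proj_space m) (projectivity A \<circ>\<^sub>m f)"
  define Y where "Y = subst_poly F (G 0)"
  have Y: "Y \<in> forms m (d * e)" unfolding Y_def by (rule forms_subst_poly[OF G F]) simp_all
  have Y_eval: "eval Y u = form_map m G (form_map m F u) $ 0" for u
    by (simp add: Y_def eval_subst_poly[OF G] form_map_def[of m G])
  have "eval (Var 0 * Y) (orb 0) \<noteq> 0" using orbit[of 0] by (simp only: orbit_avoids_def orb_def mem_Collect_eq Y_def not_False_eq_True)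
  then have "Y \<noteq> 0" by (auto simp: eval_def)
  \<comment> \<open>on this open set \<open>G(F(u))\<close> is a nonzero multiple of \<open>u\<close>\<close>
  define W0 where "W0 = W \<inter> basic_open m Y"
  have W0: "openin (zariski m) W0" unfolding W0_def by (rule openin_Int[OF W(1) openin_basic_open[OF Y]])
  have W0_ne: "W0 \<noteq> {}" unfolding W0_def
    by (rule proj_space_opens_meet[OF W(1) openin_basic_open[OF Y] W(2) nonzero_form_basic_open[OF Y \<open>Y \<noteq> 0\<close>]])
  have W0P: "W0 \<subseteq> proj_space m" using openin_subset[OF W0] by (simp add: topspace_zariski)
  have A_nonzero: "A *\<^sub>v u \<noteq> 0\<^sub>v (Suc m)" if "u \<in> carrier_vec (Suc m)" "u \<noteq> 0\<^sub>v (Suc m)" for u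
  proof
    assume "A *\<^sub>v u = 0\<^sub>v (Suc m)"
    then have "det A \<cdot>\<^sub>v u = B *\<^sub>v 0\<^sub>v (Suc m)" using B_A[OF that(1)] by simp
    also have "\<dots> = 0\<^sub>v (Suc m)" using B by auto
    finally show False using det_A that by (simp add: smult_eq_0_vec)
  qed
  have rep: "given_by m FA (projectivity A \<circ>\<^sub>m f) W0"
    unfolding given_by_form_map
  proof (intro ballI)
    fix p u assume p: "p \<in> W0" "u \<in> p"
    have Fu: "form_map m F u \<noteq> 0\<^sub>v (Suc m)" "f p = Some (point_of (form_map m F u))"
      using W(3) p unfolding given_by_form_map W0_def by blast+
    have "(\<lambda>v. A *\<^sub>v v) ` point_of (form_map m F u) = point_of (A *\<^sub>v form_map m F u)"
    proof (rule Set.set_eqI)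
      fix x
      have "x \<in> (\<lambda>v. A *\<^sub>v v) ` point_of (form_map m F u) \<longleftrightarrow> (\<exists>c. c \<noteq> 0 \<and> x = A *\<^sub>v (c \<cdot>\<^sub>v form_map m F u))"
        unfolding point_of_def by blast
      then show "x \<in> (\<lambda>v. A *\<^sub>v v) ` point_of (form_map m F u) \<longleftrightarrow> x \<in> point_of (A *\<^sub>v form_map m F u)"
        unfolding point_of_def mult_mat_vec[OF A form_map_carrier] by blast
    qed
    moreover have "point_of (form_map m F u) \<in> projectivization (dim_col A)"
      using proj_spaceI[OF form_map_carrier Fu(1)] A by simp
    ultimately have "(projectivity A \<circ>\<^sub>m f) p = Some (point_of (form_map m FA u))"
      using Fu(2) by (simp add: projectivity_def map_comp_def form_map_FA)
    then show "form_map m FA u \<noteq> 0\<^sub>v (Suc m) \<and> (projectivity A \<circ>\<^sub>m f) p = Some (point_of (form_map m FA u))"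
      using A_nonzero[OF form_map_carrier Fu(1)] by (simp add: form_map_FA)
  qed
  have inv: "\<forall>p\<in>W0. \<forall>u\<in>p. \<exists>c. c \<noteq> 0 \<and> form_map m GB (form_map m FA u) = c \<cdot>\<^sub>v u"
  proof (intro ballI)
    fix p u assume p: "p \<in> W0" "u \<in> p"
    have pP: "p \<in> proj_space m" using p W0P by blast
    note u = proj_spaceD[OF pP p(2)]
    obtain c where c: "form_map m G (form_map m F u) = c \<cdot>\<^sub>v u"
      using inverse_forms.FG_multiple[OF inverse u(1)] by blast
    have "eval Y u \<noteq> 0" using basic_open_iff[OF Y p(2) pP] p(1) by (simp add: W0_def)
    then have "c \<noteq> 0" using u(1) by (auto simp: Y_eval c)
    then show "\<exists>c. c \<noteq> 0 \<and> form_map m GB (form_map m FA u) = c \<cdot>\<^sub>v u"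
      using det_A by (intro exI[of _ "det A ^ e * c"]) (simp add: GB_FA c smult_smult_assoc)
  qed
  define parallel where "parallel H E \<longleftrightarrow> (\<forall>i\<le>m. \<forall>j\<le>m. H i * E j = H j * E i)" for H E :: "nat \<Rightarrow> 'k mpoly"
  have "\<exists>T t. T \<in> forms m t \<and> T \<noteq> 0 \<and> (\<forall>u\<in>carrier_vec (Suc m). u \<noteq> 0\<^sub>v (Suc m) \<longrightarrow> eval T u \<noteq> 0 \<longrightarrow>
      (\<forall>N. \<exists>k\<ge>N. \<exists>H H'. parallel H (iterate_forms GB k) \<and> form_map m H u \<noteq> 0\<^sub>v (Suc m) \<and>
        parallel H' (iterate_forms FA k) \<and> form_map m H' (form_map m H u) \<noteq> 0\<^sub>v (Suc m)))"
    unfolding parallel_def by (rule regularizable_recurrence[OF reg _ _ W0 W0_ne rep inv]) (erule FA, erule GB)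
  then obtain T t where T: "T \<in> forms m t" "T \<noteq> 0"
    and recur: "\<forall>u\<in>carrier_vec (Suc m). u \<noteq> 0\<^sub>v (Suc m) \<longrightarrow> eval T u \<noteq> 0 \<longrightarrow>
      (\<forall>N. \<exists>k\<ge>N. \<exists>H H'. parallel H (iterate_forms GB k) \<and> form_map m H u \<noteq> 0\<^sub>v (Suc m) \<and>
        parallel H' (iterate_forms FA k) \<and> form_map m H' (form_map m H u) \<noteq> 0\<^sub>v (Suc m))"
    by (elim exE conjE)
  obtain u k where u: "u \<in> carrier_vec (Suc m)" "u \<noteq> 0\<^sub>v (Suc m)" "eval T u \<noteq> 0"
    and zero: "round_trip k u = 0\<^sub>v (Suc m)" using round_trip_zeros_unbounded[OF T] by blast
  obtain l H H' where l: "l \<ge> k"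
    and H: "parallel H (iterate_forms GB l)" "form_map m H u \<noteq> 0\<^sub>v (Suc m)"
    and H': "parallel H' (iterate_forms FA l)" "form_map m H' (form_map m H u) \<noteq> 0\<^sub>v (Suc m)"
    using recur u by blast
  have vanish: "form_map m K x = 0\<^sub>v (Suc m)"
    if E: "\<forall>i\<le>m. E i \<in> forms m r" and line: "free_line m E y z" and par: "parallel K E"
      and zero: "form_map m E x = 0\<^sub>v (Suc m)"
    for E K :: "nat \<Rightarrow> 'k mpoly" and r y z x
  proof -
    have "value_at (($) x) (E i) = 0" if "i \<le> m" for i
      using arg_cong[OF zero, of "\<lambda>u. u $ i"] that by (simp add: form_map_def eval_eq_value_at)
    then have "value_at (($) x) (K i) = 0" if "i \<le> m" for i
      using parallel_forms_vanish[of m E r y z K "($) x" i] E line par that unfolding parallel_def by blast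
    then show ?thesis by (intro eq_vecI) (auto simp: form_map_def eval_eq_value_at less_Suc_eq_le)
  qed
  let ?g = "(form_map m GB ^^ l) u"
  have g: "?g \<in> carrier_vec (Suc m)" by (rule iterate_form_map_carrier[OF u(1)])
  obtain y z where yz: "free_line m (iterate_forms GB l) y z" using free_line_GB_iterate by blast
  have "form_map m (iterate_forms GB l) u \<noteq> 0\<^sub>v (Suc m)"
    using vanish[OF _ yz H(1)] GB_iterate H(2) by blast
  then have g_ne: "?g \<noteq> 0\<^sub>v (Suc m)" by (simp add: form_map_GB_iterate[OF u(1)])
  \<comment> \<open>the two representations of the image point agree\<close>
  have "point_of (form_map m H u) = point_of ?g"
    unfolding point_of_eq_iff[OF form_map_carrier H(2) g g_ne]
  proof (intro allI impI)
    fix i j assume ij: "i < Suc m" "j < Suc m"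
    have "eval (H i * iterate_forms GB l j) u = eval (H j * iterate_forms GB l i) u" using H(1) ij unfolding parallel_def by simp
    then have "form_map m H u $ i * form_map m (iterate_forms GB l) u $ j = form_map m H u $ j * form_map m (iterate_forms GB l) u $ i"
      using ij by (simp add: form_map_def eval_eq_value_at value_at_hom.hom_mult)
    then show "form_map m H u $ i * ?g $ j = form_map m H u $ j * ?g $ i"
      by (simp add: form_map_GB_iterate[OF u(1)])
  qed
  then have "form_map m H u \<in> point_of ?g" using point_of_self by metis
  then obtain c where c: "c \<noteq> 0" "form_map m H u = c \<cdot>\<^sub>v ?g" by (auto simp: point_of_def)
  have scale: "(form_map m FA ^^ l) (c \<cdot>\<^sub>v ?g) = c ^ (d ^ l) \<cdot>\<^sub>v round_trip l u"
    by (rule iterate_form_map_smult[OF _ g]) (erule FA)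
  have "form_map m (iterate_forms FA l) (form_map m H u) \<noteq> 0\<^sub>v (Suc m)"
    using vanish[OF _ free_line_FA_iterate H'(1)] FA_iterate H'(2) by blast
  then have "round_trip l u \<noteq> 0\<^sub>v (Suc m)"
    unfolding form_map_FA_iterate[OF form_map_carrier] unfolding c(2) scale by auto
  with round_trip_zero_mono[OF u(1) l zero] show False by blast
qed

end

theorem corollary1p7:
  fixes f :: "'k::alg_closed_field point \<rightharpoonup> 'k point" and m d :: nat
  assumes "uncountable (UNIV :: 'k set)"
    and "birational_map m (proj_space m) m (proj_space m) f"
    and "has_degree m f d"
    and "d \<ge> 2"
  shows "\<exists>A \<in> PGL (m + 1). \<not> regularizable m (proj_space m) (A \<circ>\<^sub>m f)"
proof -
  from assms(3) obtain F W where F: "\<And>i. i \<le> m \<Longrightarrow> F i \<in> forms m d"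
    and coprime: "\<And>D. (\<And>i. i \<le> m \<Longrightarrow> D dvd F i) \<Longrightarrow> D dvd 1"
    and W: "openin (zariski m) W" "W \<noteq> {}" "given_by m F f W"
    unfolding has_degree_def by metis
  from assms(2) obtain f' where f: "rational_map m (proj_space m) m (proj_space m) f"
    and f': "rational_map m (proj_space m) m (proj_space m) f'"
    and f'f: "rat_eq m (proj_space m) (f' \<circ>\<^sub>m f) Some" and ff': "rat_eq m (proj_space m) (f \<circ>\<^sub>m f') Some"
    unfolding birational_map_def birational_inverse_def by blast
  obtain G e W' v' w' where G: "\<And>i. i \<le> m \<Longrightarrow> G i \<in> forms m e"
    and W': "openin (zariski m) W'" "W' \<noteq> {}" "given_by m G f' W'" and free_G: "free_line m G v' w'"
    using exists_representation_with_free_line[OF f'] by blast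
  have FG: "subst_poly G (F i) * Var j = subst_poly G (F j) * Var i" if "i \<le> m" "j \<le> m" for i j
    by (rule composition_parallel(1)[OF _ W _ W' f' ff' f'f that]) (erule F, erule G)
  have GF: "subst_poly F (G i) * Var j = subst_poly F (G j) * Var i" if "i \<le> m" "j \<le> m" for i j
    by (rule composition_parallel(1)[OF _ W' _ W f f'f ff' that]) (erule G, erule F)
  have FG_nonzero: "\<exists>i\<le>m. subst_poly G (F i) \<noteq> 0"
    by (rule composition_parallel(2)[OF _ W _ W' f' ff' f'f]) (erule F, erule G)
  have GF_nonzero: "\<exists>i\<le>m. subst_poly F (G i) \<noteq> 0"
    by (rule composition_parallel(2)[OF _ W' _ W f f'f ff']) (erule G, erule F)
  obtain a where a: "a \<le> m" "F a \<noteq> 0"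
  proof -
    have "\<exists>a\<le>m. F a \<noteq> 0"
    proof (rule ccontr)
      assume "\<not> ?thesis"
      then have "form_map m F u = 0\<^sub>v (Suc m)" for u by (intro eq_vecI) (auto simp: form_map_def eval_def)
      moreover obtain p where "p \<in> W" using W(2) by blast
      moreover then obtain u where "u \<in> p"
        using proj_space_rep[of p m] openin_subset[OF W(1)] by (auto simp: topspace_zariski)
      ultimately show False using W(3) unfolding given_by_form_map by blast
    qed
    then show ?thesis using that by blast
  qed
  have "\<exists>v w. free_line m F v w"
  proof (rule exists_free_line[where F = F, OF F a])
    fix D and x :: "nat \<Rightarrow> 'k" assume "\<And>i. i \<le> m \<Longrightarrow> D dvd F i"
    then have "D dvd 1" by (rule coprime)
    then obtain D' where "1 = D * D'" by (rule dvdE)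
    from arg_cong[OF this, of "value_at x"] show "value_at x D \<noteq> 0" by (auto simp: value_at_hom.hom_mult)
  qed
  then obtain v w where free_F: "free_line m F v w" by blast
  \<comment> \<open>two vectors with one entry are proportional, so a line on which \<open>F\<close> has no zeros requires \<open>m \<ge> 1\<close>\<close>
  have m: "m \<ge> 1"
  proof (rule ccontr)
    assume "\<not> m \<ge> 1"
    then have m0: "m = 0" by simp
    define \<alpha> \<beta> where "\<alpha> = (if v 0 = 0 then 1 else w 0)" and "\<beta> = (if v 0 = 0 then 0 else - v 0)"
    have nz: "\<alpha> \<noteq> 0 \<or> \<beta> \<noteq> 0" and z: "\<alpha> * v 0 + \<beta> * w 0 = 0" by (auto simp: \<alpha>_def \<beta>_def)
    have "value_at (\<lambda>j. \<alpha> * v j + \<beta> * w j) (F 0) = value_at (\<lambda>j. 0 * w j) (F 0)"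
      by (rule peval_forms_cong[OF F[of 0]]) (use m0 z in auto)
    also have "\<dots> = 0 ^ d * value_at w (F 0)" by (rule peval_forms_scale[OF F]) simp
    also have "\<dots> = 0" using assms(4) by (simp add: power_0_left)
    finally show False using free_F[unfolded free_line_def, rule_format, OF nz] m0 by simp
  qed
  have e: "e \<ge> 1"
  proof (rule ccontr)
    assume "\<not> e \<ge> 1"
    then have e0: "e = 0" by simp
    obtain i where i: "i \<le> m" "subst_poly G (F i) \<noteq> 0" using FG_nonzero by blast
    have form: "subst_poly G (F i) \<in> forms m 0" using forms_subst_poly[OF F[OF i(1)] G] e0 by simp
    have const: "value_at x (subst_poly G (F i)) = value_at y (subst_poly G (F i))" for x y
      using peval_forms_scale[OF form, of "\<lambda>c. c" 0 x] peval_forms_scale[OF form, of "\<lambda>c. c" 0 y] by simp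
    obtain j where j: "j \<le> m" "j \<noteq> i" using m i(1) by (cases "i = 0") auto
    have "value_at (\<lambda>l. if l = j then 1 else 0) (subst_poly G (F i) * Var j)
      = value_at (\<lambda>l. if l = j then 1 else 0) (subst_poly G (F j) * Var i)" using FG[OF i(1) j(1)] by simp
    then have "value_at (\<lambda>l. if l = j then 1 else 0) (subst_poly G (F i)) = 0"
      unfolding value_at_hom.hom_mult value_at_Var using j(2) by simp
    then have "value_at x (subst_poly G (F i)) = 0" for x using const by metis
    then have "subst_poly G (F i) = 0" by (rule value_at_all_zero_imp_zero[OF alg_closed_infinite])
    with i(2) show False by blast
  qed
  interpret inverse_forms m F G d e
    by unfold_locales (use F G assms(4) e FG GF in auto)
  have "d * e \<ge> 2" using assms(4) e by (metis mult_le_mono nat_mult_1_right)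
  then obtain q where q: "q \<in> carrier_vec (Suc m)" "q \<noteq> 0\<^sub>v (Suc m)" "form_map m F (form_map m G q) = 0\<^sub>v (Suc m)"
    using composition_zero[OF m] by blast
  define X where "X = Var 0 * subst_poly F (G 0)"
  have X: "X \<in> forms m (1 + d * e)"
    unfolding X_def by (intro forms_mult forms_Var forms_subst_poly[OF G F]) simp_all
  have "subst_poly F (G 0) \<noteq> 0"
  proof
    assume zero: "subst_poly F (G 0) = 0"
    obtain i where i: "i \<le> m" "subst_poly F (G i) \<noteq> 0" using GF_nonzero by blast
    have "subst_poly F (G i) * Var 0 = 0" using GF[OF i(1), of 0] zero by simp
    then show False using i(2) Var_nonzero[of 0] by (metis mult_eq_0_iff)
  qed
  then have "X \<noteq> 0" unfolding X_def using Var_nonzero[of 0] by simp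
  then obtain p where p: "p \<in> basic_open m X" using nonzero_form_basic_open[OF X] by blast
  then have "p \<in> proj_space m" using basic_open_subset by blast
  then obtain u where u: "u \<in> p" "u \<in> carrier_vec (Suc m)" using proj_space_rep by metis
  then have Xu: "eval X u \<noteq> 0" using p by (simp add: basic_open_def)
  have "form_map m F u \<noteq> 0\<^sub>v (Suc m)"
  proof
    assume "form_map m F u = 0\<^sub>v (Suc m)"
    then have "form_map m G (form_map m F u) $ 0 = 0" by (simp add: G_zero)
    then have "eval (subst_poly F (G 0)) u = 0" by (simp add: eval_subst_poly[OF G] form_map_def[of m G])
    then have "eval X u = 0" unfolding X_def eval_eq_value_at value_at_hom.hom_mult by simp
    with Xu show False ..
  qed
  then obtain A where mat: "A \<in> carrier_mat (Suc m) (Suc m)" "det A \<noteq> 0"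
    "\<And>k. A \<in> iterates_avoid_zero m F v w k" "\<And>k. adj_mat A \<in> iterates_avoid_zero m G v' w' k"
    "\<And>k. A \<in> orbit_avoids m F X q k"
    using exists_generic_matrix[OF assms(1) F _ free_F G e free_G X q(1,2) u(2) Xu] assms(4) by auto
  interpret generic_twist m F G d e A v w v' w' q
    by unfold_locales (use mat q in \<open>simp_all add: X_def\<close>)
  have "invertible_mat A"
    unfolding invertible_mat_def inverts_mat_def
  proof (intro conjI exI[of _ "(1 / det A) \<cdot>\<^sub>m adj_mat A"])
    show "square_mat A" using mat(1) by simp
    have *: "(1 / det A) \<cdot>\<^sub>m (det A \<cdot>\<^sub>m 1\<^sub>m (Suc m)) = (1\<^sub>m (Suc m) :: 'k mat)"
      by (rule eq_matI) (use mat(2) in auto)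
    note adj = adj_mat[OF mat(1)]
    show "A * ((1 / det A) \<cdot>\<^sub>m adj_mat A) = 1\<^sub>m (dim_row A)"
      using mult_smult_distrib[OF mat(1) adj(1)] adj(2) * mat(1) by simp
    show "(1 / det A) \<cdot>\<^sub>m adj_mat A * A = 1\<^sub>m (dim_row ((1 / det A) \<cdot>\<^sub>m adj_mat A))"
      using mult_smult_assoc_mat[OF adj(1) mat(1)] adj(1,3) * by simp
  qed
  then have "projectivity A \<in> PGL (m + 1)" using mat(1) unfolding PGL_def by auto
  with not_regularizable[OF W] show ?thesis by blast
qed

end
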